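(* Let $G$ be a metric graph of total length $L(G)$ and let $N^{\min}:[0,\infty)\to[0,\infty)$ be the counting function for optimal eigenvalues, defined by $$N^{\min}(\lambda):=\#\{k\in\mathbb{N}_0:\lambda_k^{\min}(G)\le\lambda\}.$$ Then $$\frac{N^{\min}(\lambda)}{\sqrt{\lambda}}\sim\frac{\sqrt{L(G)}}{2},\qquad\lambda\to\infty,$$ and $$\lambda_k^{\min}(G)\sim\frac{4k^2}{L(G)},\qquad k\to\infty,$$ where $a\sim b$ means that the quotient $a/b$ tends to $1$.
   Context: A metric graph $G=(V,E,\ell)$ is given by a finite connected graph $(V,E)$ with at least one edge (loops and multiple edges allowed) and edge lengths $\ell:E\to(0,\infty)$: each edge $e$ is (after choosing an orientation) identified with the interval $[0,\ell(e)]$, and $G$ is the compact topological space obtained by gluing endpoints of edges corresponding to the same vertex. $L(G)=\sum_{e\in E}\ell(e)$, $\mathbb{N}_0=\{0,1,2,\dots\}$. $dx$ is the Lebesgue measure on $G$. $H^1(G)$ is the space of continuous $f:G\to\mathbb{R}$ whose restriction to every open edge lies in $H^1((0,\ell(e)))$; $q(f,g)=\int_G f'g'\,dx$. A function $f\in H^1(G)$ is harmonic on an open set $O\subset G$ if $q(f,g)=0$ for all $g\in H^1(G)$ with $g\equiv 0$ on $G\setminus O$. For a Borel probability measure $\mu$ on $G$, let $H^1(G,\mu)=\{f\in H^1(G): f \text{ harmonic on } G\setminus\operatorname{supp}\mu\}$, regarded (injectively) as a dense subspace of $L^2(G,\mu)$. $H_\mu$ is the non-negative self-adjoint operator in $L^2(G,\mu)$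 associated with the closed form $q|_{H^1(G,\mu)}$: $f\in\operatorname{dom}(H_\mu)$ and $H_\mu f=g$ iff $f\in H^1(G,\mu)$ and $q(f,\varphi)=\int_G g\varphi\,d\mu$ for all $\varphi\in H^1(G,\mu)$. Its spectrum is discrete; its eigenvalues, counted with multiplicity, are $0=\lambda_0(H_\mu)<\lambda_1(H_\mu)\le\lambda_2(H_\mu)\le\cdots$, with the convention $\lambda_k(H_\mu):=+\infty$ for $k\ge\dim L^2(G,\mu)$. Let $\lambda_k^{\min}(G):=\min_{\mu}\lambda_k(H_\mu)$ over all Borel probability measures $\mu$ on $G$ (attained). *)

theory Defs
  imports
    "HOL-Analysis.Analysis"
    "HOL-Probability.Probability_Measure"
    "HOL-Library.Landau_Symbols"
    "HOL-Library.Function_Algebras"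
    "Graph_Theory.Digraph_Component"
begin

section \<open>Metric graphs\<close>

text \<open>
  The underlying multigraph is a finite digraph in the sense of \<^theory>\<open>Graph_Theory.Digraph\<close>
  (loops and parallel arcs are allowed); the direction of an arc is the chosen orientation of the
  edge, along which \<open>e\<close> is identified with \<open>[0, l e]\<close>.  Connectedness is that of the
  underlying undirected graph.
\<close>

locale metric_graph = fin_digraph G
  for G :: "('v, 'e) pre_digraph" and l :: "'e \<Rightarrow> real" +
  assumes connected: "Digraph_Component.connected G"
    and has_edge: "arcs G \<noteq> {}"
    and length_pos: "e \<in> arcs G \<Longrightarrow> 0 < l e"

definition total_length :: "('v, 'e) pre_digraph \<Rightarrow> ('e \<Rightarrow> real) \<Rightarrow> real" where
  "total_length G l = (\<Sum>e\<in>arcs G. l e)"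

text \<open>
  A point of the metric graph is a vertex or a point \<open>0 < t < l e\<close> in the interior of an edge;
  these are canonical representatives for the gluing of the edge intervals at their endpoints.
\<close>

datatype ('v, 'e) gpoint = Vertex 'v | Inner 'e real

definition gpoints :: "('v, 'e) pre_digraph \<Rightarrow> ('e \<Rightarrow> real) \<Rightarrow> ('v, 'e) gpoint set" where
  "gpoints G l = Vertex ` verts G \<union> {Inner e t |e t. e \<in> arcs G \<and> 0 < t \<and> t < l e}"

definition edge_point :: "('v, 'e) pre_digraph \<Rightarrow> ('e \<Rightarrow> real) \<Rightarrow> 'e \<Rightarrow> real \<Rightarrow> ('v, 'e) gpoint" where
  "edge_point G l e t =
     (if t \<le> 0 then Vertex (tail G e) else if l e \<le> t then Vertex (head G e) else Inner e t)"

definition edge_union :: "('v, 'e) pre_digraph \<Rightarrow> ('e \<Rightarrow> real) \<Rightarrow> ('e \<times> real) topology" where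
  "edge_union G l = sum_topology (\<lambda>e. top_of_set {0..l e}) (arcs G)"

text \<open>The quotient topology induced by the gluing map; cf. \<open>quotient_map_graph_topology\<close>.\<close>

definition graph_topology ::
    "('v, 'e) pre_digraph \<Rightarrow> ('e \<Rightarrow> real) \<Rightarrow> ('v, 'e) gpoint topology" where
  "graph_topology G l = topology (\<lambda>U. U \<subseteq> gpoints G l \<and>
     openin (edge_union G l) {z \<in> topspace (edge_union G l). case_prod (edge_point G l) z \<in> U})"

lemma openin_graph_topology:
  "openin (graph_topology G l) U \<longleftrightarrow> U \<subseteq> gpoints G l \<and>
     openin (edge_union G l) {z \<in> topspace (edge_union G l). case_prod (edge_point G l) z \<in> U}"
proof -
  let ?P = "\<lambda>U. {z \<in> topspace (edge_union G l). case_prod (edge_point G l) z \<in> U}"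
  have i: "?P (S \<inter> T) = ?P S \<inter> ?P T" for S T by auto
  have u: "?P (\<Union>\<K>) = \<Union> (?P ` \<K>)" for \<K> by auto
  have "istopology (\<lambda>U. U \<subseteq> gpoints G l \<and> openin (edge_union G l) (?P U))"
    unfolding istopology_def i u by (intro conjI allI impI openin_Int openin_Union) auto
  then show ?thesis
    by (simp add: graph_topology_def topology_inverse')
qed

context metric_graph
begin

lemma topspace_edge_union: "topspace (edge_union G l) = Sigma (arcs G) (\<lambda>e. {0..l e})"
  by (simp add: edge_union_def comp_def)

lemma vertex_covered:
  assumes "v \<in> verts G" shows "\<exists>e\<in>arcs G. tail G e = v \<or> head G e = v"
proof -
  obtain e where e: "e \<in> arcs G" using has_edge by blast
  have "v \<rightarrow>\<^sup>*\<^bsub>with_proj (mk_symmetric G)\<^esub> tail G e"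
    using connected e assms
    by (auto simp: Digraph_Component.connected_def strongly_connected_def)
  then have "(v, tail G e) \<in> rtrancl_on (verts G) (\<Union>e\<in>arcs G. {(tail G e, head G e), (head G e, tail G e)})"
    by (simp add: reachable_def parcs_mk_symmetric arcs_ends_def arc_to_ends_def)
  then show ?thesis
    by (cases rule: converse_rtrancl_on_cases) (use e in auto)
qed

lemma edge_point_image:
  "case_prod (edge_point G l) ` topspace (edge_union G l) = gpoints G l"
proof
  show "case_prod (edge_point G l) ` topspace (edge_union G l) \<subseteq> gpoints G l"
    by (auto simp: topspace_edge_union edge_point_def gpoints_def split: if_splits)
next
  show "gpoints G l \<subseteq> case_prod (edge_point G l) ` topspace (edge_union G l)"
  proof
    fix x assume "x \<in> gpoints G l"
    then consider v where "x = Vertex v" "v \<in> verts G"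
      | e t where "x = Inner e t" "e \<in> arcs G" "0 < t" "t < l e"
      by (auto simp: gpoints_def)
    then show "x \<in> case_prod (edge_point G l) ` topspace (edge_union G l)"
    proof cases
      case 1
      then obtain e where e: "e \<in> arcs G" "tail G e = v \<or> head G e = v"
        using vertex_covered by blast
      have "x = case_prod (edge_point G l) (e, 0) \<or> x = case_prod (edge_point G l) (e, l e)"
        using e 1 length_pos[OF e(1)] by (auto simp: edge_point_def)
      moreover have "(e, 0) \<in> topspace (edge_union G l)" "(e, l e) \<in> topspace (edge_union G l)"
        using e length_pos[OF e(1)] by (auto simp: topspace_edge_union)
      ultimately show ?thesis by blast
    next
      case 2
      then have "x = case_prod (edge_point G l) (e, t)" by (simp add: edge_point_def)
      moreover have "(e, t) \<in> topspace (edge_union G l)"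
        using 2 by (simp add: topspace_edge_union)
      ultimately show ?thesis by blast
    qed
  qed
qed

lemma topspace_graph_topology: "topspace (graph_topology G l) = gpoints G l"
proof -
  have "{z \<in> topspace (edge_union G l). case_prod (edge_point G l) z \<in> gpoints G l} =
          topspace (edge_union G l)"
    using edge_point_image by blast
  then have "openin (graph_topology G l) (gpoints G l)"
    by (simp add: openin_graph_topology)
  then show ?thesis
    by (metis openin_graph_topology openin_subset openin_topspace subset_antisym)
qed

lemma quotient_map_graph_topology:
  "quotient_map (edge_union G l) (graph_topology G l) (case_prod (edge_point G l))"
  unfolding quotient_map_def
  by (simp add: edge_point_image topspace_graph_topology openin_graph_topology)

end

section \<open>Sobolev spaces\<close>

text \<open>Test functions on \<open>(0, a)\<close>, extended by \<open>0\<close> to the real line.\<close>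

definition test_functions :: "real \<Rightarrow> (real \<Rightarrow> real) set" where
  "test_functions a = {\<phi>. (\<forall>n. (deriv ^^ n) \<phi> differentiable_on UNIV) \<and>
     compact (closure {t. \<phi> t \<noteq> 0}) \<and> closure {t. \<phi> t \<noteq> 0} \<subseteq> {0<..<a}}"

definition L2_interval :: "real \<Rightarrow> (real \<Rightarrow> real) set" where
  "L2_interval a = {u. set_borel_measurable lborel {0<..<a} u \<and>
     set_integrable lborel {0<..<a} (\<lambda>t. (u t)\<^sup>2)}"

definition is_weak_deriv :: "real \<Rightarrow> (real \<Rightarrow> real) \<Rightarrow> (real \<Rightarrow> real) \<Rightarrow> bool" where
  "is_weak_deriv a u v \<longleftrightarrow> (\<forall>\<phi>\<in>test_functions a.
     (LINT t:{0<..<a}|lborel. u t * deriv \<phi> t) = - (LINT t:{0<..<a}|lborel. v t * \<phi> t))"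

definition H1_interval :: "real \<Rightarrow> (real \<Rightarrow> real) set" where
  "H1_interval a = {u \<in> L2_interval a. \<exists>v\<in>L2_interval a. is_weak_deriv a u v}"

text \<open>The weak derivative is unique only up to null sets; a representative is chosen.\<close>

definition weak_deriv :: "real \<Rightarrow> (real \<Rightarrow> real) \<Rightarrow> real \<Rightarrow> real" where
  "weak_deriv a u = (SOME v. v \<in> L2_interval a \<and> is_weak_deriv a u v)"

definition on_edge ::
    "('v, 'e) pre_digraph \<Rightarrow> ('e \<Rightarrow> real) \<Rightarrow> (('v, 'e) gpoint \<Rightarrow> real) \<Rightarrow> 'e \<Rightarrow> real \<Rightarrow> real" where
  "on_edge G l f e t = f (edge_point G l e t)"

text \<open>
  Real functions on the metric graph are represented by total functions vanishing off
  \<open>gpoints G l\<close>, so that equality and linear independence have their usual meaning.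
\<close>

definition H1 :: "('v, 'e) pre_digraph \<Rightarrow> ('e \<Rightarrow> real) \<Rightarrow> (('v, 'e) gpoint \<Rightarrow> real) set" where
  "H1 G l = {f. (\<forall>x. x \<notin> gpoints G l \<longrightarrow> f x = 0) \<and>
     continuous_map (graph_topology G l) euclideanreal f \<and>
     (\<forall>e\<in>arcs G. on_edge G l f e \<in> H1_interval (l e))}"

definition qform :: "('v, 'e) pre_digraph \<Rightarrow> ('e \<Rightarrow> real) \<Rightarrow>
    (('v, 'e) gpoint \<Rightarrow> real) \<Rightarrow> (('v, 'e) gpoint \<Rightarrow> real) \<Rightarrow> real" where
  "qform G l f g = (\<Sum>e\<in>arcs G. LINT t:{0<..<l e}|lborel.
     weak_deriv (l e) (on_edge G l f e) t * weak_deriv (l e) (on_edge G l g e) t)"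

definition harmonic_on_graph :: "('v, 'e) pre_digraph \<Rightarrow> ('e \<Rightarrow> real) \<Rightarrow>
    ('v, 'e) gpoint set \<Rightarrow> (('v, 'e) gpoint \<Rightarrow> real) \<Rightarrow> bool" where
  "harmonic_on_graph G l U f \<longleftrightarrow>
     f \<in> H1 G l \<and> (\<forall>g\<in>H1 G l. (\<forall>x\<in>gpoints G l - U. g x = 0) \<longrightarrow> qform G l f g = 0)"

section \<open>The operators \<open>H\<^sub>\<mu>\<close>\<close>

definition borel_prob_measures ::
    "('v, 'e) pre_digraph \<Rightarrow> ('e \<Rightarrow> real) \<Rightarrow> ('v, 'e) gpoint measure set" where
  "borel_prob_measures G l = {\<mu>. prob_space \<mu> \<and>
     sets \<mu> = sets (sigma (gpoints G l) {U. openin (graph_topology G l) U})}"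

definition msupport :: "('v, 'e) pre_digraph \<Rightarrow> ('e \<Rightarrow> real) \<Rightarrow>
    ('v, 'e) gpoint measure \<Rightarrow> ('v, 'e) gpoint set" where
  "msupport G l \<mu> = {x \<in> gpoints G l. \<forall>U. openin (graph_topology G l) U \<and> x \<in> U \<longrightarrow> emeasure \<mu> U > 0}"

definition H1_mu :: "('v, 'e) pre_digraph \<Rightarrow> ('e \<Rightarrow> real) \<Rightarrow>
    ('v, 'e) gpoint measure \<Rightarrow> (('v, 'e) gpoint \<Rightarrow> real) set" where
  "H1_mu G l \<mu> = {f \<in> H1 G l. harmonic_on_graph G l (gpoints G l - msupport G l \<mu>) f}"

text \<open>
  \<open>H_op G l \<mu> f g\<close> means \<open>f \<in> dom H\<^sub>\<mu>\<close> and \<open>H\<^sub>\<mu> f = g\<close> in \<open>L\<^sup>2(G, \<mu>)\<close>; the relation is invariant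
  under changing \<open>g\<close> on a \<open>\<mu>\<close>-null set.
\<close>

definition H_op :: "('v, 'e) pre_digraph \<Rightarrow> ('e \<Rightarrow> real) \<Rightarrow> ('v, 'e) gpoint measure \<Rightarrow>
    (('v, 'e) gpoint \<Rightarrow> real) \<Rightarrow> (('v, 'e) gpoint \<Rightarrow> real) \<Rightarrow> bool" where
  "H_op G l \<mu> f g \<longleftrightarrow> f \<in> H1_mu G l \<mu> \<and>
     g \<in> borel_measurable \<mu> \<and> integrable \<mu> (\<lambda>x. (g x)\<^sup>2) \<and>
     (\<forall>\<phi>\<in>H1_mu G l \<mu>. qform G l f \<phi> = (LINT x|\<mu>. g x * \<phi> x))"

definition eigenspace :: "('v, 'e) pre_digraph \<Rightarrow> ('e \<Rightarrow> real) \<Rightarrow>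
    ('v, 'e) gpoint measure \<Rightarrow> real \<Rightarrow> (('v, 'e) gpoint \<Rightarrow> real) set" where
  "eigenspace G l \<mu> \<eta> = {f. H_op G l \<mu> f (\<lambda>x. \<eta> * f x)}"

text \<open>
  Since \<open>H1_mu G l \<mu>\<close> embeds injectively into \<open>L\<^sup>2(G, \<mu>)\<close>, nonvanishing and linear independence
  may be taken pointwise.
\<close>

definition eigenvalues :: "('v, 'e) pre_digraph \<Rightarrow> ('e \<Rightarrow> real) \<Rightarrow>
    ('v, 'e) gpoint measure \<Rightarrow> real set" where
  "eigenvalues G l \<mu> = {\<eta>. \<exists>f\<in>eigenspace G l \<mu> \<eta>. f \<noteq> 0}"

global_interpretation fun_space: vector_space "\<lambda>(c::real) (f :: 'x \<Rightarrow> real) x. c * f x"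
  by unfold_locales (auto simp: fun_eq_iff algebra_simps)

definition multiplicity_of :: "('v, 'e) pre_digraph \<Rightarrow> ('e \<Rightarrow> real) \<Rightarrow>
    ('v, 'e) gpoint measure \<Rightarrow> real \<Rightarrow> nat" where
  "multiplicity_of G l \<mu> \<eta> = fun_space.dim (eigenspace G l \<mu> \<eta>)"

text \<open>
  The \<open>k\<close>-th eigenvalue, counted with multiplicity and starting at \<open>k = 0\<close>, is the least \<open>r\<close> such
  that more than \<open>k\<close> eigenvalues (with multiplicity) are at most \<open>r\<close>.  As the spectrum is discrete,
  the total number of eigenvalues is \<open>dim L\<^sup>2(G, \<mu>)\<close>; for \<open>k \<ge> dim L\<^sup>2(G, \<mu>)\<close> the infimum is over the
  empty set and equals \<open>\<infinity>\<close>.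
\<close>

definition eigenvalue_k :: "('v, 'e) pre_digraph \<Rightarrow> ('e \<Rightarrow> real) \<Rightarrow>
    ('v, 'e) gpoint measure \<Rightarrow> nat \<Rightarrow> ereal" where
  "eigenvalue_k G l \<mu> k = Inf {ereal r |r.
     \<exists>S. finite S \<and> S \<subseteq> {\<eta> \<in> eigenvalues G l \<mu>. \<eta> \<le> r} \<and> k < (\<Sum>\<eta>\<in>S. multiplicity_of G l \<mu> \<eta>)}"

definition eigenvalue_min :: "('v, 'e) pre_digraph \<Rightarrow> ('e \<Rightarrow> real) \<Rightarrow> nat \<Rightarrow> ereal" where
  "eigenvalue_min G l k = (INF \<mu>\<in>borel_prob_measures G l. eigenvalue_k G l \<mu> k)"

definition N_min :: "('v, 'e) pre_digraph \<Rightarrow> ('e \<Rightarrow> real) \<Rightarrow> real \<Rightarrow> nat" where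
  "N_min G l r = card {k::nat. eigenvalue_min G l k \<le> ereal r}"

end

theory Submission
  imports Defs "HOL-Probability.Distribution_Functions"
begin

text \<open>
  Both asymptotics follow from \<open>4 (k - C)\<^sup>2 / L \<le> \<lambda>\<^sub>k\<^sup>m\<^sup>i\<^sup>n \<le> 4 (k + C)\<^sup>2 / L\<close> with a constant \<open>C\<close> that
  depends only on the graph.

  Lower bound: a function vanishing at both ends of a segment of length \<open>a\<close> satisfies
  \<open>f\<^sup>2 \<le> a/4 \<integral> f'\<^sup>2\<close> there, so \<open>\<integral> f\<^sup>2 d\<mu> \<le> 1/r \<integral> f'\<^sup>2\<close> on a segment with \<open>a \<mu>(segment) \<le> 4/r\<close>.  Cutting
  each edge greedily into maximal segments of this kind, every completed segment has
  \<open>\<surd>(a \<mu>(segment)) \<ge> 2/\<surd>r\<close>, so by the Cauchy--Schwarz inequality there are at most \<open>\<surd>(L r)/2\<close> cuts,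
  whatever \<open>\<mu>\<close> is.  More than \<open>|V| + \<surd>(L r)/2\<close> eigenvalues below \<open>r\<close> would give a nonzero combination
  of eigenfunctions vanishing at all vertices and cuts, which contradicts the Rayleigh quotient.

  Upper bound: subdivide every edge into \<open>n\<^sub>e\<close> equal segments and put on each node the sum of the
  reciprocal lengths of the adjacent segments, normalized.  Since
  \<open>(f x - f y)\<^sup>2 / h \<le> 2 (f\<^sup>2 x + f\<^sup>2 y) / h\<close>, all Rayleigh quotients of piecewise linear functions are at
  most \<open>4 \<Sum>\<^sub>e n\<^sub>e\<^sup>2 / l\<^sub>e\<close>, and there are as many eigenvalues as nodes; take \<open>n\<^sub>e\<close> close to \<open>k l\<^sub>e / L\<close>.
\<close>

section \<open>Weak derivatives on an interval\<close>

text \<open>\<open>eigenvalue_k\<close> is an infimum over finite sets of eigenvalues weighted by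
  \<open>dim\<close>. A lower bound has to control every finite set of eigenvalues of every measure,
  by linear algebra on the span of the eigenfunctions; an upper bound only has to exhibit one
  measure and one finite set. For a measure on the nodes of a subdivision the eigenvalue equation
  involves node values alone, so its eigenfunctions come from diagonalising two quadratic forms on a
  finite-dimensional space, here by successive maximisation of Rayleigh quotients.

  The two bounds share their leading constant: equality in the Cauchy--Schwarz step means mass
  proportional to length, and n_e close to k l_e / L comes near this and makes the sum of n_e^2 /
  l_e close to k^2 / L. The vertices and the rounding of n_e shift k by a bounded amount only.

  \<open>weak_deriv\<close> is an arbitrary choice modulo null sets, without a formula. Computations
  therefore go through the fundamental theorem of calculus, valid at every point of a closed edge
  because functions in \<open>H1\<close> are continuous there.\<close>

definition smooth :: "(real \<Rightarrow> real) \<Rightarrow> bool" where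
  "smooth f \<longleftrightarrow> (\<forall>n. (deriv ^^ n) f differentiable_on UNIV)"

text \<open>Smoothness ranges over all iterated derivatives. A set of differentiable functions
  closed under \<open>deriv\<close> settles them at once, without a formula for the n-th derivative;
  each closure property below amounts to the choice of such a set.\<close>

lemma smooth_coinduct:
  assumes "f \<in> S" and "\<And>g. g \<in> S \<Longrightarrow> g differentiable_on UNIV \<and> deriv g \<in> S"
  shows "smooth f"
proof -
  have "(deriv ^^ n) f \<in> S" for n
    by (induction n) (use assms in auto)
  then show ?thesis using assms(2) by (simp add: smooth_def)
qed

lemma smooth_deriv: "smooth f \<Longrightarrow> smooth (deriv f)"
  unfolding smooth_def by (metis funpow_Suc_right o_apply)

lemma smooth_DERIV: "smooth f \<Longrightarrow> (f has_real_derivative deriv f x) (at x)"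
  unfolding smooth_def
  by (metis DERIV_deriv_iff_real_differentiable UNIV_I differentiable_on_def funpow_0)

lemma smooth_continuous: "smooth f \<Longrightarrow> continuous_on A f"
  by (meson DERIV_isCont continuous_at_imp_continuous_on smooth_DERIV)

lemma differentiable_on_DERIV: "(\<And>x. (f has_real_derivative g x) (at x)) \<Longrightarrow> f differentiable_on UNIV"
  by (meson differentiable_on_def real_differentiable_def)

lemma deriv_eqI: "(\<And>x. (f has_real_derivative g x) (at x)) \<Longrightarrow> deriv f = g"
  by (auto intro!: ext DERIV_imp_deriv)

inductive_set smooth_products :: "(real \<Rightarrow> real) set" where
  prod: "smooth f \<Longrightarrow> smooth g \<Longrightarrow> (\<lambda>x. f x * g x) \<in> smooth_products"
| add: "f \<in> smooth_products \<Longrightarrow> g \<in> smooth_products \<Longrightarrow> (\<lambda>x. f x + g x) \<in> smooth_products"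

lemma smooth_products_DERIV: "f \<in> smooth_products \<Longrightarrow> \<exists>g\<in>smooth_products. \<forall>x. (f has_real_derivative g x) (at x)"
proof (induction rule: smooth_products.induct)
  case (prod f g)
  then show ?case
    by (intro bexI[of _ "\<lambda>x. deriv f x * g x + deriv g x * f x"])
       (auto intro!: DERIV_mult smooth_products.intros smooth_DERIV smooth_deriv)
next
  case (add f g)
  then obtain f' g' where "f' \<in> smooth_products" "g' \<in> smooth_products"
    "\<forall>x. (f has_real_derivative f' x) (at x)" "\<forall>x. (g has_real_derivative g' x) (at x)" by blast
  then show ?case
    by (intro bexI[of _ "\<lambda>x. f' x + g' x"]) (auto intro!: DERIV_add smooth_products.intros)
qed

lemma smooth_mult: assumes "smooth f" "smooth g" shows "smooth (\<lambda>x. f x * g x)"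
proof (rule smooth_coinduct[where S=smooth_products])
  show "(\<lambda>x. f x * g x) \<in> smooth_products" using assms by (rule smooth_products.prod)
next
  fix h assume "h \<in> smooth_products"
  then show "h differentiable_on UNIV \<and> deriv h \<in> smooth_products"
    using smooth_products_DERIV deriv_eqI differentiable_on_DERIV by metis
qed

lemma smooth_affine: assumes "smooth f" shows "smooth (\<lambda>x. f (a * x + b))"
\<comment> \<open>The factor \<open>c\<close> collects the powers of \<open>a\<close> produced by
  the chain rule.\<close>
proof (rule smooth_coinduct[where S="{\<lambda>x. c * g (a * x + b) |c g. smooth g}"])
  show "(\<lambda>x. f (a * x + b)) \<in> {\<lambda>x. c * g (a * x + b) |c g. smooth g}"
    using assms by (intro CollectI exI[of _ 1] exI[of _ f]) simp
next
  fix h assume "h \<in> {\<lambda>x. c * g (a * x + b) |c g. smooth g}"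
  then obtain c g where h: "h = (\<lambda>x. c * g (a * x + b))" "smooth g" by blast
  have D: "(h has_real_derivative (c * a) * deriv g (a * x + b)) (at x)" for x
  proof -
    have "((\<lambda>x. g (a * x + b)) has_real_derivative deriv g (a * x + b) * a) (at x)"
      by (rule DERIV_chain2[OF smooth_DERIV[OF h(2)]]) (auto intro!: derivative_eq_intros)
    then show ?thesis unfolding h(1)
      by (auto intro!: derivative_eq_intros)
  qed
  then show "h differentiable_on UNIV \<and> deriv h \<in> {\<lambda>x. c * g (a * x + b) |c g. smooth g}"
    using deriv_eqI[OF D] differentiable_on_DERIV[OF D] smooth_deriv[OF h(2)] by blast
qed

lemma smooth_diff: assumes "smooth f" "smooth g" shows "smooth (\<lambda>x. f x - g x)"
proof (rule smooth_coinduct[where S="{\<lambda>x. f x - g x |f g. smooth f \<and> smooth g}"])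
  show "(\<lambda>x. f x - g x) \<in> {\<lambda>x. f x - g x |f g. smooth f \<and> smooth g}"
    using assms by blast
next
  fix h assume "h \<in> {\<lambda>x. f x - g x |f g. smooth f \<and> smooth g}"
  then obtain f g where h: "h = (\<lambda>x. f x - g x)" "smooth f" "smooth g" by blast
  have D: "(h has_real_derivative deriv f x - deriv g x) (at x)" for x
    unfolding h(1) by (intro DERIV_diff smooth_DERIV h)
  then show "h differentiable_on UNIV \<and> deriv h \<in> {\<lambda>x. f x - g x |f g. smooth f \<and> smooth g}"
    using deriv_eqI[OF D] differentiable_on_DERIV[OF D] smooth_deriv[OF h(2)] smooth_deriv[OF h(3)]
    by blast
qed

section \<open>Flat functions and a smooth step\<close>

lemma poly_over_exp: "((\<lambda>x::real. poly p x / exp x) \<longlongrightarrow> 0) at_top"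
proof -
  have "((\<lambda>x::real. \<Sum>i\<le>degree p. coeff p i * (x ^ i / exp x)) \<longlongrightarrow> (\<Sum>i\<le>degree p. coeff p i * 0)) at_top"
    by (intro tendsto_intros tendsto_power_div_exp_0)
  then show ?thesis by (simp add: poly_altdef sum_divide_distrib)
qed

text \<open>The classical exp(-1/x), extended by 0, times a polynomial in 1/x: the polynomial factor
  makes the family closed under differentiation.\<close>

definition flat :: "real poly \<Rightarrow> real \<Rightarrow> real" where
  "flat p x = (if x \<le> 0 then 0 else poly p (1 / x) * exp (- (1 / x)))"

text \<open>For positive x the product and chain rules give (p - p')(1/x) / x^2 times exp(-1/x), and
  1 / x^2 is the monomial of degree 2 at 1/x. At 0 the right difference quotient becomes, with y =
  1/h, a polynomial in y over exp y.\<close>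

lemma flat_DERIV:
  "(flat p has_real_derivative flat (monom 1 2 * (p - pderiv p)) x) (at x)"
proof (cases "x = 0")
  case True
  have "((\<lambda>h. flat p h / h) \<longlongrightarrow> 0) (at_right 0)"
  proof -
    have "((\<lambda>y::real. poly (monom 1 1 * p) y / exp y) \<longlongrightarrow> 0) at_top" by (rule poly_over_exp)
    then have "((\<lambda>h::real. poly (monom 1 1 * p) (inverse h) / exp (inverse h)) \<longlongrightarrow> 0) (at_right 0)"
      using filterlim_compose filterlim_inverse_at_top_right by blast
    then show ?thesis
      by (rule Lim_transform_eventually)
         (auto simp: eventually_at_filter flat_def exp_minus field_simps poly_monom)
  qed
  moreover have "((\<lambda>h. flat p h / h) \<longlongrightarrow> 0) (at_left 0)"
    by (rule Lim_transform_eventually[OF tendsto_const]) (auto simp: eventually_at_filter flat_def)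
  ultimately have "((\<lambda>h. flat p h / h) \<longlongrightarrow> 0) (at 0)"
    by (simp add: filterlim_at_split)
  then show ?thesis using True by (simp add: DERIV_def flat_def)
next
  case False
  then consider "x < 0" | "x > 0" by linarith
  then show ?thesis
  proof cases
    case 1
    have "((\<lambda>x. 0) has_real_derivative 0) (at x)" by simp
    then have "(flat p has_real_derivative 0) (at x)"
      by (rule has_field_derivative_transform_within_open[where S="{..<0}"]) (use 1 in \<open>auto simp: flat_def\<close>)
    then show ?thesis using 1 by (simp add: flat_def)
  next
    case 2
    have "((\<lambda>x. poly p (1/x) * exp (- (1 / x))) has_real_derivative
       poly (monom 1 2 * (p - pderiv p)) (1 / x) * exp (- (1 / x))) (at x)"
      using 2 by (auto intro!: derivative_eq_intros poly_DERIV[THEN DERIV_chain2] simp: poly_monom field_simps power2_eq_square)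
    then have "(flat p has_real_derivative poly (monom 1 2 * (p - pderiv p)) (1 / x) * exp (- (1 / x))) (at x)"
      by (rule has_field_derivative_transform_within_open[where S="{0<..}"]) (use 2 in \<open>auto simp: flat_def\<close>)
    then show ?thesis using 2 by (simp add: flat_def)
  qed
qed

lemma smooth_flat: "smooth (flat p)"
  by (rule smooth_coinduct[where S="range flat"])
     (use flat_DERIV in \<open>auto intro: differentiable_on_DERIV simp: deriv_eqI[OF flat_DERIV]\<close>)

text \<open>The step is a normalised primitive of the bump \<open>b\<close>, a product of two
  reflected flat functions. The sign of the derivative is recorded because its rescalings serve as
  non-negative kernels of mass 1.\<close>

lemma ex_smooth_step:
  "\<exists>H. smooth H \<and> (\<forall>x\<le>0. H x = 0) \<and> (\<forall>x\<ge>1. H x = 1) \<and> (\<forall>x. 0 \<le> deriv H x)"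
proof -
  define b where "b x = flat 1 x * flat 1 (-1 * x + 1)" for x
  have sb: "smooth b" unfolding b_def by (intro smooth_mult smooth_flat smooth_affine[OF smooth_flat])
  have b_cont: "continuous_on A b" for A using sb by (rule smooth_continuous)
  have b_nonneg: "0 \<le> b x" for x by (auto simp: b_def flat_def)
  have b_zero: "b x = 0" if "x \<le> 0 \<or> x \<ge> 1" for x using that by (auto simp: b_def flat_def)
  \<comment> \<open>The base point -1 lies left of the support of \<open>b\<close>, so for x \<le>
    -1, where the integral yields no two-sided derivative, \<open>F\<close> vanishes in a whole
    neighbourhood.\<close>
  define F where "F x = integral {-1..x} b" for x
  have FD: "(F has_real_derivative b x) (at x)" for x
  proof (cases "x > -1")
    case True
    have "(F has_real_derivative b x) (at x within {-1..x+1})"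
      unfolding F_def by (rule integral_has_real_derivative) (use b_cont True in auto)
    then show ?thesis using True by (simp add: at_within_Icc_at)
  next
    case False
    have "((\<lambda>x. 0) has_real_derivative 0) (at x)" by simp
    then have "(F has_real_derivative 0) (at x)"
    proof (rule has_field_derivative_transform_within_open[where S="{..<0}"])
      fix y :: real assume y: "y \<in> {..<0}"
      have "integral {-1..y} b = integral {-1..y} (\<lambda>_. 0)"
        by (rule integral_cong) (use y b_zero in auto)
      then show "0 = F y" by (simp add: F_def)
    qed (use False in auto)
    then show ?thesis using False b_zero by simp
  qed
  have F0: "F x = 0" if "x \<le> 0" for x
  proof -
    have "integral {-1..x} b = integral {-1..x} (\<lambda>_. 0)"
      by (rule integral_cong) (use that b_zero in auto)
    then show ?thesis by (simp add: F_def)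
  qed
  have F1: "F x = F 1" if "x \<ge> 1" for x
  proof (cases "x = 1")
    case False
    then show ?thesis
      by (intro DERIV_isconst_end[of 1 x F])
         (use that FD b_zero in \<open>auto intro: DERIV_isCont DERIV_continuous_on continuous_at_imp_continuous_on simp: le_less\<close>,
          metis FD b_zero less_imp_le)
  qed simp
  have mono: "F x \<le> F y" if "x \<le> y" for x y
    using that FD b_nonneg by (meson DERIV_nonneg_imp_nondecreasing)
  have "0 < F 1"
  proof -
    have "b (1/2) > 0" by (simp add: b_def flat_def)
    then obtain d where d: "d > 0" "\<And>h. 0 < h \<Longrightarrow> h < d \<Longrightarrow> F (1/2) < F (1/2 + h)"
      using DERIV_pos_inc_right[OF FD] by blast
    define h where "h = min (d/2) (1/2)"
    have "F (1/2) < F (1/2 + h)" using d(1) by (intro d(2)) (auto simp: h_def)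
    also have "\<dots> \<le> F 1" by (rule mono) (simp add: h_def)
    finally show ?thesis using mono[of 0 "1/2"] F0[of 0] by simp
  qed
  have sF: "smooth F"
  proof (rule smooth_coinduct[where S="insert F {g. smooth g}"])
    show "g differentiable_on UNIV \<and> deriv g \<in> insert F {g. smooth g}" if "g \<in> insert F {g. smooth g}" for g
    proof (cases "g = F")
      case True
      then show ?thesis using differentiable_on_DERIV[OF FD] deriv_eqI[OF FD] sb by simp
    next
      case False
      then have "smooth g" using that by simp
      then show ?thesis using differentiable_on_DERIV[OF smooth_DERIV] smooth_deriv by blast
    qed
  qed simp
  have sc: "smooth (\<lambda>_. c)" for c
    by (rule smooth_coinduct[where S="range (\<lambda>c _. c)"]) auto
  define H where "H x = (1 / F 1) * F x" for x
  have sH: "smooth H" unfolding H_def by (intro smooth_mult sc sF)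
  have DH: "(H has_real_derivative (1 / F 1) * b x) (at x)" for x
    unfolding H_def by (intro DERIV_cmult FD)
  show ?thesis
  proof (intro exI conjI allI impI)
    show "smooth H" by (rule sH)
    show "H x = 0" if "x \<le> 0" for x using F0[OF that] by (simp add: H_def)
    show "H x = 1" if "1 \<le> x" for x using F1[OF that] \<open>0 < F 1\<close> by (simp add: H_def)
    show "0 \<le> deriv H x" for x
      unfolding deriv_eqI[OF DH] using \<open>0 < F 1\<close> b_nonneg by simp
  qed
qed

section \<open>Square integrable functions and the fundamental theorem for weak derivatives\<close>

lemma set_integral_Ioo_Icc:
  fixes f :: "real \<Rightarrow> real"
  shows "(LINT x:{a<..<b}|lborel. f x) = (LINT x:{a..b}|lborel. f x)"
  by (rule set_integral_discrete_difference[where X="{a, b}"]) auto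

lemma set_integrable_Ioo:
  fixes f :: "real \<Rightarrow> real"
  assumes "continuous_on {a..b} f"
  shows "set_integrable lborel {a<..<b} f"
  by (rule set_integrable_subset[OF borel_integrable_atLeastAtMost'[OF assms]]) auto

lemma L2_mult_integrable:
  assumes "u \<in> L2_interval a" "v \<in> L2_interval a"
  shows "set_integrable lborel {0<..<a} (\<lambda>t. u t * v t)"
proof -
  let ?I = "\<lambda>f t. indicator {0<..<a} t *\<^sub>R (f t :: real)"
  have m: "(\<lambda>t. ?I u t) \<in> borel_measurable lborel" "(\<lambda>t. ?I v t) \<in> borel_measurable lborel"
    and i: "integrable lborel (\<lambda>t. ?I (\<lambda>t. (u t)\<^sup>2) t + ?I (\<lambda>t. (v t)\<^sup>2) t)"
    using assms by (auto simp: L2_interval_def set_borel_measurable_def set_integrable_def)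
  have "(\<lambda>t. ?I u t * ?I v t) \<in> borel_measurable lborel"
    using m by (rule borel_measurable_times)
  moreover have "(\<lambda>t. ?I u t * ?I v t) = (\<lambda>t. ?I (\<lambda>t. u t * v t) t)"
    by (auto split: split_indicator)
  ultimately have m': "(\<lambda>t. ?I (\<lambda>t. u t * v t) t) \<in> borel_measurable lborel" by simp
  have "\<bar>u t * v t\<bar> \<le> (u t)\<^sup>2 + (v t)\<^sup>2" for t
  proof -
    have "2 * \<bar>u t * v t\<bar> \<le> (u t)\<^sup>2 + (v t)\<^sup>2"
      using sum_squares_bound[of "\<bar>u t\<bar>" "\<bar>v t\<bar>"] by (simp add: abs_mult)
    then show ?thesis using abs_ge_zero[of "u t * v t"] by linarith
  qed
  then show ?thesis
    unfolding set_integrable_def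
    by (intro Bochner_Integration.integrable_bound[OF i m']) (auto split: split_indicator)
qed

lemma continuous_L2: "continuous_on {0..a} u \<Longrightarrow> u \<in> L2_interval a"
  using set_integrable_Ioo[of 0 a u] set_integrable_Ioo[of 0 a "\<lambda>t. (u t)\<^sup>2"]
  by (auto simp: L2_interval_def set_integrable_def set_borel_measurable_def intro!: continuous_intros)

lemma L2_integrable: "u \<in> L2_interval a \<Longrightarrow> set_integrable lborel {0<..<a} u"
  using L2_mult_integrable[OF _ continuous_L2[OF continuous_on_const[of _ 1]], of u a] by simp

text \<open>The kernels n H'(n (x - s)) are non-negative, have mass 1 and live on [s, s + 1/n]: an
  approximate identity at \<open>s\<close>, approached from the right.\<close>

lemma smooth_step_concentrates:
  fixes u :: "real \<Rightarrow> real"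
  assumes H: "smooth H" "\<And>x. x \<le> 0 \<Longrightarrow> H x = 0" "\<And>x. x \<ge> 1 \<Longrightarrow> H x = 1" "\<And>x. 0 \<le> deriv H x"
    and u: "continuous_on {0..a} u" and s: "0 < s" "s < a"
  shows "(\<lambda>n. LINT x:{0<..<a}|lborel. u x * (real n * deriv H (real n * x - real n * s))) \<longlonglongrightarrow> u s"
proof (rule LIMSEQ_I)
  fix r :: real assume r: "0 < r"
  have "isCont u s" using u s by (intro continuous_on_interior[of "{0..a}"]) auto
  then obtain d where d: "d > 0" "\<And>x. \<bar>x - s\<bar> < d \<Longrightarrow> \<bar>u x - u s\<bar> < r / 2"
    unfolding continuous_at_eps_delta using r
    by (metis dist_real_def half_gt_zero)
  have dH0: "deriv H y = 0" if "y < 0 \<or> 1 < y" for y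
  proof -
    have "((\<lambda>_. if y < 0 then 0 else 1) has_real_derivative 0) (at y)" by simp
    then have "(H has_real_derivative 0) (at y)"
      by (rule has_field_derivative_transform_within_open[where S="if y < 0 then {..<0} else {1<..}"])
         (use that H in auto)
    then show ?thesis by (rule DERIV_imp_deriv)
  qed
  \<comment> \<open>n > 1/d puts the support of the kernel within \<open>d\<close> of
    \<open>s\<close>; n > 1/(a - s) keeps it left of \<open>a\<close>, so that the interval carries
    the full mass 1.\<close>
  obtain N :: nat where N: "real N > max (max (1 / d) (1 / (a - s))) 1"
    using reals_Archimedean2 by blast
  show "\<exists>no. \<forall>n\<ge>no. norm ((LINT x:{0<..<a}|lborel. u x * (real n * deriv H (real n * x - real n * s))) - u s) < r"
  proof (intro exI allI impI)
    fix n assume "N \<le> n"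
    then have n: "real n > 1 / d" "real n > 1 / (a - s)" "real n > 1" using N by auto
    define K where "K x = real n * deriv H (real n * x - real n * s)" for x
    have K_cont: "continuous_on A K" for A unfolding K_def
      using smooth_continuous[OF smooth_affine[OF smooth_deriv[OF H(1)]], of A "real n" "- (real n * s)"]
      by (auto intro!: continuous_intros)
    have DK: "((\<lambda>x. H (real n * x - real n * s)) has_real_derivative K x) (at x)" for x
      unfolding K_def
      by (rule DERIV_cong[OF DERIV_chain2[OF smooth_DERIV[OF H(1)]]])
         (auto intro!: derivative_eq_intros)
    have K0: "0 \<le> K x" for x using H(4) by (simp add: K_def)
    have K_supp: "\<bar>x - s\<bar> < d" if "K x \<noteq> 0" for x
    proof -
      have "0 \<le> real n * x - real n * s" "real n * x - real n * s \<le> 1"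
        using that dH0[of "real n * x - real n * s"] by (force simp: K_def)+
      then have "0 \<le> real n * (x - s)" "real n * (x - s) \<le> 1" by (auto simp: algebra_simps)
      then have "0 \<le> x - s" "x - s \<le> 1 / real n"
        using n(3) by (auto simp: zero_le_mult_iff field_simps)
      moreover have "1 / real n < d" using n d(1) by (simp add: field_simps)
      ultimately show ?thesis by simp
    qed
    have int1: "(LINT x:{0<..<a}|lborel. K x) = 1"
    proof -
      have "(LINT x:{0..a}|lborel. K x) = H (real n * a - real n * s) - H (real n * 0 - real n * s)"
        using integral_FTC_Icc_real[of 0 a "\<lambda>x. H (real n * x - real n * s)" K] DK s
          K_cont[of UNIV, unfolded continuous_on_eq_continuous_at[OF open_UNIV]]
        by (simp add: set_lebesgue_integral_def mult.commute)
      moreover have "real n * a - real n * s \<ge> 1" using n(2) s by (simp add: field_simps)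
      moreover have "real n * 0 - real n * s \<le> 0" using s by simp
      ultimately show ?thesis using H(2,3) by (simp add: set_integral_Ioo_Icc)
    qed
    have iK: "set_integrable lborel {0<..<a} K" by (intro set_integrable_Ioo K_cont)
    have iuK: "set_integrable lborel {0<..<a} (\<lambda>x. u x * K x)"
      by (intro set_integrable_Ioo continuous_intros u K_cont)
    have iuK': "set_integrable lborel {0<..<a} (\<lambda>x. (u x - u s) * K x)"
      by (intro set_integrable_Ioo continuous_intros u K_cont)
    have "(LINT x:{0<..<a}|lborel. u x * K x) - u s = (LINT x:{0<..<a}|lborel. u x * K x) - (LINT x:{0<..<a}|lborel. u s * K x)"
      using int1 by simp
    also have "\<dots> = (LINT x:{0<..<a}|lborel. (u x - u s) * K x)"
      using set_integral_diff(2)[OF iuK set_integrable_mult_right[of "u s", OF iK]] by (simp add: left_diff_distrib)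
    also have "norm \<dots> \<le> (LINT x:{0<..<a}|lborel. norm ((u x - u s) * K x))"
      by (rule set_integral_norm_bound[OF iuK'])
    also have "\<dots> \<le> (LINT x:{0<..<a}|lborel. r / 2 * K x)"
    proof (rule set_integral_mono)
      show "norm ((u x - u s) * K x) \<le> r / 2 * K x" if "x \<in> {0<..<a}" for x
        using d(2)[of x] K_supp[of x] K0[of x]
        by (cases "K x = 0") (auto simp: abs_mult intro!: mult_right_mono)
      show "set_integrable lborel {0<..<a} (\<lambda>x. norm ((u x - u s) * K x))"
        by (rule set_integrable_norm[OF iuK'])
      show "set_integrable lborel {0<..<a} (\<lambda>x. r / 2 * K x)"
        by (rule set_integrable_mult_right[OF iK])
    qed
    also have "\<dots> = r / 2" using int1 by simp
    also have "\<dots> < r" using r by simp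
    finally show "norm ((LINT x:{0<..<a}|lborel. u x * (real n * deriv H (real n * x - real n * s))) - u s) < r"
      by (simp add: K_def)
  qed
qed

text \<open>The weak derivative is tested against smooth functions that increase from \<open>0\<close> to \<open>1\<close> just to the
  right of \<open>s\<close> and decrease back to \<open>0\<close> just to the right of \<open>t\<close>.\<close>

lemma weak_deriv_FTC_interior:
  assumes u: "continuous_on {0..a} u" and v: "v \<in> L2_interval a" and w: "is_weak_deriv a u v"
    and st: "0 < s" "s < t" "t < a"
  shows "(LINT x:{s<..<t}|lborel. v x) = u t - u s"
proof -
  obtain H where H: "smooth H" "\<And>x. x \<le> 0 \<Longrightarrow> H x = 0" "\<And>x. x \<ge> 1 \<Longrightarrow> H x = 1" "\<And>x. 0 \<le> deriv H x"
    using ex_smooth_step by blast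
  have H_mono: "H x \<le> H y" if "x \<le> y" for x y
    using that smooth_DERIV[OF H(1)] H(4) by (meson DERIV_nonneg_imp_nondecreasing)
  have H01: "0 \<le> H x" "H x \<le> 1" for x
    using H_mono[of "min x 0" x] H_mono[of x "max x 1"] H(2)[of "min x 0"] H(3)[of "max x 1"] by auto
  define \<psi> where "\<psi> n x = H (real n * x - real n * s) - H (real n * x - real n * t)" for n x
  define K where "K n s x = real n * deriv H (real n * x - real n * s)" for n s x
  have s\<psi>: "smooth (\<psi> n)" for n
    unfolding \<psi>_def
    using smooth_diff[OF smooth_affine[OF H(1), of "real n" "- real n * s"] smooth_affine[OF H(1), of "real n" "- real n * t"]]
    by simp
  have d\<psi>: "deriv (\<psi> n) = (\<lambda>x. K n s x - K n t x)" for n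
    unfolding \<psi>_def K_def
    by (rule deriv_eqI, intro DERIV_diff DERIV_cong[OF DERIV_chain2[OF smooth_DERIV[OF H(1)]]])
       (auto intro!: derivative_eq_intros)
  \<comment> \<open>n > 1/(a - t) keeps the support [s, t + 1/n] of \<open>\<psi> n\<close> inside
    (0, a), as a test function requires.\<close>
  obtain N :: nat where N: "real N > max (1 / (a - t)) 1"
    using reals_Archimedean2 by blast
  have eq: "(LINT x:{0<..<a}|lborel. u x * K n s x) - (LINT x:{0<..<a}|lborel. u x * K n t x)
     = - (LINT x:{0<..<a}|lborel. v x * \<psi> n x)" if "N \<le> n" for n
  proof -
    have n: "real n > 1 / (a - t)" "real n > 1" using N that by auto
    have "\<psi> n x = 0" if x: "x \<notin> {s..t + 1 / real n}" for x
    proof -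
      consider "x < s" | "x > t + 1 / real n" using x by (auto simp: not_le)
      then show ?thesis
      proof cases
        case 1
        then show ?thesis using st n by (auto simp: \<psi>_def H(2) mult_left_mono)
      next
        case 2
        then have "real n * x \<ge> real n * (t + 1 / real n)" using n by (intro mult_left_mono) auto
        then have "real n * x - real n * t \<ge> 1" using n by (simp add: algebra_simps)
        moreover have "real n * t \<ge> real n * s" using st by (intro mult_left_mono) auto
        ultimately show ?thesis by (simp add: \<psi>_def H(3))
      qed
    qed
    then have sub: "closure {x. \<psi> n x \<noteq> 0} \<subseteq> {s..t + 1 / real n}"
      by (intro closure_minimal subsetI) (blast, rule closed_atLeastAtMost)
    moreover have "t + 1 / real n < a" using n st by (simp add: field_simps)
    ultimately have "\<psi> n \<in> test_functions a"
      using s\<psi> st bounded_subset[OF _ sub]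
      by (auto simp: test_functions_def smooth_def compact_eq_bounded_closed)
    then have "(LINT x:{0<..<a}|lborel. u x * deriv (\<psi> n) x) = - (LINT x:{0<..<a}|lborel. v x * \<psi> n x)"
      using w by (simp add: is_weak_deriv_def)
    moreover have "set_integrable lborel {0<..<a} (\<lambda>x. u x * K n s x)" for s
      unfolding K_def
      using smooth_continuous[OF smooth_affine[OF smooth_deriv[OF H(1)]], of "{0..a}" "real n" "- (real n * s)"]
      by (intro set_integrable_Ioo) (auto intro!: continuous_intros u)
    ultimately show ?thesis
      by (simp add: d\<psi> right_diff_distrib set_integral_diff)
  qed
  have lim1: "(\<lambda>n. (LINT x:{0<..<a}|lborel. u x * K n s x) - (LINT x:{0<..<a}|lborel. u x * K n t x)) \<longlonglongrightarrow> u s - u t"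
    unfolding K_def using st by (intro tendsto_diff smooth_step_concentrates H u) auto
  have vi: "integrable lborel (\<lambda>x. indicator {0<..<a} x *\<^sub>R v x)"
    using L2_integrable[OF v] by (simp add: set_integrable_def)
  \<comment> \<open>The limit is half-open because \<open>H\<close> vanishes at 0: the value tends
    to 0 at \<open>s\<close> and to 1 at \<open>t\<close>. Dominated convergence applies since
    \<open>\<psi> n\<close> is bounded by 1.\<close>
  have "(\<lambda>n. LINT x|lborel. (indicator {0<..<a} x *\<^sub>R v x) * \<psi> n x) \<longlonglongrightarrow>
      (LINT x|lborel. (indicator {0<..<a} x *\<^sub>R v x) * indicator {s<..t} x)"
  proof (rule integral_dominated_convergence)
    show "integrable lborel (\<lambda>x. norm (indicator {0<..<a} x *\<^sub>R v x))" using vi by (rule integrable_norm)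
    show "AE x in lborel. norm ((indicator {0<..<a} x *\<^sub>R v x) * \<psi> n x) \<le> norm (indicator {0<..<a} x *\<^sub>R v x)" for n
    proof (rule AE_I2)
      fix x
      have "\<bar>\<psi> n x\<bar> \<le> 1"
        using H01[of "real n * x - real n * s"] H01[of "real n * x - real n * t"] by (auto simp: \<psi>_def)
      then show "norm ((indicator {0<..<a} x *\<^sub>R v x) * \<psi> n x) \<le> norm (indicator {0<..<a} x *\<^sub>R v x)"
        by (simp add: abs_mult mult_left_le)
    qed
    show "AE x in lborel. (\<lambda>n. (indicator {0<..<a} x *\<^sub>R v x) * \<psi> n x) \<longlonglongrightarrow> (indicator {0<..<a} x *\<^sub>R v x) * indicator {s<..t} x"
    proof (rule AE_I2, rule tendsto_mult_left)
      fix x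
      have lim: "(\<lambda>n. H (real n * x - real n * s)) \<longlonglongrightarrow> (if s < x then 1 else 0)" for s
      proof (cases "s < x")
        case True
        obtain M :: nat where M: "real M > 1 / (x - s)" using reals_Archimedean2 by blast
        have "H (real n * x - real n * s) = 1" if "M \<le> n" for n
        proof (rule H(3))
          have "1 / (x - s) < real n" using M that by linarith
          then show "1 \<le> real n * x - real n * s" using True by (simp add: field_simps)
        qed
        then have "\<forall>\<^sub>F n in sequentially. H (real n * x - real n * s) = 1"
          unfolding eventually_sequentially by blast
        then show ?thesis using True by (simp add: tendsto_eventually)
      next
        case False
        then have "H (real n * x - real n * s) = 0" for n by (simp add: H(2) mult_left_mono)
        then show ?thesis using False by simp
      qed
      have "\<psi> n x = H (real n * x - real n * s) - H (real n * x - real n * t)" for n by (simp add: \<psi>_def)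
      then show "(\<lambda>n. \<psi> n x) \<longlonglongrightarrow> indicator {s<..t} x"
        using tendsto_diff[OF lim[of s] lim[of t]] st by (cases "s < x"; cases "t < x") auto
    qed
    show "(\<lambda>x. (indicator {0<..<a} x *\<^sub>R v x) * \<psi> n x) \<in> borel_measurable lborel" for n
      using vi smooth_continuous[OF s\<psi>] by (intro borel_measurable_times) (auto intro: borel_measurable_continuous_onI)
    show "(\<lambda>x. (indicator {0<..<a} x *\<^sub>R v x) * indicator {s<..t} x) \<in> borel_measurable lborel"
      using vi by (intro borel_measurable_times) auto
  qed
  moreover have "(LINT x|lborel. (indicator {0<..<a} x *\<^sub>R v x) * indicator {s<..t} x) = (LINT x:{s<..<t}|lborel. v x)"
  proof -
    have "(LINT x|lborel. (indicator {0<..<a} x *\<^sub>R v x) * indicator {s<..t} x) = (LINT x:{s<..t}|lborel. v x)"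
      unfolding set_lebesgue_integral_def
      by (rule Bochner_Integration.integral_cong) (use st in \<open>auto split: split_indicator\<close>)
    also have "\<dots> = (LINT x:{s<..<t}|lborel. v x)"
      by (rule set_integral_discrete_difference[where X="{t}"]) auto
    finally show ?thesis .
  qed
  ultimately have lim2: "(\<lambda>n. LINT x:{0<..<a}|lborel. v x * \<psi> n x) \<longlonglongrightarrow> (LINT x:{s<..<t}|lborel. v x)"
    by (simp add: set_lebesgue_integral_def mult.assoc)
  have "(\<lambda>n. (LINT x:{0<..<a}|lborel. u x * K n s x) - (LINT x:{0<..<a}|lborel. u x * K n t x)) \<longlonglongrightarrow> - (LINT x:{s<..<t}|lborel. v x)"
    by (rule Lim_transform_eventually[OF tendsto_minus[OF lim2]])
       (auto simp: eventually_sequentially eq intro!: exI[of _ N])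
  from LIMSEQ_unique[OF this lim1] show ?thesis by simp
qed

text \<open>The integral of \<open>v\<close> from 0 minus \<open>u\<close> is constant on the open
  interval by the interior case, and continuity carries the constant to the endpoints.\<close>

lemma weak_deriv_FTC:
  assumes u: "continuous_on {0..a} u" and v: "v \<in> L2_interval a" and w: "is_weak_deriv a u v"
    and st: "0 \<le> s" "s \<le> t" "t \<le> a"
  shows "(LINT x:{s<..<t}|lborel. v x) = u t - u s"
proof (cases "s < t")
  case True
  then have a: "0 < a" using st by simp
  have si: "set_integrable lborel {s<..<t} v" if "0 \<le> s" "t \<le> a" for s t
    by (rule set_integrable_subset[OF L2_integrable[OF v]]) (use that in auto)
  have HK: "(LINT x:{s<..<t}|lborel. v x) = integral {s..t} v" if "0 \<le> s" "t \<le> a" for s t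
    using set_borel_integral_eq_integral(2)[OF si[OF that]] by (simp add: integral_open_interval_real)
  have vi: "v integrable_on {0..a}"
    using set_borel_integral_eq_integral(1)[OF si[of 0 a]] by (simp add: integrable_on_Icc_iff_Ioo)
  define F where "F x = integral {0..x} v - u x" for x
  have F_diff: "F y - F x = integral {x..y} v - (u y - u x)" if "0 \<le> x" "x \<le> y" "y \<le> a" for x y
    using Henstock_Kurzweil_Integration.integral_combine[of 0 x y v] integrable_subinterval_real[OF vi, of 0 y] that
    by (simp add: F_def)
  have Fc: "continuous_on {0..a} F"
    unfolding F_def by (intro continuous_intros u indefinite_integral_continuous_1 vi)
  have const: "F x = F (a/2)" if "x \<in> {0<..<a}" for x
  proof -
    have "F y = F x" if "0 < x" "x < y" "y < a" for x y
      using weak_deriv_FTC_interior[OF u v w that] HK[of x y] F_diff[of x y] that by simp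
    note * = this[of x "a/2"] this[of "a/2" x]
    show ?thesis
    proof (rule linorder_cases[of x "a/2"])
      assume "x = a/2" then show ?thesis by (rule arg_cong)
    qed (use * that a in auto)
  qed
  have cl: "F x = F (a/2)" if "x \<in> {0..a}" for x
  proof (rule continuous_constant_on_closure[of "{0<..<a}" F])
    show "continuous_on (closure {0<..<a}) F" using Fc a by (simp add: closure_greaterThanLessThan)
    show "x \<in> closure {0<..<a}" using that a by (simp add: closure_greaterThanLessThan)
    show "F y = F (a/2)" if "y \<in> {0<..<a}" for y by (rule const[OF that])
  qed
  have "F s = F (a/2)" "F t = F (a/2)" by (rule cl, use st in simp)+
  then show ?thesis using HK[OF st(1,3)] F_diff[OF st] by linarith
next
  case False
  then show ?thesis using st by (simp add: set_lebesgue_integral_def)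
qed

text \<open>The positive and negative parts of \<open>v\<close>, extended by 0, are densities of two
  finite measures on the line. Vanishing interval integrals make their distribution functions equal,
  hence the measures, hence the densities almost everywhere; equal positive and negative parts are
  both 0.\<close>

lemma AE_zero_if_interval_integrals_zero:
  fixes v :: "real \<Rightarrow> real"
  assumes v: "set_integrable lborel {0<..<a} v"
    and 0: "\<And>s t. 0 \<le> s \<Longrightarrow> s \<le> t \<Longrightarrow> t \<le> a \<Longrightarrow> (LINT x:{s<..<t}|lborel. v x) = 0"
  shows "AE x in lborel. x \<in> {0<..<a} \<longrightarrow> v x = 0"
proof -
  define w where "w x = indicator {0<..<a} x *\<^sub>R v x" for x
  have wi: "integrable lborel w" using v by (simp add: w_def[abs_def] set_integrable_def)
  have [measurable]: "w \<in> borel_measurable borel" using wi by auto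
  have fin: "finite_borel_measure (density lborel (\<lambda>x. ennreal (max 0 (g x))))"
    and cdf: "cdf (density lborel (\<lambda>x. ennreal (max 0 (g x)))) y = (LINT x:{..y}|lborel. max 0 (g x))"
    if g: "integrable lborel g" for g y
  proof -
    have [measurable]: "g \<in> borel_measurable borel" using g by auto
    have gi: "integrable lborel (\<lambda>x. max 0 (g x))" using g by (intro integrable_max) auto
    have e: "emeasure (density lborel (\<lambda>x. ennreal (max 0 (g x)))) A = ennreal (LINT x:A|lborel. max 0 (g x))"
      if [measurable]: "A \<in> sets borel" for A
    proof -
      have ii: "integrable lborel (\<lambda>x. indicator A x *\<^sub>R max 0 (g x))"
        using gi by (rule integrable_mult_indicator[rotated]) auto
      have "emeasure (density lborel (\<lambda>x. ennreal (max 0 (g x)))) A = (\<integral>\<^sup>+x. ennreal (max 0 (g x)) * indicator A x \<partial>lborel)"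
        by (rule emeasure_density) auto
      also have "\<dots> = (\<integral>\<^sup>+x. ennreal (indicator A x *\<^sub>R max 0 (g x)) \<partial>lborel)"
        by (rule nn_integral_cong) (auto split: split_indicator)
      also have "\<dots> = ennreal (LINT x:A|lborel. max 0 (g x))"
        unfolding set_lebesgue_integral_def by (rule nn_integral_eq_integral[OF ii]) auto
      finally show ?thesis .
    qed
    show "finite_borel_measure (density lborel (\<lambda>x. ennreal (max 0 (g x))))"
      unfolding finite_borel_measure_def finite_borel_measure_axioms_def
      by (auto intro!: finite_measureI simp: e)
    have "0 \<le> (LINT x:{..y}|lborel. max 0 (g x))"
      unfolding set_lebesgue_integral_def by (rule Bochner_Integration.integral_nonneg) auto
    then show "cdf (density lborel (\<lambda>x. ennreal (max 0 (g x)))) y = (LINT x:{..y}|lborel. max 0 (g x))"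
      by (simp add: cdf_def measure_def e)
  qed
  have wi': "integrable lborel (\<lambda>x. - w x)" using wi by simp
  have "cdf (density lborel (\<lambda>x. ennreal (max 0 (w x)))) y = cdf (density lborel (\<lambda>x. ennreal (max 0 (- w x)))) y" for y
  proof -
    have si: "set_integrable lborel {..y} (\<lambda>x. max 0 (w x))" "set_integrable lborel {..y} (\<lambda>x. max 0 (- w x))"
      unfolding set_integrable_def
      by (rule integrable_mult_indicator; use wi in \<open>simp add: integrable_max\<close>)+
    have "(LINT x:{..y}|lborel. max 0 (w x)) - (LINT x:{..y}|lborel. max 0 (- w x)) = (LINT x:{..y}|lborel. max 0 (w x) - max 0 (- w x))"
      using si by (simp add: set_integral_diff)
    also have "\<dots> = (LINT x:{..y}|lborel. w x)"
      by (rule arg_cong[where f="set_lebesgue_integral lborel {..y}"]) auto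
    also have "\<dots> = (LINT x:{0<..min a y}|lborel. v x)"
    proof -
      have "(LINT x:{..y}|lborel. w x) = (LINT x:{..y} \<inter> {0<..<a}|lborel. v x)"
        unfolding set_lebesgue_integral_def w_def
        by (rule Bochner_Integration.integral_cong) (auto split: split_indicator)
      also have "\<dots> = (LINT x:{0<..min a y}|lborel. v x)"
        by (rule set_integral_discrete_difference[where X="{a}"]) auto
      finally show ?thesis .
    qed
    also have "\<dots> = (LINT x:{0<..<min a y}|lborel. v x)"
      by (rule set_integral_discrete_difference[where X="{min a y}"]) auto
    also have "\<dots> = 0"
    proof (cases "0 \<le> min a y")
      case True
      then show ?thesis by (intro 0) auto
    next
      case False
      then have "{0<..<min a y} = {}" by auto
      then show ?thesis by (simp add: set_lebesgue_integral_def)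
    qed
    finally show ?thesis by (simp add: cdf[OF wi] cdf[OF wi'])
  qed
  then have "density lborel (\<lambda>x. ennreal (max 0 (w x))) = density lborel (\<lambda>x. ennreal (max 0 (- w x)))"
    by (intro cdf_unique' fin wi wi' ext)
  then have "AE x in lborel. ennreal (max 0 (w x)) = ennreal (max 0 (- w x))"
    by (subst (asm) sigma_finite_measure.density_unique_iff[OF lborel.sigma_finite_measure_axioms]) auto
  then show ?thesis
    by eventually_elim (auto simp: w_def max_def split: if_splits)
qed

text \<open>The derivative is carried along explicitly, because \<open>weak_deriv\<close> is a
  choice without a formula. Uniqueness up to null sets (\<open>H1_pair_unique\<close>) leads back to
  it.\<close>

definition H1_pair :: "real \<Rightarrow> (real \<Rightarrow> real) \<Rightarrow> (real \<Rightarrow> real) \<Rightarrow> bool" where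
  "H1_pair a u v \<longleftrightarrow> continuous_on {0..a} u \<and> u \<in> L2_interval a \<and> v \<in> L2_interval a \<and> is_weak_deriv a u v"

lemma H1_pair_FTC:
  "H1_pair a u v \<Longrightarrow> 0 \<le> s \<Longrightarrow> s \<le> t \<Longrightarrow> t \<le> a \<Longrightarrow> (LINT x:{s<..<t}|lborel. v x) = u t - u s"
  using weak_deriv_FTC by (auto simp: H1_pair_def)

lemma H1_pair_weak_deriv:
  assumes "continuous_on {0..a} u" "u \<in> H1_interval a"
  shows "H1_pair a u (weak_deriv a u)"
proof -
  have "\<exists>v. v \<in> L2_interval a \<and> is_weak_deriv a u v" using assms by (auto simp: H1_interval_def)
  then have "weak_deriv a u \<in> L2_interval a \<and> is_weak_deriv a u (weak_deriv a u)"
    unfolding weak_deriv_def by (rule someI_ex)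
  then show ?thesis using assms by (simp add: H1_pair_def H1_interval_def)
qed

lemma H1_pair_H1: "H1_pair a u v \<Longrightarrow> u \<in> H1_interval a"
  by (auto simp: H1_pair_def H1_interval_def)

lemma H1_pair_unique:
  assumes "H1_pair a u v" "H1_pair a u w"
  shows "AE x in lborel. x \<in> {0<..<a} \<longrightarrow> v x = w x"
proof -
  have i: "set_integrable lborel {0<..<a} v" "set_integrable lborel {0<..<a} w"
    using assms L2_integrable by (auto simp: H1_pair_def)
  have "AE x in lborel. x \<in> {0<..<a} \<longrightarrow> v x - w x = 0"
  proof (rule AE_zero_if_interval_integrals_zero)
    fix s t :: real assume st: "0 \<le> s" "s \<le> t" "t \<le> a"
    have "set_integrable lborel {s<..<t} v" "set_integrable lborel {s<..<t} w"
      using i st by (auto elim!: set_integrable_subset)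
    then show "(LINT x:{s<..<t}|lborel. v x - w x) = 0"
      using H1_pair_FTC[OF assms(1) st] H1_pair_FTC[OF assms(2) st] by (simp add: set_integral_diff)
  qed (use i in \<open>auto intro: set_integral_diff\<close>)
  then show ?thesis by simp
qed

lemma set_integral_AE_cong:
  fixes f g :: "real \<Rightarrow> real"
  assumes "set_borel_measurable lborel A f" "set_borel_measurable lborel A g"
    and "AE x in lborel. x \<in> A \<longrightarrow> f x = g x"
  shows "(LINT x:A|lborel. f x) = (LINT x:A|lborel. g x)"
  using assms unfolding set_lebesgue_integral_def set_borel_measurable_def
  by (intro integral_cong_AE) (auto elim!: eventually_mono split: split_indicator)

text \<open>This is what allows \<open>qform\<close> to be evaluated with an explicit
  derivative.\<close>

lemma weak_deriv_integral:
  assumes "H1_pair a u v" "w \<in> L2_interval a"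
  shows "(LINT x:{0<..<a}|lborel. weak_deriv a u x * w x) = (LINT x:{0<..<a}|lborel. v x * w x)"
proof (rule set_integral_AE_cong)
  have p: "H1_pair a u (weak_deriv a u)"
    using H1_pair_weak_deriv[OF _ H1_pair_H1[OF assms(1)]] assms(1) by (simp add: H1_pair_def)
  then show "set_borel_measurable lborel {0<..<a} (\<lambda>x. weak_deriv a u x * w x)"
    "set_borel_measurable lborel {0<..<a} (\<lambda>x. v x * w x)"
    using assms L2_mult_integrable[of _ a w] by (auto simp: H1_pair_def set_integrable_def set_borel_measurable_def)
  show "AE x in lborel. x \<in> {0<..<a} \<longrightarrow> weak_deriv a u x * w x = v x * w x"
    using H1_pair_unique[OF p assms(1)] by eventually_elim auto
qed

section \<open>Linear combinations and ramps\<close>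

lemma L2_add: assumes "u \<in> L2_interval a" "v \<in> L2_interval a" shows "(\<lambda>t. u t + v t) \<in> L2_interval a"
proof -
  have "set_integrable lborel {0<..<a} (\<lambda>t. (u t * u t + v t * v t) + 2 * (u t * v t))"
    using assms by (intro set_integral_add set_integrable_mult_right L2_mult_integrable)
  then have "set_integrable lborel {0<..<a} (\<lambda>t. (u t + v t)\<^sup>2)"
    by (simp add: power2_eq_square algebra_simps)
  then show ?thesis using assms
    by (auto simp: L2_interval_def set_borel_measurable_def distrib_left)
qed

lemma L2_scale: "u \<in> L2_interval a \<Longrightarrow> (\<lambda>t. c * u t) \<in> L2_interval a"
  by (auto simp: L2_interval_def set_borel_measurable_def power_mult_distrib mult.left_commute)

lemma test_function_smooth: "\<phi> \<in> test_functions a \<Longrightarrow> smooth \<phi>"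
  by (simp add: test_functions_def smooth_def)

lemma test_function_zero:
  assumes "\<phi> \<in> test_functions a" "t \<notin> {0<..<a}" shows "\<phi> t = 0"
  using assms closure_subset[of "{t. \<phi> t \<noteq> 0}"] by (auto simp: test_functions_def)

lemma test_function_L2: "\<phi> \<in> test_functions a \<Longrightarrow> \<phi> \<in> L2_interval a \<and> deriv \<phi> \<in> L2_interval a"
  by (intro conjI continuous_L2 smooth_continuous smooth_deriv test_function_smooth)

lemma H1_pair_add:
  assumes "H1_pair a u v" "H1_pair a u' v'"
  shows "H1_pair a (\<lambda>t. u t + u' t) (\<lambda>t. v t + v' t)"
proof -
  have "is_weak_deriv a (\<lambda>t. u t + u' t) (\<lambda>t. v t + v' t)"
    using assms test_function_L2
    by (auto simp: H1_pair_def is_weak_deriv_def distrib_right set_integral_add L2_mult_integrable)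
  then show ?thesis using assms by (auto simp: H1_pair_def L2_add intro: continuous_intros)
qed

lemma H1_pair_scale:
  assumes "H1_pair a u v"
  shows "H1_pair a (\<lambda>t. c * u t) (\<lambda>t. c * v t)"
proof -
  have "is_weak_deriv a (\<lambda>t. c * u t) (\<lambda>t. c * v t)"
    using assms by (auto simp: H1_pair_def is_weak_deriv_def mult.assoc)
  then show ?thesis using assms by (auto simp: H1_pair_def L2_scale intro: continuous_intros)
qed

lemma H1_pair_const: "H1_pair a (\<lambda>_. c) (\<lambda>_. 0)"
proof -
  have "is_weak_deriv a (\<lambda>_. c) (\<lambda>_. 0)"
    unfolding is_weak_deriv_def
  proof
    fix \<phi> assume \<phi>: "\<phi> \<in> test_functions a"
    show "(LINT t:{0<..<a}|lborel. c * deriv \<phi> t) = - (LINT t:{0<..<a}|lborel. 0 * \<phi> t)"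
    proof (cases "0 \<le> a")
      case True
      have "(LINT t:{0..a}|lborel. deriv \<phi> t) = \<phi> a - \<phi> 0"
        using integral_FTC_Icc_real[OF True smooth_DERIV[OF test_function_smooth[OF \<phi>]]]
          smooth_continuous[OF smooth_deriv[OF test_function_smooth[OF \<phi>]], of UNIV, unfolded continuous_on_eq_continuous_at[OF open_UNIV]]
        by (simp add: set_lebesgue_integral_def mult.commute)
      then show ?thesis using \<phi> by (simp add: set_integral_Ioo_Icc test_function_zero)
    next
      case False
      then have "{0<..<a} = {}" by auto
      then show ?thesis by (simp add: set_lebesgue_integral_def)
    qed
  qed
  then show ?thesis by (auto simp: H1_pair_def intro!: continuous_L2)
qed

text \<open>A piecewise linear function is a constant plus multiples of ramps, one for each segment,
  so a ramp is the one shape whose weak derivative has to be computed.\<close>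

definition ramp :: "real \<Rightarrow> real \<Rightarrow> real \<Rightarrow> real" where
  "ramp b c t = max 0 (min 1 ((t - b) / (c - b)))"

lemma ramp_left: "b < c \<Longrightarrow> t \<le> b \<Longrightarrow> ramp b c t = 0"
  by (simp add: ramp_def divide_le_0_iff)

lemma ramp_mid: "b \<le> t \<Longrightarrow> t \<le> c \<Longrightarrow> ramp b c t = (t - b) / (c - b)"
  by (cases "b = c") (auto simp: ramp_def divide_le_eq_1)

lemma ramp_right: "b < c \<Longrightarrow> c \<le> t \<Longrightarrow> ramp b c t = 1"
  by (simp add: ramp_def le_divide_eq_1)

lemma continuous_on_ramp: "b < c \<Longrightarrow> continuous_on A (ramp b c)"
  unfolding ramp_def by (intro continuous_intros) auto

lemma H1_pair_ramp:
  assumes bc: "0 \<le> b" "b < c" "c \<le> a"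
  shows "H1_pair a (ramp b c) (\<lambda>t. indicator {b<..<c} t / (c - b))"
proof -
  let ?r = "\<lambda>t. indicator {b<..<c} t / (c - b)"
  have "set_integrable lborel {0<..<a} (\<lambda>t. indicator {b<..<c} t :: real)"
    unfolding set_integrable_def
    by (rule integrable_mult_indicator) (use bc in \<open>auto simp: integrable_indicator_iff\<close>)
  moreover have "(indicator {b<..<c} t :: real)\<^sup>2 = indicator {b<..<c} t" for t
    by (auto split: split_indicator)
  ultimately have "(\<lambda>t. (1 / (c - b)) * indicator {b<..<c} t) \<in> L2_interval a"
    by (intro L2_scale) (simp add: L2_interval_def set_integrable_def set_borel_measurable_def)
  then have rL2: "?r \<in> L2_interval a" by simp
  have uL2: "ramp b c \<in> L2_interval a" by (intro continuous_L2 continuous_on_ramp bc)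
  have "is_weak_deriv a (ramp b c) ?r"
    unfolding is_weak_deriv_def
  proof
    fix \<phi> assume \<phi>: "\<phi> \<in> test_functions a"
    note D = smooth_DERIV[OF test_function_smooth[OF \<phi>]]
    let ?f = "\<lambda>t. ramp b c t * deriv \<phi> t + ?r t * \<phi> t"
    have "(?f has_integral (ramp b c a * \<phi> a - ramp b c 0 * \<phi> 0)) {0..a}"
    \<comment> \<open>This form of the theorem allows finitely many points without derivative inside
      the interval: the kinks \<open>b\<close> and \<open>c\<close>.\<close>
    proof (rule fundamental_theorem_of_calculus_interior_strong[where S="{b, c}"])
      show "((\<lambda>t. ramp b c t * \<phi> t) has_vector_derivative ?f x) (at x)" if x: "x \<in> {0<..<a} - {b, c}" for x
      proof -
        have "(ramp b c has_real_derivative ?r x) (at x)"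
        proof -
          consider "x < b" | "b < x" "x < c" | "c < x" using x by fastforce
          then show ?thesis
          proof cases
            case 1
            have "((\<lambda>_. 0) has_real_derivative 0) (at x)" by simp
            then have "(ramp b c has_real_derivative 0) (at x)"
              by (rule has_field_derivative_transform_within_open[where S="{..<b}"])
                 (use 1 bc in \<open>auto simp: ramp_left\<close>)
            then show ?thesis using 1 by simp
          next
            case 2
            have "((\<lambda>t. (t - b) / (c - b)) has_real_derivative 1 / (c - b)) (at x)"
              using bc by (auto intro!: derivative_eq_intros)
            then have "(ramp b c has_real_derivative 1 / (c - b)) (at x)"
              by (rule has_field_derivative_transform_within_open[where S="{b<..<c}"])
                 (use 2 bc in \<open>auto simp: ramp_mid\<close>)
            then show ?thesis using 2 by simp
          next
            case 3
            have "((\<lambda>_. 1) has_real_derivative 0) (at x)" by simp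
            then have "(ramp b c has_real_derivative 0) (at x)"
              by (rule has_field_derivative_transform_within_open[where S="{c<..}"])
                 (use 3 bc in \<open>auto simp: ramp_right\<close>)
            then show ?thesis using 3 by simp
          qed
        qed
        from DERIV_mult[OF this D[of x]] show ?thesis
          by (simp add: has_real_derivative_iff_has_vector_derivative add.commute mult.commute)
      qed
      show "continuous_on {0..a} (\<lambda>t. ramp b c t * \<phi> t)"
        by (intro continuous_intros continuous_on_ramp bc smooth_continuous test_function_smooth[OF \<phi>])
    qed (use bc in auto)
    then have "(?f has_integral 0) {0..a}" using test_function_zero[OF \<phi>] by simp
    then have "(?f has_integral 0) {0<..<a}" by (simp add: has_integral_Icc_iff_Ioo)
    moreover have i: "set_integrable lborel {0<..<a} (\<lambda>t. ramp b c t * deriv \<phi> t)"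
        "set_integrable lborel {0<..<a} (\<lambda>t. ?r t * \<phi> t)"
      using test_function_L2[OF \<phi>] rL2 uL2 L2_mult_integrable by blast+
    ultimately have "(LINT t:{0<..<a}|lborel. ?f t) = 0"
      using set_borel_integral_eq_integral(2)[OF set_integral_add(1)[OF i]] by (simp add: integral_unique)
    then show "(LINT t:{0<..<a}|lborel. ramp b c t * deriv \<phi> t) = - (LINT t:{0<..<a}|lborel. ?r t * \<phi> t)"
      using set_integral_add(2)[OF i] by linarith
  qed
  then show ?thesis using rL2 uL2 bc by (simp add: H1_pair_def continuous_on_ramp)
qed

section \<open>The sup bound on a segment\<close>

lemma set_integral_split:
  fixes f :: "real \<Rightarrow> real"
  assumes "set_integrable lborel {s<..<t} f" "s \<le> x" "x \<le> t"
  shows "(LINT y:{s<..<t}|lborel. f y) = (LINT y:{s<..<x}|lborel. f y) + (LINT y:{x<..<t}|lborel. f y)"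
proof -
  have "(LINT y:{s<..<t}|lborel. f y) = (LINT y:{s<..<x} \<union> {x<..<t}|lborel. f y)"
    by (rule set_integral_discrete_difference[where X="{x}"]) (use assms in auto)
  also have "\<dots> = (LINT y:{s<..<x}|lborel. f y) + (LINT y:{x<..<t}|lborel. f y)"
    using assms by (intro set_integral_Un set_integrable_subset[OF assms(1)]) auto
  finally show ?thesis .
qed

text \<open>Integrate the square of \<open>v\<close> minus its mean value.\<close>

lemma set_integral_cauchy_schwarz:
  fixes v :: "real \<Rightarrow> real"
  assumes "s \<le> t" "set_integrable lborel {s<..<t} v" "set_integrable lborel {s<..<t} (\<lambda>x. (v x)\<^sup>2)"
  shows "(LINT x:{s<..<t}|lborel. v x)\<^sup>2 \<le> (t - s) * (LINT x:{s<..<t}|lborel. (v x)\<^sup>2)"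
proof (cases "s = t")
  case False
  let ?I = "LINT x:{s<..<t}|lborel. v x"
  define c where "c = ?I / (t - s)"
  have i: "set_integrable lborel {s<..<t} (\<lambda>x. 2 * c * v x)" "set_integrable lborel {s<..<t} (\<lambda>_. c\<^sup>2)"
    "set_integrable lborel {s<..<t} (\<lambda>x. (v x)\<^sup>2 - 2 * c * v x)"
    using assms by (auto intro!: set_integrable_mult_right set_integrable_Ioo set_integral_diff)
  have "0 \<le> (LINT x:{s<..<t}|lborel. (v x - c)\<^sup>2)"
    unfolding set_lebesgue_integral_def by (rule Bochner_Integration.integral_nonneg) auto
  also have "(\<lambda>x. (v x - c)\<^sup>2) = (\<lambda>x. ((v x)\<^sup>2 - 2 * c * v x) + c\<^sup>2)"
    by (auto simp: power2_diff)
  also have "(LINT x:{s<..<t}|lborel. ((v x)\<^sup>2 - 2 * c * v x) + c\<^sup>2) =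
     (LINT x:{s<..<t}|lborel. (v x)\<^sup>2) - 2 * c * ?I + (LINT x:{s<..<t}|lborel. c\<^sup>2)"
    unfolding set_integral_add(2)[OF i(3,2)] set_integral_diff(2)[OF assms(3) i(1)] set_integral_mult_right ..
  also have "(LINT x:{s<..<t}|lborel. c\<^sup>2) = c\<^sup>2 * (t - s)"
    using assms by (simp add: set_lebesgue_integral_def)
  finally have *: "0 \<le> (LINT x:{s<..<t}|lborel. (v x)\<^sup>2) - 2 * c * ?I + c\<^sup>2 * (t - s)" .
  have "c * (t - s) = ?I" using False by (simp add: c_def)
  then have "c\<^sup>2 * (t - s) = c * ?I" by (simp add: power2_eq_square mult.assoc)
  with * have "c * ?I \<le> (LINT x:{s<..<t}|lborel. (v x)\<^sup>2)" by linarith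
  then have "(t - s) * (c * ?I) \<le> (t - s) * (LINT x:{s<..<t}|lborel. (v x)\<^sup>2)"
    using assms by (intro mult_left_mono) auto
  moreover have "(t - s) * (c * ?I) = ?I\<^sup>2" using \<open>c * (t - s) = ?I\<close>
    by (metis mult.assoc mult.commute power2_eq_square)
  ultimately show ?thesis by simp
qed (simp add: set_lebesgue_integral_def)

text \<open>Starting from either end, |u x| is at most the integral of |v| over that side of
  \<open>x\<close>. Adding the two bounds gives 2 |u x|, and squaring turns this into the factor
  1/4, the source of the 4 in the asymptotics.\<close>

lemma H1_pair_sup_bound:
  assumes p: "H1_pair a u v" and st: "0 \<le> s" "s \<le> x" "x \<le> t" "t \<le> a" and 0: "u s = 0" "u t = 0"
  shows "(u x)\<^sup>2 \<le> (t - s) / 4 * (LINT y:{s<..<t}|lborel. (v y)\<^sup>2)"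
proof -
  have L2: "v \<in> L2_interval a" using p by (simp add: H1_pair_def)
  have i: "set_integrable lborel {s<..<t} v"
    by (rule set_integrable_subset[OF L2_integrable[OF L2]]) (use st in auto)
  have i2: "set_integrable lborel {s<..<t} (\<lambda>x. (v x)\<^sup>2)"
    by (rule set_integrable_subset[of _ "{0<..<a}"]) (use st L2 in \<open>auto simp: L2_interval_def\<close>)
  have ia: "set_integrable lborel {s<..<t} (\<lambda>x. \<bar>v x\<bar>)" using i by (rule set_integrable_abs)
  have "set_integrable lborel {s<..<x} v" "set_integrable lborel {x<..<t} v"
    by (rule set_integrable_subset[OF i]; use st in auto)+
  note b = this[THEN set_integral_norm_bound]
  have "\<bar>u x\<bar> \<le> (LINT y:{s<..<x}|lborel. \<bar>v y\<bar>)"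
    using b(1) H1_pair_FTC[OF p, of s x] st 0 by simp
  moreover have "\<bar>u x\<bar> \<le> (LINT y:{x<..<t}|lborel. \<bar>v y\<bar>)"
    using b(2) H1_pair_FTC[OF p, of x t] st 0 by simp
  ultimately have "2 * \<bar>u x\<bar> \<le> (LINT y:{s<..<t}|lborel. \<bar>v y\<bar>)"
    using set_integral_split[OF ia st(2,3)] by linarith
  then have "(2 * \<bar>u x\<bar>)\<^sup>2 \<le> (LINT y:{s<..<t}|lborel. \<bar>v y\<bar>)\<^sup>2" by (intro power_mono) auto
  also have "\<dots> \<le> (t - s) * (LINT y:{s<..<t}|lborel. (v y)\<^sup>2)"
    using set_integral_cauchy_schwarz[OF _ ia] i2 st by simp
  finally show ?thesis by (simp add: power_mult_distrib)
qed

section \<open>Cutting an interval\<close>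

text \<open>The square root of length times mass is superadditive, by the Cauchy--Schwarz inequality
  for two terms. It therefore serves as a budget from which each cut of an edge takes its
  share.\<close>

lemma sqrt_mult_add_le:
  fixes x y m k :: real
  assumes "0 \<le> x" "0 \<le> y" "0 \<le> m" "0 \<le> k"
  shows "sqrt (x * m) + sqrt (y * k) \<le> sqrt ((x + y) * (m + k))"
proof (rule real_le_rsqrt)
  have "2 * sqrt (x * m) * sqrt (y * k) = 2 * sqrt (x * k) * sqrt (y * m)"
    by (simp add: real_sqrt_mult)
  also have "\<dots> \<le> (sqrt (x * k))\<^sup>2 + (sqrt (y * m))\<^sup>2" by (rule sum_squares_bound)
  finally show "(sqrt (x * m) + sqrt (y * k))\<^sup>2 \<le> (x + y) * (m + k)"
    using assms by (simp add: power2_sum algebra_simps)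
qed

context finite_borel_measure
begin

lemma set_integrable_square:
  assumes "continuous_on {0..a} u" "0 \<le> s" "t \<le> a"
  shows "set_integrable M {s<..<t} (\<lambda>x. (u x)\<^sup>2 :: real)"
proof -
  have c: "continuous_on {0..a} (\<lambda>x. (u x)\<^sup>2)" using assms by (intro continuous_intros)
  have "compact ((\<lambda>x. (u x)\<^sup>2) ` {0..a})" by (rule compact_continuous_image[OF c]) simp
  then obtain B where B: "\<And>x. x \<in> {0..a} \<Longrightarrow> norm ((u x)\<^sup>2) \<le> B"
    by (meson bounded_iff compact_imp_bounded imageI)
  have m: "(\<lambda>x. indicator {s<..<t} x *\<^sub>R (u x)\<^sup>2) \<in> borel_measurable borel"
    by (rule borel_measurable_continuous_on_indicator) (use assms in \<open>auto intro: continuous_on_subset[OF c]\<close>)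
  show ?thesis unfolding set_integrable_def
  proof (rule integrable_const_bound[where B="\<bar>B\<bar>"])
    show "AE x in M. norm (indicator {s<..<t} x *\<^sub>R (u x)\<^sup>2) \<le> \<bar>B\<bar>"
    proof (rule AE_I2)
      fix x
      show "norm (indicator {s<..<t} x *\<^sub>R (u x)\<^sup>2) \<le> \<bar>B\<bar>"
        using B[of x] assms by (cases "x \<in> {s<..<t}") auto
    qed
    show "(\<lambda>x. indicator {s<..<t} x *\<^sub>R (u x)\<^sup>2) \<in> borel_measurable M"
      using m measurable_cong_sets[OF M_is_borel refl] by blast
  qed
qed

lemma segment_integral_le:
  assumes p: "H1_pair a u v" and st: "0 \<le> s" "s \<le> t" "t \<le> a" "u s = 0" "u t = 0"
    and c: "(t - s) * measure M {s<..<t} \<le> c"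
  shows "(LINT x:{s<..<t}|M. (u x)\<^sup>2) \<le> c / 4 * (LINT x:{s<..<t}|lborel. (v x)\<^sup>2)"
proof -
  let ?D = "LINT x:{s<..<t}|lborel. (v x)\<^sup>2"
  have D: "0 \<le> ?D" unfolding set_lebesgue_integral_def
    by (rule Bochner_Integration.integral_nonneg) auto
  have "(LINT x:{s<..<t}|M. (u x)\<^sup>2) \<le> (LINT x:{s<..<t}|M. (t - s) / 4 * ?D)"
  proof (rule set_integral_mono)
    show "set_integrable M {s<..<t} (\<lambda>x. (u x)\<^sup>2)"
      using p st by (intro set_integrable_square[of a]) (auto simp: H1_pair_def)
    show "set_integrable M {s<..<t} (\<lambda>x. (t - s) / 4 * ?D)"
      unfolding set_integrable_def by (rule integrable_mult_indicator) auto
    show "(u x)\<^sup>2 \<le> (t - s) / 4 * ?D" if "x \<in> {s<..<t}" for x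
      using that st by (intro H1_pair_sup_bound[OF p]) auto
  qed
  also have "\<dots> = (t - s) * measure M {s<..<t} / 4 * ?D"
    by (simp add: set_lebesgue_integral_def borel_UNIV)
  also have "\<dots> \<le> c / 4 * ?D" using c D by (intro mult_right_mono divide_right_mono) auto
  finally show ?thesis .
qed

lemma measure_Ioc: "s \<le> t \<Longrightarrow> measure M {s<..t} = cdf M t - cdf M s"
  using cdf_diff_eq[of s t] by (cases "s = t") auto

text \<open>Each cut is placed as far to the right as the condition \<open>(t - s) * \<nu> (s, t) \<le> c\<close> allows.
  An atom at the cut point does not matter, because \<open>u\<close> vanishes there; so the piece may be
  counted with its right endpoint, and then \<open>(t - s) * \<nu> (s, t] \<ge> c\<close>.\<close>

lemma ex_maximal_cut:
  assumes s: "s < b" and c: "0 < c"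
  obtains t where "s < t" "t \<le> b" "(t - s) * measure M {s<..<t} \<le> c"
    "t < b \<Longrightarrow> c \<le> (t - s) * measure M {s<..t}"
proof -
  define T where "T = {t \<in> {s<..b}. (t - s) * measure M {s<..<t} \<le> c}"
  have mono: "(t - s) * measure M A \<le> (t' - s) * measure M B" if "s \<le> t" "t \<le> t'" "A \<subseteq> B" "B \<in> sets borel" for t t' A B
    using that by (intro mult_mono finite_measure_mono) auto
  \<comment> \<open>So short a first piece that even the total mass meets the bound; it shows that
    \<open>T\<close> is non-empty and that its supremum exceeds \<open>s\<close>. The
    \<open>+ 1\<close> guards against the zero measure.\<close>
  define t1 where "t1 = min b (s + c / (measure M (space M) + 1))"
  have "t1 \<in> T"
  proof -
    have "(t1 - s) * measure M {s<..<t1} \<le> (c / (measure M (space M) + 1)) * (measure M (space M) + 1)"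
      using c s measure_nonneg[of M "space M"] bounded_measure[of "{s<..<t1}"]
      by (intro mult_mono) (auto simp: t1_def intro: add_nonneg_nonneg)
    also have "\<dots> = c"
    proof -
      have "0 < measure M (space M) + 1" using measure_nonneg[of M "space M"] by linarith
      then show ?thesis by simp
    qed
    finally have "(t1 - s) * measure M {s<..<t1} \<le> c" .
    moreover have "0 < c / (measure M (space M) + 1)"
      using c measure_nonneg[of M "space M"] by (intro divide_pos_pos) linarith+
    then have "s < t1" using s by (auto simp: t1_def)
    ultimately show ?thesis by (auto simp: T_def t1_def)
  qed
  define t where "t = Sup T"
  have bdd: "bdd_above T" by (rule bdd_aboveI[of _ b]) (auto simp: T_def)
  have st: "s < t" using \<open>t1 \<in> T\<close> cSup_upper[OF _ bdd] by (force simp: t_def T_def)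
  have tb: "t \<le> b" unfolding t_def using \<open>t1 \<in> T\<close> by (intro cSup_least) (auto simp: T_def)
  have below: "(x - s) * (cdf M x - cdf M s) \<le> c" if x: "s < x" "x < t" for x
  proof -
    obtain t' where t': "t' \<in> T" "x < t'"
      using x less_cSup_iff[OF _ bdd] \<open>t1 \<in> T\<close> unfolding t_def by blast
    have "(x - s) * measure M {s<..x} \<le> (t' - s) * measure M {s<..<t'}"
      using t' x by (intro mono) auto
    also have "\<dots> \<le> c" using t' by (simp add: T_def)
    finally show ?thesis using x by (simp add: measure_Ioc)
  qed
  \<comment> \<open>A limit of \<open>cdf\<close> from the left leaves out an atom at
    \<open>t\<close>, a limit from the right includes it. This is why the upper bound is for the
    open piece and the lower bound for the piece closed at \<open>t\<close>.\<close>
  have "(t - s) * (measure M {..<t} - cdf M s) \<le> c"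
  proof (rule tendsto_upperbound)
    show "((\<lambda>x. (x - s) * (cdf M x - cdf M s)) \<longlongrightarrow> (t - s) * (measure M {..<t} - cdf M s)) (at_left t)"
      by (intro tendsto_intros cdf_at_left)
    show "\<forall>\<^sub>F x in at_left t. (x - s) * (cdf M x - cdf M s) \<le> c"
      using eventually_at_left_real[OF st] by eventually_elim (use below in auto)
  qed auto
  moreover have "measure M {..<t} - cdf M s = measure M {s<..<t}"
  proof -
    have "{s<..<t} = {..<t} - {..s}" by auto
    moreover have "{..s} \<subseteq> {..<t}" using st by auto
    ultimately show ?thesis using finite_measure_Diff[of "{..<t}" "{..s}", OF sets_M sets_M] by (simp add: cdf_def)
  qed
  ultimately have 1: "(t - s) * measure M {s<..<t} \<le> c" by simp
  have 2: "c \<le> (t - s) * measure M {s<..t}" if "t < b"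
  proof -
    have above: "c \<le> (x - s) * (cdf M x - cdf M s)" if x: "t < x" "x < b" for x
    proof -
      have "x \<notin> T" using x cSup_upper[OF _ bdd] unfolding t_def by force
      then have "c < (x - s) * measure M {s<..<x}" using x st by (auto simp: T_def)
      also have "\<dots> \<le> (x - s) * measure M {s<..x}" using x st by (intro mono) auto
      finally show ?thesis using x st by (simp add: measure_Ioc)
    qed
    have "(cdf M \<longlongrightarrow> cdf M t) (at_right t)"
      using cdf_is_right_cont by (simp add: continuous_within)
    then have "((\<lambda>x. (x - s) * (cdf M x - cdf M s)) \<longlongrightarrow> (t - s) * (cdf M t - cdf M s)) (at_right t)"
      by (intro tendsto_intros)
    then have "c \<le> (t - s) * (cdf M t - cdf M s)"
    proof (rule tendsto_lowerbound)
      show "\<forall>\<^sub>F x in at_right t. c \<le> (x - s) * (cdf M x - cdf M s)"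
        using eventually_at_right_real[OF that] by eventually_elim (use above in auto)
    qed auto
    then show ?thesis using st by (simp add: measure_Ioc)
  qed
  show ?thesis by (rule that[OF st tb 1 2])
qed

text \<open>Induction on the budget, measured in units of \<open>sqrt c\<close>. A maximal piece
  that stops before \<open>b\<close> uses up at least one unit by \<open>sqrt_mult_add_le\<close>,
  so one cut lowers \<open>n\<close> by one; strictness excludes an empty budget and leaves fewer
  than \<open>n\<close> cuts.\<close>

lemma ex_cut_points:
  assumes c: "0 < c" and "0 \<le> s" "s < b"
    and "sqrt ((b - s) * measure M {s<..<b}) < real n * sqrt c"
  shows "\<exists>C. finite C \<and> C \<subseteq> {s<..<b} \<and> card C < n \<and>
     (\<forall>u v. H1_pair b u v \<longrightarrow> u s = 0 \<longrightarrow> u b = 0 \<longrightarrow> (\<forall>x\<in>C. u x = 0) \<longrightarrow>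
       (LINT x:{s<..<b}|M. (u x)\<^sup>2) \<le> c / 4 * (LINT x:{s<..<b}|lborel. (v x)\<^sup>2))"
  using assms(2-)
proof (induction n arbitrary: s)
  case 0
  moreover have "0 \<le> sqrt ((b - s) * measure M {s<..<b})" using 0 by simp
  ultimately show ?case by simp
next
  case (Suc n)
  obtain t where t: "s < t" "t \<le> b" "(t - s) * measure M {s<..<t} \<le> c"
    "t < b \<Longrightarrow> c \<le> (t - s) * measure M {s<..t}"
    using ex_maximal_cut[OF Suc.prems(2) c] by blast
  show ?case
  proof (cases "t = b")
    case True
    show ?thesis
    proof (intro exI[of _ "{}"] conjI allI impI)
      fix u v assume "H1_pair b u v" "u s = 0" "u b = 0"
      then show "(LINT x:{s<..<b}|M. (u x)\<^sup>2) \<le> c / 4 * (LINT x:{s<..<b}|lborel. (v x)\<^sup>2)"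
        using t True Suc.prems by (intro segment_integral_le) auto
    qed auto
  next
    case False
    then have tb: "t < b" using t by simp
    have "measure M {s<..<b} = measure M ({s<..t} \<union> {t<..<b})"
      using t tb by (intro arg_cong[where f="measure M"]) auto
    also have "\<dots> = measure M {s<..t} + measure M {t<..<b}"
      by (rule finite_measure_Union) auto
    finally have "sqrt ((t - s) * measure M {s<..t}) + sqrt ((b - t) * measure M {t<..<b}) \<le> sqrt ((b - s) * measure M {s<..<b})"
      using sqrt_mult_add_le[of "t - s" "b - t" "measure M {s<..t}" "measure M {t<..<b}"] t by simp
    moreover have "sqrt c \<le> sqrt ((t - s) * measure M {s<..t})"
      using t(4)[OF tb] by (rule real_sqrt_le_mono)
    moreover have "real (Suc n) * sqrt c = sqrt c + real n * sqrt c" by (simp add: distrib_right)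
    ultimately have "sqrt ((b - t) * measure M {t<..<b}) < real n * sqrt c"
      using Suc.prems(3) by linarith
    with Suc.IH[of t] t tb Suc.prems obtain C where C: "finite C" "C \<subseteq> {t<..<b}" "card C < n"
      and *: "\<And>u v. H1_pair b u v \<Longrightarrow> u t = 0 \<Longrightarrow> u b = 0 \<Longrightarrow> \<forall>x\<in>C. u x = 0 \<Longrightarrow>
       (LINT x:{t<..<b}|M. (u x)\<^sup>2) \<le> c / 4 * (LINT x:{t<..<b}|lborel. (v x)\<^sup>2)"
      by auto
    show ?thesis
    proof (intro exI[of _ "insert t C"] conjI allI impI)
      show "finite (insert t C)" "insert t C \<subseteq> {s<..<b}" using C t tb by auto
      show "card (insert t C) < Suc n" using C card_insert_le_m1[of "Suc n" C t] by (simp add: card_insert_if)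
      fix u v assume p: "H1_pair b u v" and u: "u s = 0" "u b = 0" "\<forall>x\<in>insert t C. u x = 0"
      have uc: "continuous_on {0..b} u" using p by (simp add: H1_pair_def)
      \<comment> \<open>The cut point \<open>t\<close> may be an atom of \<open>M\<close>, but the
        integrand vanishes there.\<close>
      have "(LINT x:{s<..<b}|M. (u x)\<^sup>2) = (LINT x:{s<..<t} \<union> {t<..<b}|M. (u x)\<^sup>2)"
        unfolding set_lebesgue_integral_def
        by (rule Bochner_Integration.integral_cong) (use u t tb in \<open>auto split: split_indicator\<close>)
      also have "\<dots> = (LINT x:{s<..<t}|M. (u x)\<^sup>2) + (LINT x:{t<..<b}|M. (u x)\<^sup>2)"
        using t tb Suc.prems by (intro set_integral_Un set_integrable_square[OF uc]) auto
      also have "\<dots> \<le> c / 4 * (LINT x:{s<..<t}|lborel. (v x)\<^sup>2) + c / 4 * (LINT x:{t<..<b}|lborel. (v x)\<^sup>2)"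
        using t tb Suc.prems u by (intro add_mono segment_integral_le[OF p] *[OF p]) auto
      also have "\<dots> = c / 4 * ((LINT x:{s<..<t}|lborel. (v x)\<^sup>2) + (LINT x:{t<..<b}|lborel. (v x)\<^sup>2))"
        by (simp add: distrib_left)
      also have "(LINT x:{s<..<t}|lborel. (v x)\<^sup>2) + (LINT x:{t<..<b}|lborel. (v x)\<^sup>2) = (LINT x:{s<..<b}|lborel. (v x)\<^sup>2)"
      proof (rule set_integral_split[symmetric])
        have "set_integrable lborel {0<..<b} (\<lambda>x. (v x)\<^sup>2)" using p by (simp add: H1_pair_def L2_interval_def)
        then show "set_integrable lborel {s<..<b} (\<lambda>x. (v x)\<^sup>2)"
          by (rule set_integrable_subset) (use Suc.prems in auto)
      qed (use t tb in auto)
      finally show "(LINT x:{s<..<b}|M. (u x)\<^sup>2) \<le> c / 4 * (LINT x:{s<..<b}|lborel. (v x)\<^sup>2)" .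
    qed
  qed
qed

end

section \<open>Common zeros of linear functionals\<close>

context vector_space
begin

lemma functional_zero_on_span:
  assumes V: "subspace V" "B \<subseteq> V"
    and add: "\<And>f g. f \<in> V \<Longrightarrow> g \<in> V \<Longrightarrow> \<phi> (f + g) = \<phi> f + \<phi> g"
    and scale: "\<And>f r. f \<in> V \<Longrightarrow> \<phi> (scale r f) = r * \<phi> f"
    and B: "\<And>b. b \<in> B \<Longrightarrow> \<phi> b = 0" and f: "f \<in> span B"
  shows "\<phi> f = 0"
proof -
  have "subspace {f \<in> V. \<phi> f = 0}"
  proof (rule subspaceI)
    have 0: "0 \<in> V" using V(1) by (rule subspace_0)
    then have "\<phi> (scale 0 0) = 0" using scale[of 0 0] by simp
    then show "0 \<in> {f \<in> V. \<phi> f = 0}" using 0 by simp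
  qed (use V add scale in \<open>auto intro: subspace_add subspace_scale\<close>)
  then show ?thesis using span_minimal[of B "{f \<in> V. \<phi> f = 0}"] V(2) B f by blast
qed

text \<open>Gaussian elimination: if some \<open>b\<close> in \<open>B\<close> is not annihilated by
  \<open>c\<close>, it serves as a pivot, and shifting the other vectors by multiples of it moves
  them into the kernel of \<open>\<phi> c\<close>. Each functional thus costs at most one
  vector.\<close>

lemma ex_common_zero:
  assumes "finite C" and "finite B" "independent B" "card C < card B"
    and V: "subspace V" and "B \<subseteq> V"
    and "\<And>c f g. c \<in> C \<Longrightarrow> f \<in> V \<Longrightarrow> g \<in> V \<Longrightarrow> \<phi> c (f + g) = \<phi> c f + \<phi> c g"
    and "\<And>c f r. c \<in> C \<Longrightarrow> f \<in> V \<Longrightarrow> \<phi> c (scale r f) = r * \<phi> c f"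
  shows "\<exists>f\<in>span B. f \<noteq> 0 \<and> (\<forall>c\<in>C. \<phi> c f = 0)"
  using assms(1-4) assms(6-)
proof (induction C arbitrary: B rule: finite_induct)
  case empty
  then obtain b where b: "b \<in> B" by fastforce
  then have "b \<noteq> 0" using empty.prems(2) dependent_zero by metis
  then show ?case using span_base[OF b] by auto
next
  case (insert c C)
  note add = insert.prems(5) and scl = insert.prems(6) and BV = insert.prems(4)
  show ?case
  proof (cases "\<forall>b\<in>B. \<phi> c b = 0")
    case True
    have "\<exists>f\<in>span B. f \<noteq> 0 \<and> (\<forall>c\<in>C. \<phi> c f = 0)"
    proof (rule insert.IH)
      show "card C < card B" using insert.prems(3) insert.hyps by simp
    qed (use insert.prems in auto)
    moreover have "\<phi> c f = 0" if "f \<in> span B" for f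
      by (rule functional_zero_on_span[OF V BV _ _ _ that]) (use add scl True in auto)
    ultimately show ?thesis by auto
  next
    case False
    then obtain b where b: "b \<in> B" "\<phi> c b \<noteq> 0" by blast
    define B' where "B' = B - {b}"
    have B': "finite B'" "b \<notin> B'" "B = insert b B'" using b insert.prems by (auto simp: B'_def)
    have indB': "independent B'"
      by (rule independent_mono[OF insert.prems(2)]) (auto simp: B'_def)
    have nb: "b \<notin> span B'"
      using insert.prems(2) B' by (metis independent_insert)
    \<comment> \<open>The coefficient that makes \<open>\<phi> c\<close> vanish at x + k x b. The
      shifted vectors remain independent, since a relation among them would either put the pivot
      into the span of \<open>B'\<close> or be a relation within \<open>B'\<close>.\<close>
    define k where "k x = - \<phi> c x / \<phi> c b" for x
    define h where "h x = x + scale (k x) b" for x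
    have bV: "scale r b \<in> V" for r
      using V BV b subspace_scale by blast
    have hV: "h x \<in> V" if "x \<in> B'" for x
      unfolding h_def using BV B' bV that by (intro subspace_add[OF V]) auto
    have h0: "\<phi> c (h x) = 0" if "x \<in> B'" for x
    proof -
      have "\<phi> c (h x) = \<phi> c x + k x * \<phi> c b"
        unfolding h_def using BV B' bV that b add[of c x "scale (k x) b"] scl[of c b "k x"] by auto
      then show ?thesis using b by (simp add: k_def)
    qed
    have comb: "(\<Sum>x\<in>B'. scale (u x) (h x)) = (\<Sum>x\<in>B'. scale (u x) x) + scale (\<Sum>x\<in>B'. u x * k x) b" for u
      by (simp add: h_def scale_right_distrib sum.distrib scale_sum_left)
    have dep: "u x = 0" if u: "(\<Sum>x\<in>B'. scale (u x) (h x)) = 0" "x \<in> B'" for u x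
    proof -
      have sp: "(\<Sum>x\<in>B'. scale (u x) x) \<in> span B'"
        by (intro span_sum span_scale span_base)
      let ?K = "\<Sum>x\<in>B'. u x * k x"
      have "?K = 0"
      proof (rule ccontr)
        assume K: "?K \<noteq> 0"
        have "scale ?K b = - (\<Sum>x\<in>B'. scale (u x) x)"
          using u(1) unfolding comb by (simp add: eq_neg_iff_add_eq_0 add.commute)
        then have "scale ?K b \<in> span B'" using span_neg[OF sp] by simp
        then have "scale (1 / ?K) (scale ?K b) \<in> span B'" by (rule span_scale)
        then show False using nb K by simp
      qed
      then have "(\<Sum>x\<in>B'. scale (u x) x) = 0"
        using u(1)[unfolded comb] by simp
      then show ?thesis using independentD[OF indB' B'(1) subset_refl _ u(2)] by blast
    qed
    have inj: "inj_on h B'"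
    proof (rule inj_onI, rule ccontr)
      fix x y assume xy: "x \<in> B'" "y \<in> B'" "h x = h y" "x \<noteq> y"
      let ?u = "\<lambda>w. if w = x then 1 else if w = y then - 1 else (0 :: 'a)"
      have "(\<Sum>w\<in>B'. scale (?u w) (h w)) = (\<Sum>w\<in>{x,y}. scale (?u w) (h w))"
        by (rule sum.mono_neutral_right) (use xy B' in auto)
      also have "\<dots> = 0" using xy by auto
      finally have "?u x = 0" using xy(1) by (rule dep[where u="?u" and x=x])
      then show False by simp
    qed
    have ind: "independent (h ` B')"
    proof (rule independent_if_scalars_zero)
      show "finite (h ` B')" using B' by simp
      fix u y assume s: "(\<Sum>x\<in>h ` B'. scale (u x) x) = 0" and y: "y \<in> h ` B'"
      then obtain x where x: "x \<in> B'" "y = h x" by blast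
      have "(\<Sum>x\<in>B'. scale (u (h x)) (h x)) = 0"
        using s by (simp add: sum.reindex[OF inj])
      then show "u y = 0" using dep[of "\<lambda>x. u (h x)"] x by blast
    qed
    have "\<exists>f\<in>span (h ` B'). f \<noteq> 0 \<and> (\<forall>c\<in>C. \<phi> c f = 0)"
    proof (rule insert.IH)
      show "card C < card (h ` B')"
        using insert.prems(3) insert.hyps B' by (simp add: card_image inj)
      show "finite (h ` B')" using B' by simp
      show "h ` B' \<subseteq> V" using hV by blast
    qed (use ind add scl in auto)
    then obtain f where f: "f \<in> span (h ` B')" "f \<noteq> 0" "\<forall>c\<in>C. \<phi> c f = 0" by blast
    have "h ` B' \<subseteq> span B"
    proof
      fix y assume "y \<in> h ` B'"
      then obtain x where "x \<in> B" "y = x + scale (k x) b" using B' by (auto simp: h_def)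
      then show "y \<in> span B" using b(1) by (simp add: span_add span_scale span_base)
    qed
    then have f': "f \<in> span B" using f(1) span_minimal[OF _ subspace_span] by blast
    have "\<phi> c f = 0"
    proof (rule functional_zero_on_span[OF V _ _ _ _ f(1)])
      show "h ` B' \<subseteq> V" using hV by blast
    qed (use add scl h0 in auto)
    then show ?thesis using f f' by blast
  qed
qed

end

section \<open>The energy form on the graph\<close>

lemma fun_sum_apply: "(\<Sum>b\<in>B. g b) x = (\<Sum>b\<in>B. (g b x :: real))"
  by (induction B rule: infinite_finite_induct) auto

context metric_graph
begin

abbreviation "T \<equiv> graph_topology G l"

abbreviation on :: "(('v, 'e) gpoint \<Rightarrow> real) \<Rightarrow> 'e \<Rightarrow> real \<Rightarrow> real" where
  "on \<equiv> on_edge G l"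

lemma edge_point_in: "e \<in> arcs G \<Longrightarrow> edge_point G l e t \<in> gpoints G l"
  by (auto simp: edge_point_def gpoints_def)

lemma openin_T_Pow: "{U. openin T U} \<subseteq> Pow (gpoints G l)"
  using openin_subset[of T] by (auto simp: topspace_graph_topology)

lemma gpoint_cases:
  assumes "x \<in> gpoints G l"
  obtains e t where "e \<in> arcs G" "t \<in> {0..l e}" "x = edge_point G l e t"
proof -
  have "x \<in> case_prod (edge_point G l) ` topspace (edge_union G l)"
    using assms edge_point_image by simp
  then obtain e t where "(e, t) \<in> topspace (edge_union G l)" "x = edge_point G l e t" by auto
  then show ?thesis by (intro that[of e t]) (auto simp: topspace_edge_union)
qed

lemma continuous_map_edge_point:
  assumes "e \<in> arcs G"
  shows "continuous_map (top_of_set {0..l e}) T (edge_point G l e)"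
proof -
  have "continuous_map (top_of_set {0..l e}) (edge_union G l) (Pair e)"
    unfolding edge_union_def using assms by (rule continuous_map_component_injection)
  then have "continuous_map (top_of_set {0..l e}) T (case_prod (edge_point G l) \<circ> Pair e)"
    by (rule continuous_map_compose[OF _ quotient_imp_continuous_map[OF quotient_map_graph_topology]])
  then show ?thesis by (simp add: comp_def)
qed

text \<open>Continuity on a quotient is continuity of the pullback, and on a disjoint sum it is
  checked on each summand.\<close>

lemma continuous_on_edges_iff:
  "continuous_map T euclideanreal f \<longleftrightarrow> (\<forall>e\<in>arcs G. continuous_on {0..l e} (on f e))"
proof
  assume f: "continuous_map T euclideanreal f"
  show "\<forall>e\<in>arcs G. continuous_on {0..l e} (on f e)"
  proof
    fix e assume "e \<in> arcs G"
    from continuous_map_compose[OF continuous_map_edge_point[OF this] f]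
    have "continuous_map (top_of_set {0..l e}) euclideanreal (on f e)"
      by (simp add: comp_def on_edge_def[abs_def])
    then show "continuous_on {0..l e} (on f e)" by simp
  qed
next
  assume c: "\<forall>e\<in>arcs G. continuous_on {0..l e} (on f e)"
  have "continuous_map (edge_union G l) euclideanreal (f \<circ> case_prod (edge_point G l))"
    unfolding continuous_map_alt
  proof (intro conjI allI impI)
    fix U :: "real set" assume U: "openin euclideanreal U"
    let ?P = "(f \<circ> case_prod (edge_point G l)) -` U \<inter> topspace (edge_union G l)"
    have "openin (top_of_set {0..l e}) {x. (e, x) \<in> ?P}" if e: "e \<in> arcs G" for e
    proof -
      have "{x. (e, x) \<in> ?P} = {0..l e} \<inter> on f e -` U"
        using e by (auto simp: topspace_edge_union on_edge_def)
      then show ?thesis using c e U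
        by (metis continuous_openin_preimage_gen open_openin)
    qed
    moreover have "?P \<subseteq> Sigma (arcs G) (topspace \<circ> (\<lambda>e. top_of_set {0..l e}))"
      by (auto simp: topspace_edge_union)
    ultimately show "openin (edge_union G l) ?P"
      unfolding edge_union_def openin_sum_topology by (auto simp: edge_union_def)
  qed auto
  then show "continuous_map T euclideanreal f"
    by (simp add: continuous_compose_quotient_map_eq[OF quotient_map_graph_topology])
qed

lemma H1_iff:
  "f \<in> H1 G l \<longleftrightarrow> (\<forall>x. x \<notin> gpoints G l \<longrightarrow> f x = 0) \<and>
     (\<forall>e\<in>arcs G. \<exists>v. H1_pair (l e) (on f e) v)"
proof -
  have "(\<exists>v. H1_pair (l e) (on f e) v) \<longleftrightarrow> continuous_on {0..l e} (on f e) \<and> on f e \<in> H1_interval (l e)" for e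
    by (meson H1_pair_H1 H1_pair_def H1_pair_weak_deriv)
  then show ?thesis unfolding H1_def continuous_on_edges_iff by blast
qed

abbreviation "wd f e \<equiv> weak_deriv (l e) (on f e)"

lemma H1_wd: "f \<in> H1 G l \<Longrightarrow> e \<in> arcs G \<Longrightarrow> H1_pair (l e) (on f e) (wd f e)"
  unfolding H1_def continuous_on_edges_iff by (blast intro: H1_pair_weak_deriv)

lemma wd_L2: "f \<in> H1 G l \<Longrightarrow> e \<in> arcs G \<Longrightarrow> wd f e \<in> L2_interval (l e)"
  using H1_wd H1_pair_def by blast

lemma qform_eq:
  assumes "g \<in> H1 G l" "\<And>e. e \<in> arcs G \<Longrightarrow> H1_pair (l e) (on f e) (v e)"
  shows "qform G l f g = (\<Sum>e\<in>arcs G. LINT t:{0<..<l e}|lborel. v e t * wd g e t)"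
  unfolding qform_def by (intro sum.cong refl weak_deriv_integral assms wd_L2)

lemma qform_sym: "qform G l f g = qform G l g f"
  unfolding qform_def by (simp add: mult.commute)

lemma on_add: "on (f + g) e = (\<lambda>t. on f e t + on g e t)"
  and on_scale: "on (\<lambda>x. c * f x) e = (\<lambda>t. c * on f e t)"
  by (auto simp: on_edge_def)

lemma H1_subspace: "fun_space.subspace (H1 G l)"
proof (rule fun_space.subspaceI)
  show "0 \<in> H1 G l"
    using H1_pair_const[of _ 0] by (auto simp: H1_iff on_edge_def[abs_def])
  show "f + g \<in> H1 G l" if "f \<in> H1 G l" "g \<in> H1 G l" for f g
    unfolding H1_iff on_add using that H1_pair_add[OF H1_wd H1_wd] by (auto simp: H1_iff)
  show "(\<lambda>x. c * f x) \<in> H1 G l" if "f \<in> H1 G l" for c f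
    unfolding H1_iff on_scale using that H1_pair_scale[OF H1_wd] by (auto simp: H1_iff)
qed

lemma qform_add: 
  assumes "f \<in> H1 G l" "g \<in> H1 G l" "h \<in> H1 G l"
  shows "qform G l (f + g) h = qform G l f h + qform G l g h"
proof -
  have "qform G l (f + g) h = (\<Sum>e\<in>arcs G. LINT t:{0<..<l e}|lborel. (wd f e t + wd g e t) * wd h e t)"
    by (rule qform_eq[OF assms(3)]) (use assms in \<open>simp add: on_add H1_pair_add H1_wd\<close>)
  also have "\<dots> = (\<Sum>e\<in>arcs G. (LINT t:{0<..<l e}|lborel. wd f e t * wd h e t) + (LINT t:{0<..<l e}|lborel. wd g e t * wd h e t))"
    using assms by (intro sum.cong refl) (simp add: distrib_right set_integral_add L2_mult_integrable wd_L2)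
  finally show ?thesis by (simp add: sum.distrib qform_def)
qed

lemma qform_scale:
  assumes "f \<in> H1 G l" "h \<in> H1 G l"
  shows "qform G l (\<lambda>x. c * f x) h = c * qform G l f h"
proof -
  have "qform G l (\<lambda>x. c * f x) h = (\<Sum>e\<in>arcs G. LINT t:{0<..<l e}|lborel. (c * wd f e t) * wd h e t)"
    by (rule qform_eq[OF assms(2)]) (use assms in \<open>simp add: on_scale H1_pair_scale H1_wd\<close>)
  then show ?thesis by (simp add: qform_def sum_distrib_left mult.assoc)
qed

lemma qform_self: "qform G l f f = (\<Sum>e\<in>arcs G. LINT t:{0<..<l e}|lborel. (wd f e t)\<^sup>2)"
  by (simp add: qform_def power2_eq_square)

lemma wd_square_nonneg: "0 \<le> (LINT t:{0<..<l e}|lborel. (wd f e t)\<^sup>2)"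
  unfolding set_lebesgue_integral_def by (rule Bochner_Integration.integral_nonneg) auto

lemma edge_rtrancl:
  assumes "u \<in> verts G" "v \<in> verts G" "\<And>e. e \<in> arcs G \<Longrightarrow> P (tail G e) \<longleftrightarrow> P (head G e)" "P u"
  shows "P v"
proof -
  have "u \<rightarrow>\<^sup>*\<^bsub>with_proj (mk_symmetric G)\<^esub> v"
    using connected assms by (auto simp: Digraph_Component.connected_def strongly_connected_def)
  then have "(u, v) \<in> rtrancl_on (verts G) (\<Union>e\<in>arcs G. {(tail G e, head G e), (head G e, tail G e)})"
    by (simp add: reachable_def parcs_mk_symmetric arcs_ends_def arc_to_ends_def)
  then show ?thesis
    by (induction rule: rtrancl_on_induct) (use assms in auto)
qed

text \<open>On an edge, the squared increment of \<open>f\<close> is at most the length times the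
  energy, by the fundamental theorem and the Cauchy--Schwarz inequality, so it is 0; connectedness
  links the values at the vertices.\<close>

lemma qform_zero_const:
  assumes f: "f \<in> H1 G l" and q: "qform G l f f \<le> 0" and x: "x \<in> gpoints G l" and y: "y \<in> gpoints G l"
  shows "f x = f y"
proof -
  have "qform G l f f = 0" using q unfolding qform_self by (intro antisym sum_nonneg wd_square_nonneg)
  then have w0: "(LINT t:{0<..<l e}|lborel. (wd f e t)\<^sup>2) = 0" if "e \<in> arcs G" for e
    using that unfolding qform_self by (subst (asm) sum_nonneg_eq_0_iff) (auto simp: wd_square_nonneg)
  have const: "on f e t = on f e 0" if e: "e \<in> arcs G" and t: "t \<in> {0..l e}" for e t
  proof -
    have L2: "wd f e \<in> L2_interval (l e)" using wd_L2 f e by blast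
    have i: "set_integrable lborel {0<..<t} (wd f e)"
      by (rule set_integrable_subset[OF L2_integrable[OF L2]]) (use t in auto)
    have i2: "set_integrable lborel {0<..<l e} (\<lambda>x. (wd f e x)\<^sup>2)" using L2 by (simp add: L2_interval_def)
    have i2': "set_integrable lborel {0<..<t} (\<lambda>x. (wd f e x)\<^sup>2)"
      by (rule set_integrable_subset[OF i2]) (use t in auto)
    have le: "(LINT x:{0<..<t}|lborel. (wd f e x)\<^sup>2) \<le> (LINT x:{0<..<l e}|lborel. (wd f e x)\<^sup>2)"
      using set_integral_split[OF i2, of t] t
      by (simp add: set_lebesgue_integral_def Bochner_Integration.integral_nonneg)
    have "(on f e t - on f e 0)\<^sup>2 = (LINT x:{0<..<t}|lborel. wd f e x)\<^sup>2"
      using H1_pair_FTC[OF H1_wd[OF f e], of 0 t] t by simp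
    also have "\<dots> \<le> (t - 0) * (LINT x:{0<..<t}|lborel. (wd f e x)\<^sup>2)"
      using t by (intro set_integral_cauchy_schwarz i i2') auto
    also have "\<dots> \<le> 0" using le w0[OF e] t by (simp add: mult_le_0_iff)
    finally show ?thesis by simp
  qed
  obtain e t where e: "e \<in> arcs G" "t \<in> {0..l e}" "x = edge_point G l e t" using x by (rule gpoint_cases)
  obtain e' t' where e': "e' \<in> arcs G" "t' \<in> {0..l e'}" "y = edge_point G l e' t'" using y by (rule gpoint_cases)
  have ends: "on f d 0 = f (Vertex (tail G d))" "on f d (l d) = f (Vertex (head G d))" if "d \<in> arcs G" for d
    using length_pos[OF that] by (auto simp: on_edge_def edge_point_def)
  have "f (Vertex (tail G e')) = f (Vertex (tail G e))"
  proof (rule edge_rtrancl[of "tail G e" "tail G e'" "\<lambda>v. f (Vertex v) = f (Vertex (tail G e))"])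
    show "(f (Vertex (tail G d)) = f (Vertex (tail G e))) = (f (Vertex (head G d)) = f (Vertex (tail G e)))"
      if "d \<in> arcs G" for d
      using const[OF that, of "l d"] ends[OF that] length_pos[OF that] by simp
  qed (use e e' in auto)
  then show ?thesis
    using const[OF e(1,2)] const[OF e'(1,2)] ends e e' by (simp add: on_edge_def)
qed

lemma H1_bounded:
  assumes "f \<in> H1 G l"
  obtains B where "\<And>x. \<bar>f x\<bar> \<le> B"
proof -
  have "\<exists>B. \<forall>t\<in>{0..l e}. \<bar>on f e t\<bar> \<le> B" if "e \<in> arcs G" for e
  proof -
    have "compact (on f e ` {0..l e})"
      using H1_wd[OF assms that] by (intro compact_continuous_image) (auto simp: H1_pair_def)
    then show ?thesis
      by (metis bounded_iff compact_imp_bounded imageI real_norm_def)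
  qed
  then obtain B where B: "\<And>e t. e \<in> arcs G \<Longrightarrow> t \<in> {0..l e} \<Longrightarrow> \<bar>on f e t\<bar> \<le> B e" by metis
  have "\<bar>f x\<bar> \<le> (\<Sum>e\<in>arcs G. \<bar>B e\<bar>)" for x
  proof (cases "x \<in> gpoints G l")
    case True
    then obtain e t where e: "e \<in> arcs G" "t \<in> {0..l e}" "x = edge_point G l e t" by (rule gpoint_cases)
    then have "\<bar>f x\<bar> \<le> \<bar>B e\<bar>" using B[of e t] by (simp add: on_edge_def)
    also have "\<dots> \<le> (\<Sum>e\<in>arcs G. \<bar>B e\<bar>)" using e by (intro member_le_sum) auto
    finally show ?thesis .
  next
    case False
    then show ?thesis using assms by (auto simp: H1_def sum_nonneg)
  qed
  then show ?thesis by (rule that)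
qed

end

section \<open>The lower bound\<close>

locale graph_measure = metric_graph G l
  for G :: "('v, 'e) pre_digraph" and l :: "'e \<Rightarrow> real" +
  fixes \<mu> :: "('v, 'e) gpoint measure"
  assumes \<mu>: "\<mu> \<in> borel_prob_measures G l"

sublocale graph_measure \<subseteq> prob_space \<mu>
  using \<mu> by (simp add: borel_prob_measures_def)

context graph_measure
begin

lemma sets_\<mu>: "sets \<mu> = sigma_sets (gpoints G l) {U. openin T U}"
  using \<mu> sets_measure_of[OF openin_T_Pow] by (simp add: borel_prob_measures_def)

lemma space_\<mu>: "space \<mu> = gpoints G l"
  using \<mu> space_measure_of[OF openin_T_Pow] sets_eq_imp_space_eq unfolding borel_prob_measures_def by blast

lemma open_in_sets: "openin T U \<Longrightarrow> U \<in> sets \<mu>"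
  by (simp add: sets_\<mu> sigma_sets.Basic)

lemma H1_measurable: "f \<in> H1 G l \<Longrightarrow> f \<in> borel_measurable \<mu>"
proof (rule borel_measurableI)
  fix S :: "real set" assume f: "f \<in> H1 G l" and S: "open S"
  then have "openin T {x \<in> topspace T. f x \<in> S}"
    by (intro openin_continuous_map_preimage[of T euclideanreal]) (auto simp: H1_def)
  moreover have "f -` S \<inter> space \<mu> = {x \<in> topspace T. f x \<in> S}"
    by (auto simp: space_\<mu> topspace_graph_topology)
  ultimately show "f -` S \<inter> space \<mu> \<in> sets \<mu>" using open_in_sets by simp
qed

lemma H1_mult_integrable:
  assumes "f \<in> H1 G l" "g \<in> H1 G l" shows "integrable \<mu> (\<lambda>x. f x * g x)"
proof -
  obtain A B where A: "\<And>x. \<bar>f x\<bar> \<le> A" and B: "\<And>x. \<bar>g x\<bar> \<le> B"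
    using H1_bounded assms by metis
  show ?thesis
  proof (rule integrable_const_bound[where B="A * B"])
    show "AE x in \<mu>. norm (f x * g x) \<le> A * B"
    proof (rule AE_I2)
      fix x
      have "0 \<le> A" using A[of x] by linarith
      then show "norm (f x * g x) \<le> A * B" using A[of x] B[of x] by (simp add: abs_mult mult_mono)
    qed
  qed (use assms H1_measurable in measurable)
qed

definition ip :: "(('v, 'e) gpoint \<Rightarrow> real) \<Rightarrow> (('v, 'e) gpoint \<Rightarrow> real) \<Rightarrow> real" where
  "ip f g = (LINT x|\<mu>. f x * g x)"

lemma ip_sym: "ip f g = ip g f"
  by (simp add: ip_def mult.commute)

lemma ip_nonneg: "0 \<le> ip f f"
  unfolding ip_def by (rule Bochner_Integration.integral_nonneg) simp

lemma ip_add: "f \<in> H1 G l \<Longrightarrow> g \<in> H1 G l \<Longrightarrow> h \<in> H1 G l \<Longrightarrow> ip (f + g) h = ip f h + ip g h"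
  by (simp add: ip_def distrib_right H1_mult_integrable)

lemma ip_scale: "ip (\<lambda>x. c * f x) h = c * ip f h"
  by (simp add: ip_def mult.assoc)

lemma form_sum:
  assumes "finite A" "\<And>a. a \<in> A \<Longrightarrow> F a \<in> H1 G l" "h \<in> H1 G l"
  shows "qform G l (\<Sum>a\<in>A. F a) h = (\<Sum>a\<in>A. qform G l (F a) h) \<and> ip (\<Sum>a\<in>A. F a) h = (\<Sum>a\<in>A. ip (F a) h)"
  using assms(1,2)
proof (induction A rule: finite_induct)
  case empty
  have "(0 :: ('v, 'e) gpoint \<Rightarrow> real) \<in> H1 G l" using H1_subspace by (rule fun_space.subspace_0)
  from qform_scale[OF this assms(3), of 0] show ?case by (simp add: ip_def zero_fun_def)
next
  case (insert a A)
  then have "F a \<in> H1 G l" "(\<Sum>a\<in>A. F a) \<in> H1 G l"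
    by (auto intro: fun_space.subspace_sum[OF H1_subspace])
  note H = this
  have IH: "qform G l (\<Sum>a\<in>A. F a) h = (\<Sum>a\<in>A. qform G l (F a) h)" "ip (\<Sum>a\<in>A. F a) h = (\<Sum>a\<in>A. ip (F a) h)"
    using insert by blast+
  show ?case
    unfolding sum.insert[OF insert.hyps] qform_add[OF H assms(3)] ip_add[OF H assms(3)] IH by simp
qed

text \<open>Zero energy makes \<open>f\<close> constant on the graph, and the integral of a constant
  square against a probability measure is that square. This makes eigenfunctions nonzero in L^2 of
  the measure once they are nonzero as functions.\<close>

lemma ip_zero_imp_zero:
  assumes f: "f \<in> H1 G l" and q: "qform G l f f \<le> 0" and i: "ip f f = 0"
  shows "f = 0"
proof
  fix x show "f x = 0 x"
  proof (cases "x \<in> gpoints G l")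
    case True
    have "ip f f = (LINT y|\<mu>. f x * f x)"
      unfolding ip_def by (rule Bochner_Integration.integral_cong) (use qform_zero_const[OF f q _ True] space_\<mu> in auto)
    then show ?thesis using i by (simp add: prob_space)
  next
    case False
    then show ?thesis using f by (simp add: H1_def)
  qed
qed

section \<open>Transport of the measure to the edge intervals\<close>

lemma openin_Inner:
  assumes "e \<in> arcs G" "0 \<le> s" "t \<le> l e"
  shows "openin T (Inner e ` {s<..<t})"
proof -
  let ?P = "{z \<in> topspace (edge_union G l). case_prod (edge_point G l) z \<in> Inner e ` {s<..<t}}"
  have "openin (top_of_set {0..l d}) {x. (d, x) \<in> ?P}" if d: "d \<in> arcs G" for d
  proof (cases "d = e")
    case True
    have "{x. (d, x) \<in> ?P} = {0..l d} \<inter> {s<..<t}"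
      using assms True by (auto simp: topspace_edge_union edge_point_def)
    then show ?thesis by auto
  next
    case False
    then have "{x. (d, x) \<in> ?P} = {}" by (auto simp: edge_point_def split: if_splits)
    then show ?thesis by (simp only: openin_empty)
  qed
  moreover have "?P \<subseteq> Sigma (arcs G) (topspace \<circ> (\<lambda>e. top_of_set {0..l e}))"
    by (auto simp: topspace_edge_union)
  ultimately have "openin (edge_union G l) ?P"
    unfolding edge_union_def openin_sum_topology by (auto simp: edge_union_def)
  then show ?thesis using assms by (auto simp: openin_graph_topology gpoints_def)
qed

text \<open>Points off the open edge go to 0, outside (0, l e). The image measure thus restricts on
  that interval to the mass of the edge, and the cutting lemma for measures on the line
  applies.\<close>

definition coord :: "'e \<Rightarrow> ('v, 'e) gpoint \<Rightarrow> real" where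
  "coord e x = (case x of Vertex v \<Rightarrow> 0 | Inner d t \<Rightarrow> if d = e then t else 0)"

lemma coord_measurable: assumes e: "e \<in> arcs G" shows "coord e \<in> borel_measurable \<mu>"
  unfolding borel_measurable_iff_greater
proof
  fix a :: real
  show "{x \<in> space \<mu>. a < coord e x} \<in> sets \<mu>"
  proof (cases "0 \<le> a")
    case True
    then have "{x \<in> space \<mu>. a < coord e x} = Inner e ` {a<..<l e}"
      using e by (auto simp: space_\<mu> gpoints_def coord_def split: if_splits)
    then show ?thesis using openin_Inner[OF e True, of "l e"] open_in_sets by simp
  next
    case False
    then have "{x \<in> space \<mu>. a < coord e x} = space \<mu>"
      by (auto simp: space_\<mu> gpoints_def coord_def split: if_splits)
    then show ?thesis by simp
  qed
qed

abbreviation inside :: "'e \<Rightarrow> ('v, 'e) gpoint set" where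
  "inside e \<equiv> Inner e ` {0<..<l e}"

lemma inside_sets: "e \<in> arcs G \<Longrightarrow> inside e \<in> sets \<mu>"
  by (rule open_in_sets[OF openin_Inner]) auto

lemma inside_mem: "inside e \<subseteq> gpoints G l" if "e \<in> arcs G"
  using that by (auto simp: gpoints_def)

lemma coord_vimage: "e \<in> arcs G \<Longrightarrow> x \<in> space \<mu> \<Longrightarrow> coord e x \<in> {0<..<l e} \<longleftrightarrow> x \<in> inside e"
  by (auto simp: space_\<mu> gpoints_def coord_def split: if_splits)

lemma edge_measure:
  assumes e: "e \<in> arcs G"
  shows "finite_borel_measure (distr \<mu> borel (coord e))"
    and "measure (distr \<mu> borel (coord e)) {0<..<l e} = measure \<mu> (inside e)"
proof -
  show "finite_borel_measure (distr \<mu> borel (coord e))"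
    unfolding finite_borel_measure_def finite_borel_measure_axioms_def
    using finite_measure_distr[OF coord_measurable[OF e]] by auto
  have "measure (distr \<mu> borel (coord e)) {0<..<l e} = measure \<mu> (coord e -` {0<..<l e} \<inter> space \<mu>)"
    by (rule measure_distr[OF coord_measurable[OF e]]) auto
  also have "coord e -` {0<..<l e} \<inter> space \<mu> = inside e"
    using coord_vimage[OF e] inside_mem[OF e] space_\<mu> by blast
  finally show "measure (distr \<mu> borel (coord e)) {0<..<l e} = measure \<mu> (inside e)" .
qed

lemma edge_integral:
  assumes e: "e \<in> arcs G" and f: "f \<in> H1 G l"
  shows "(LINT t:{0<..<l e}|distr \<mu> borel (coord e). (on f e t)\<^sup>2) = (LINT x:inside e|\<mu>. (f x)\<^sup>2)"
proof -
  have "continuous_on {0<..<l e} (\<lambda>t. (on f e t)\<^sup>2)"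
    by (rule continuous_on_subset[of "{0..l e}"])
       (use H1_wd[OF f e] in \<open>auto simp: H1_pair_def intro!: continuous_intros\<close>)
  then have "(\<lambda>t. indicator {0<..<l e} t *\<^sub>R (on f e t)\<^sup>2) \<in> borel_measurable borel"
    by (rule borel_measurable_continuous_on_indicator[rotated]) simp
  then have "(LINT t:{0<..<l e}|distr \<mu> borel (coord e). (on f e t)\<^sup>2) =
      (LINT x|\<mu>. indicator {0<..<l e} (coord e x) *\<^sub>R (on f e (coord e x))\<^sup>2)"
    unfolding set_lebesgue_integral_def by (rule integral_distr[OF coord_measurable[OF e]])
  also have "\<dots> = (LINT x:inside e|\<mu>. (f x)\<^sup>2)"
    unfolding set_lebesgue_integral_def
  proof (rule Bochner_Integration.integral_cong[OF refl])
    fix x assume x: "x \<in> space \<mu>"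
    show "indicator {0<..<l e} (coord e x) *\<^sub>R (on f e (coord e x))\<^sup>2 = indicator (inside e) x *\<^sub>R (f x)\<^sup>2"
    proof (cases "x \<in> inside e")
      case True
      then show ?thesis by (auto simp: coord_def on_edge_def edge_point_def)
    next
      case False
      then have "coord e x \<notin> {0<..<l e}" using coord_vimage[OF e x] by blast
      then show ?thesis using False by simp
    qed
  qed
  finally show ?thesis .
qed

lemma sum_inside_le: "(\<Sum>e\<in>arcs G. measure \<mu> (inside e)) \<le> 1"
proof -
  have "(\<Sum>e\<in>arcs G. measure \<mu> (inside e)) = measure \<mu> (\<Union>e\<in>arcs G. inside e)"
    using inside_sets by (intro finite_measure_finite_Union[symmetric]) (auto simp: disjoint_family_on_def)
  then show ?thesis by simp
qed

lemma integral_square_edges: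
  assumes f: "f \<in> H1 G l" and 0: "\<And>v. v \<in> verts G \<Longrightarrow> f (Vertex v) = 0"
  shows "ip f f = (\<Sum>e\<in>arcs G. LINT x:inside e|\<mu>. (f x)\<^sup>2)"
proof -
  have i: "integrable \<mu> (\<lambda>x. (f x)\<^sup>2)"
    using H1_mult_integrable[OF f f] by (simp add: power2_eq_square)
  have "(\<Sum>e\<in>arcs G. LINT x:inside e|\<mu>. (f x)\<^sup>2) = (LINT x|\<mu>. (\<Sum>e\<in>arcs G. indicator (inside e) x *\<^sub>R (f x)\<^sup>2))"
    unfolding set_lebesgue_integral_def
    using inside_sets i by (intro Bochner_Integration.integral_sum[symmetric] integrable_mult_indicator) auto
  also have "\<dots> = ip f f"
    unfolding ip_def
  proof (rule Bochner_Integration.integral_cong[OF refl])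
    fix x assume "x \<in> space \<mu>"
    then consider v where "x = Vertex v" "v \<in> verts G" | d where "d \<in> arcs G" "x \<in> inside d"
      by (auto simp: space_\<mu> gpoints_def)
    then show "(\<Sum>e\<in>arcs G. indicator (inside e) x *\<^sub>R (f x)\<^sup>2) = f x * f x"
    proof cases
      case 1
      then show ?thesis using 0 by simp
    next
      case 2
      then have "(\<Sum>e\<in>arcs G. indicator (inside e) x *\<^sub>R (f x)\<^sup>2) = (\<Sum>e\<in>arcs G. if e = d then (f x)\<^sup>2 else 0)"
        by (intro sum.cong) (auto simp: indicator_def)
      also have "\<dots> = (f x)\<^sup>2" using 2 by (simp add: sum.delta)
      finally show ?thesis by (simp add: power2_eq_square)
    qed
  qed
  finally show ?thesis by simp
qed

lemma ex_vanishing_set: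
  assumes r: "0 < r"
  obtains C where "finite C" "real (card C) \<le> card (verts G) + sqrt (total_length G l * r) / 2"
    "Vertex ` verts G \<subseteq> C"
    "\<And>f. f \<in> H1 G l \<Longrightarrow> \<forall>x\<in>C. f x = 0 \<Longrightarrow> r * ip f f \<le> qform G l f f"
proof -
  define m where "m e = measure \<mu> (inside e)" for e
  \<comment> \<open>\<open>segment_integral_le\<close> yields the factor c / 4, which has to equal 1
    / r.\<close>
  define c where "c = 4 / r"
  have c: "0 < c" using r by (simp add: c_def)
  \<comment> \<open>The floor plus 1 satisfies the strict budget inequality of
    \<open>ex_cut_points\<close>, which in turn yields fewer than \<open>Suc (n e)\<close>, hence at
    most \<open>n e\<close>, cuts.\<close>
  define n where "n e = nat \<lfloor>sqrt (l e * m e) / sqrt c\<rfloor>" for e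
  have m0: "0 \<le> m e" for e by (simp add: m_def)
  have n_le: "real (n e) \<le> sqrt (l e * m e) / sqrt c" if "e \<in> arcs G" for e
    unfolding n_def using length_pos[OF that] c m0[of e] by (intro of_nat_floor divide_nonneg_nonneg) auto
  have n_less: "sqrt (l e * m e) < real (Suc (n e)) * sqrt c" for e
  proof -
    have "sqrt (l e * m e) / sqrt c < real (Suc (n e))"
      unfolding n_def by linarith
    then show ?thesis using c by (simp add: divide_less_eq)
  qed
  define Q where "Q e K \<longleftrightarrow> finite K \<and> K \<subseteq> {0<..<l e} \<and> card K < Suc (n e) \<and>
     (\<forall>u v. H1_pair (l e) u v \<longrightarrow> u 0 = 0 \<longrightarrow> u (l e) = 0 \<longrightarrow> (\<forall>x\<in>K. u x = 0) \<longrightarrow>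
       (LINT x:{0<..<l e}|distr \<mu> borel (coord e). (u x)\<^sup>2) \<le> c / 4 * (LINT x:{0<..<l e}|lborel. (v x)\<^sup>2))" for e K
  have "\<forall>e\<in>arcs G. \<exists>K. Q e K"
  proof
    fix e assume e: "e \<in> arcs G"
    show "\<exists>K. Q e K"
      unfolding Q_def
      by (rule finite_borel_measure.ex_cut_points[OF edge_measure(1)[OF e] c])
         (use n_less[of e] length_pos[OF e] edge_measure(2)[OF e] in \<open>auto simp: m_def\<close>)
  qed
  from bchoice[OF this] obtain K where Q: "\<And>e. e \<in> arcs G \<Longrightarrow> Q e (K e)" by blast
  have K: "finite (K e)" "K e \<subseteq> {0<..<l e}" "card (K e) \<le> n e" if "e \<in> arcs G" for e
    using Q[OF that] by (auto simp: Q_def)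
  have K4: "(LINT x:{0<..<l e}|distr \<mu> borel (coord e). (u x)\<^sup>2) \<le> c / 4 * (LINT x:{0<..<l e}|lborel. (v x)\<^sup>2)"
    if "e \<in> arcs G" "H1_pair (l e) u v" "u 0 = 0" "u (l e) = 0" "\<forall>x\<in>K e. u x = 0" for e u v
    using Q[OF that(1)] that(2-) unfolding Q_def by blast
  define C where "C = Vertex ` verts G \<union> (\<Union>e\<in>arcs G. Inner e ` K e)"
  have "card C \<le> card (Vertex ` verts G :: ('v, 'e) gpoint set) + card (\<Union>e\<in>arcs G. Inner e ` K e :: ('v, 'e) gpoint set)"
    unfolding C_def by (rule card_Un_le)
  also have "\<dots> \<le> card (verts G) + (\<Sum>e\<in>arcs G. card (Inner e ` K e :: ('v, 'e) gpoint set))"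
    by (intro add_mono card_image_le card_UN_le) auto
  also have "\<dots> \<le> card (verts G) + (\<Sum>e\<in>arcs G. n e)"
    by (intro add_mono sum_mono order_refl order_trans[OF card_image_le[OF K(1)] K(3)])
  finally have "real (card C) \<le> real (card (verts G) + (\<Sum>e\<in>arcs G. n e))"
    by (rule of_nat_mono)
  then have "real (card C) \<le> real (card (verts G)) + (\<Sum>e\<in>arcs G. real (n e))"
    by simp
  \<comment> \<open>The absolute values give the sum the shape of \<open>L2_set_mult_ineq\<close>,
    to be applied across the edges.\<close>
  also have "(\<Sum>e\<in>arcs G. real (n e)) \<le> (\<Sum>e\<in>arcs G. \<bar>sqrt (l e)\<bar> * \<bar>sqrt (m e)\<bar> / sqrt c)"
  proof (rule sum_mono)
    fix e assume e: "e \<in> arcs G"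
    have "sqrt (l e * m e) = \<bar>sqrt (l e)\<bar> * \<bar>sqrt (m e)\<bar>"
      using length_pos[OF e] m0[of e] by (simp add: real_sqrt_mult)
    then show "real (n e) \<le> \<bar>sqrt (l e)\<bar> * \<bar>sqrt (m e)\<bar> / sqrt c" using n_le[OF e] by simp
  qed
  also have "\<dots> \<le> sqrt (total_length G l * r) / 2"
  proof -
    have "(\<Sum>e\<in>arcs G. \<bar>sqrt (l e)\<bar> * \<bar>sqrt (m e)\<bar>) \<le> L2_set (\<lambda>e. sqrt (l e)) (arcs G) * L2_set (\<lambda>e. sqrt (m e)) (arcs G)"
      by (rule L2_set_mult_ineq)
    also have "L2_set (\<lambda>e. sqrt (l e)) (arcs G) = sqrt (total_length G l)"
      unfolding L2_set_def total_length_def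
      by (intro arg_cong[where f=sqrt] sum.cong) (use length_pos in \<open>auto intro: less_imp_le\<close>)
    also have "L2_set (\<lambda>e. sqrt (m e)) (arcs G) = sqrt (\<Sum>e\<in>arcs G. m e)"
      unfolding L2_set_def by (intro arg_cong[where f=sqrt] sum.cong) (use m0 in auto)
    also have "sqrt (total_length G l) * sqrt (\<Sum>e\<in>arcs G. m e) \<le> sqrt (total_length G l) * 1"
      using sum_inside_le length_pos
      by (intro mult_left_mono) (auto simp: m_def total_length_def less_imp_le intro!: sum_nonneg)
    finally have "(\<Sum>e\<in>arcs G. \<bar>sqrt (l e)\<bar> * \<bar>sqrt (m e)\<bar>) / sqrt c \<le> sqrt (total_length G l) / sqrt c"
      using c by (intro divide_right_mono) auto
    also have "\<dots> = sqrt (total_length G l * r) / 2"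
      using r by (simp add: c_def real_sqrt_divide real_sqrt_mult)
    finally show ?thesis by (simp add: sum_divide_distrib)
  qed
  finally have card: "real (card C) \<le> card (verts G) + sqrt (total_length G l * r) / 2" by simp
  show ?thesis
  proof (rule that[OF _ card])
    show "finite C" using K(1) by (auto simp: C_def)
    show "Vertex ` verts G \<subseteq> C" by (simp add: C_def)
    fix f assume f: "f \<in> H1 G l" and 0: "\<forall>x\<in>C. f x = 0"
    have "ip f f = (\<Sum>e\<in>arcs G. LINT x:inside e|\<mu>. (f x)\<^sup>2)"
      using 0 by (intro integral_square_edges[OF f]) (auto simp: C_def)
    also have "\<dots> = (\<Sum>e\<in>arcs G. LINT t:{0<..<l e}|distr \<mu> borel (coord e). (on f e t)\<^sup>2)"
      by (intro sum.cong refl) (simp add: edge_integral f)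
    also have "\<dots> \<le> (\<Sum>e\<in>arcs G. c / 4 * (LINT x:{0<..<l e}|lborel. (wd f e x)\<^sup>2))"
    proof (rule sum_mono)
      fix e assume e: "e \<in> arcs G"
      have "\<forall>x\<in>K e. on f e x = 0"
        using 0 K(2)[OF e] e by (force simp: C_def on_edge_def edge_point_def)
      then show "(LINT t:{0<..<l e}|distr \<mu> borel (coord e). (on f e t)\<^sup>2) \<le> c / 4 * (LINT x:{0<..<l e}|lborel. (wd f e x)\<^sup>2)"
        using 0 e length_pos[OF e]
        by (intro K4[OF e H1_wd[OF f e]]) (auto simp: C_def on_edge_def edge_point_def)
    qed
    also have "\<dots> = qform G l f f / r"
      by (simp add: qform_self sum_distrib_left c_def flip: sum_divide_distrib)
    finally show "r * ip f f \<le> qform G l f f" using r by (simp add: field_simps)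
  qed
qed

end

text \<open>An infinite basis has \<open>card\<close> 0, and then the empty set already has the
  required cardinality. Multiplicities are defined by \<open>dim\<close>, so this supplies finite
  families for the counting argument in every case.\<close>

lemma (in vector_space) ex_basis_card:
  obtains B where "B \<subseteq> V" "independent B" "finite B" "card B = dim V"
proof -
  obtain B where B: "B \<subseteq> V" "independent B" "card B = dim V"
    by (rule basis_exists[of V])
  show ?thesis
  proof (cases "finite B")
    case True
    then show ?thesis using B that by blast
  next
    case False
    then show ?thesis using B that[of "{}"] by (simp add: independent_empty)
  qed
qed

context graph_measure
begin

section \<open>Eigenspaces and the counting bound\<close>

lemma H1_mu_H1: "f \<in> H1_mu G l \<mu> \<Longrightarrow> f \<in> H1 G l"
  by (simp add: H1_mu_def)

lemma H1_mu_iff: "f \<in> H1_mu G l \<mu> \<longleftrightarrow> f \<in> H1 G l \<and>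
    (\<forall>g\<in>H1 G l. (\<forall>x\<in>msupport G l \<mu>. g x = 0) \<longrightarrow> qform G l f g = 0)"
proof -
  have "gpoints G l - (gpoints G l - msupport G l \<mu>) = msupport G l \<mu>"
    by (auto simp: msupport_def)
  then show ?thesis by (simp add: H1_mu_def harmonic_on_graph_def)
qed

lemma H1_mu_subspace: "fun_space.subspace (H1_mu G l \<mu>)"
proof (rule fun_space.subspaceI)
  note S = H1_subspace
  show "0 \<in> H1_mu G l \<mu>"
  proof -
    have 0: "(0 :: ('v, 'e) gpoint \<Rightarrow> real) \<in> H1 G l" by (rule fun_space.subspace_0[OF S])
    from qform_scale[OF this, of _ 0] show ?thesis using 0 by (auto simp: H1_mu_iff zero_fun_def)
  qed
  show "f + g \<in> H1_mu G l \<mu>" if "f \<in> H1_mu G l \<mu>" "g \<in> H1_mu G l \<mu>" for f g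
    using that fun_space.subspace_add[OF S] qform_add unfolding H1_mu_iff by force
  show "(\<lambda>x. c * f x) \<in> H1_mu G l \<mu>" if "f \<in> H1_mu G l \<mu>" for c f
    using that fun_space.subspace_scale[OF S] qform_scale unfolding H1_mu_iff by force
qed

abbreviation "E \<equiv> eigenspace G l \<mu>"

lemma E_iff: "f \<in> E \<eta> \<longleftrightarrow> f \<in> H1_mu G l \<mu> \<and> (\<forall>\<phi>\<in>H1_mu G l \<mu>. qform G l f \<phi> = \<eta> * ip f \<phi>)"
proof -
  have "(\<lambda>x. \<eta> * f x) \<in> borel_measurable \<mu> \<and> integrable \<mu> (\<lambda>x. (\<eta> * f x)\<^sup>2)" if "f \<in> H1_mu G l \<mu>"
  proof
    have f: "f \<in> H1 G l" using that by (rule H1_mu_H1)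
    show "(\<lambda>x. \<eta> * f x) \<in> borel_measurable \<mu>" using H1_measurable[OF f] by measurable
    have "integrable \<mu> (\<lambda>x. \<eta>\<^sup>2 * (f x * f x))" using H1_mult_integrable[OF f f] by simp
    moreover have "(\<eta> * f x)\<^sup>2 = \<eta>\<^sup>2 * (f x * f x)" for x
      by (simp add: power_mult_distrib power2_eq_square)
    ultimately show "integrable \<mu> (\<lambda>x. (\<eta> * f x)\<^sup>2)" by simp
  qed
  then show ?thesis
    by (auto simp: eigenspace_def H_op_def ip_def mult.assoc)
qed

lemma E_H1: "f \<in> E \<eta> \<Longrightarrow> f \<in> H1 G l"
  by (simp add: E_iff H1_mu_H1)

lemma E_subspace: "fun_space.subspace (E \<eta>)"
proof (rule fun_space.subspaceI)
  note S = H1_mu_subspace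
  show "0 \<in> E \<eta>"
  proof -
    have 0: "(0 :: ('v, 'e) gpoint \<Rightarrow> real) \<in> H1_mu G l \<mu>" by (rule fun_space.subspace_0[OF S])
    from qform_scale[OF H1_mu_H1[OF this], of _ 0] show ?thesis
      using 0 H1_mu_H1 by (auto simp: E_iff zero_fun_def ip_def)
  qed
  show "f + g \<in> E \<eta>" if "f \<in> E \<eta>" "g \<in> E \<eta>" for f g
    unfolding E_iff
  proof (intro conjI ballI)
    show "f + g \<in> H1_mu G l \<mu>" using that fun_space.subspace_add[OF S] unfolding E_iff by blast
    fix \<phi> assume \<phi>: "\<phi> \<in> H1_mu G l \<mu>"
    have "qform G l (f + g) \<phi> = qform G l f \<phi> + qform G l g \<phi>" "ip (f + g) \<phi> = ip f \<phi> + ip g \<phi>"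
      using that \<phi> by (simp_all only: qform_add ip_add E_H1 H1_mu_H1)
    then show "qform G l (f + g) \<phi> = \<eta> * ip (f + g) \<phi>"
      using that \<phi> by (simp only: E_iff distrib_left)
  qed
  show "(\<lambda>x. c * f x) \<in> E \<eta>" if "f \<in> E \<eta>" for c f
    unfolding E_iff
  proof (intro conjI ballI)
    show "(\<lambda>x. c * f x) \<in> H1_mu G l \<mu>" using that fun_space.subspace_scale[OF S] unfolding E_iff by blast
    fix \<phi> assume \<phi>: "\<phi> \<in> H1_mu G l \<mu>"
    have "qform G l (\<lambda>x. c * f x) \<phi> = c * qform G l f \<phi>"
      using that \<phi> by (intro qform_scale E_H1 H1_mu_H1)
    then show "qform G l (\<lambda>x. c * f x) \<phi> = \<eta> * ip (\<lambda>x. c * f x) \<phi>"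
      using that \<phi> by (simp add: E_iff ip_scale)
  qed
qed

lemma E_form: "f \<in> E \<eta> \<Longrightarrow> g \<in> E \<theta> \<Longrightarrow> qform G l f g = \<eta> * ip f g"
  by (auto simp: E_iff)

lemma E_orthogonal:
  assumes "f \<in> E \<eta>" "g \<in> E \<theta>" "\<eta> \<noteq> \<theta>" shows "ip f g = 0"
proof -
  have "\<eta> * ip f g = \<theta> * ip f g"
    using E_form[OF assms(1,2)] E_form[OF assms(2,1)] unfolding qform_sym[of g f] ip_sym[of g f] by linarith
  then show ?thesis using assms(3) by simp
qed

lemma E_zero: "f \<in> E \<eta> \<Longrightarrow> ip f f = 0 \<Longrightarrow> f = 0"
  by (rule ip_zero_imp_zero) (auto simp: E_form E_H1)

lemma E_sum_forms:
  assumes S: "finite S" and F: "\<And>\<eta>. \<eta> \<in> S \<Longrightarrow> F \<eta> \<in> E \<eta>"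
  shows "\<theta> \<in> S \<Longrightarrow> ip (\<Sum>\<eta>\<in>S. F \<eta>) (F \<theta>) = ip (F \<theta>) (F \<theta>)"
    and "ip (\<Sum>\<eta>\<in>S. F \<eta>) (\<Sum>\<eta>\<in>S. F \<eta>) = (\<Sum>\<eta>\<in>S. ip (F \<eta>) (F \<eta>))"
    and "qform G l (\<Sum>\<eta>\<in>S. F \<eta>) (\<Sum>\<eta>\<in>S. F \<eta>) = (\<Sum>\<eta>\<in>S. \<eta> * ip (F \<eta>) (F \<eta>))"
proof -
  let ?f = "\<Sum>\<eta>\<in>S. F \<eta>"
  have FH: "F \<eta> \<in> H1 G l" if "\<eta> \<in> S" for \<eta> using E_H1 F that by blast
  have fH: "?f \<in> H1 G l" using FH by (intro fun_space.subspace_sum[OF H1_subspace])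
  have one: "ip ?f (F \<theta>) = ip (F \<theta>) (F \<theta>) \<and> qform G l ?f (F \<theta>) = \<theta> * ip (F \<theta>) (F \<theta>)" if "\<theta> \<in> S" for \<theta>
  proof -
    have "ip ?f (F \<theta>) = (\<Sum>\<eta>\<in>S. ip (F \<eta>) (F \<theta>))" "qform G l ?f (F \<theta>) = (\<Sum>\<eta>\<in>S. qform G l (F \<eta>) (F \<theta>))"
      using form_sum[of S F, OF S FH FH[OF that]] by blast+
    moreover have "(\<Sum>\<eta>\<in>S. ip (F \<eta>) (F \<theta>)) = (\<Sum>\<eta>\<in>S. if \<eta> = \<theta> then ip (F \<theta>) (F \<theta>) else 0)"
    proof (intro sum.cong refl)
      show "ip (F \<eta>) (F \<theta>) = (if \<eta> = \<theta> then ip (F \<theta>) (F \<theta>) else 0)" if \<eta>: "\<eta> \<in> S" for \<eta>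
        using E_orthogonal[OF F[OF \<eta>] F[OF \<open>\<theta> \<in> S\<close>]] by simp
    qed
    moreover have "(\<Sum>\<eta>\<in>S. qform G l (F \<eta>) (F \<theta>)) = (\<Sum>\<eta>\<in>S. if \<eta> = \<theta> then \<theta> * ip (F \<theta>) (F \<theta>) else 0)"
    proof (intro sum.cong refl)
      show "qform G l (F \<eta>) (F \<theta>) = (if \<eta> = \<theta> then \<theta> * ip (F \<theta>) (F \<theta>) else 0)" if \<eta>: "\<eta> \<in> S" for \<eta>
        using E_orthogonal[OF F[OF \<eta>] F[OF \<open>\<theta> \<in> S\<close>]] E_form[OF F[OF \<eta>] F[OF \<open>\<theta> \<in> S\<close>]]
        by (cases "\<eta> = \<theta>") simp_all
    qed
    ultimately show ?thesis using S that by (simp add: sum.delta)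
  qed
  then show "\<theta> \<in> S \<Longrightarrow> ip ?f (F \<theta>) = ip (F \<theta>) (F \<theta>)" by blast
  have "ip ?f ?f = (\<Sum>\<eta>\<in>S. ip (F \<eta>) ?f)" "qform G l ?f ?f = (\<Sum>\<eta>\<in>S. qform G l (F \<eta>) ?f)"
    using form_sum[of S F, OF S FH fH] by blast+
  then show "ip ?f ?f = (\<Sum>\<eta>\<in>S. ip (F \<eta>) (F \<eta>))" "qform G l ?f ?f = (\<Sum>\<eta>\<in>S. \<eta> * ip (F \<eta>) (F \<eta>))"
    using one ip_sym[of "F _" ?f] qform_sym[of "F _" ?f] by (auto intro!: sum.cong)
qed

text \<open>Orthogonality makes bases of different eigenspaces disjoint and their union independent,
  so the multiplicities add up to a dimension. On its span the energy is at most
  \<open>s * ip f f\<close>; a combination vanishing on \<open>C\<close> has energy at least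
  \<open>r * ip f f\<close>. The gap s < r forces \<open>ip f f = 0\<close>, and only then
  \<open>ip_zero_imp_zero\<close> gives f = 0.\<close>

lemma eigenvalue_count_le:
  assumes S: "finite S" "\<And>\<eta>. \<eta> \<in> S \<Longrightarrow> \<eta> \<le> s" and r: "s < r" "0 < r"
  shows "real (\<Sum>\<eta>\<in>S. multiplicity_of G l \<mu> \<eta>) \<le> card (verts G) + sqrt (total_length G l * r) / 2"
proof (rule ccontr)
  assume gt: "\<not> ?thesis"
  obtain C where C: "finite C" "real (card C) \<le> card (verts G) + sqrt (total_length G l * r) / 2"
    "Vertex ` verts G \<subseteq> C" "\<And>f. f \<in> H1 G l \<Longrightarrow> \<forall>x\<in>C. f x = 0 \<Longrightarrow> r * ip f f \<le> qform G l f f"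
    using ex_vanishing_set[OF r(2)] by blast
  have "\<exists>B. B \<subseteq> E \<eta> \<and> fun_space.independent B \<and> finite B \<and> card B = fun_space.dim (E \<eta>)" for \<eta>
    by (rule fun_space.ex_basis_card[of "E \<eta>"]) blast
  then obtain B where B: "\<And>\<eta>. B \<eta> \<subseteq> E \<eta>" "\<And>\<eta>. fun_space.independent (B \<eta>)" "\<And>\<eta>. finite (B \<eta>)"
    "\<And>\<eta>. card (B \<eta>) = multiplicity_of G l \<mu> \<eta>"
    unfolding multiplicity_of_def by metis
  have disj: "B \<eta> \<inter> B \<theta> = {}" if "\<eta> \<noteq> \<theta>" for \<eta> \<theta>
  proof -
    have "f = 0" if "f \<in> B \<eta>" "f \<in> B \<theta>" for f
      using E_zero[of f \<eta>] E_orthogonal[of f \<eta> f \<theta>] that B(1) \<open>\<eta> \<noteq> \<theta>\<close> by blast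
    moreover have "0 \<notin> B \<eta>" using B(2) fun_space.dependent_zero by blast
    ultimately show ?thesis by blast
  qed
  define U where "U = (\<Union>\<eta>\<in>S. B \<eta>)"
  define F where "F u \<eta> = (\<Sum>b\<in>B \<eta>. (\<lambda>x. u b * b x))" for u and \<eta>
  have FE: "F u \<eta> \<in> E \<eta>" for u \<eta>
    unfolding F_def using B(1) fun_space.subspace_scale[OF E_subspace]
    by (intro fun_space.subspace_sum[OF E_subspace]) blast
  have fin: "finite U" using S B by (auto simp: U_def)
  have decomp: "(\<Sum>b\<in>U. (\<lambda>x. u b * b x)) = (\<Sum>\<eta>\<in>S. F u \<eta>)" for u
    unfolding U_def F_def using S B(3) disj by (intro sum.UNION_disjoint) auto
  have "card U = (\<Sum>\<eta>\<in>S. multiplicity_of G l \<mu> \<eta>)"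
    unfolding U_def using S B(3,4) disj by (subst card_UN_disjoint) auto
  then have "real (card C) < real (card U)" using gt C(2) by linarith
  then have card: "card C < card U" by simp
  have ind: "fun_space.independent U"
  proof (rule fun_space.independent_if_scalars_zero[OF fin])
    fix u b assume 0: "(\<Sum>b\<in>U. (\<lambda>x. u b * b x)) = 0" and b: "b \<in> U"
    then obtain \<eta> where \<eta>: "\<eta> \<in> S" "b \<in> B \<eta>" by (auto simp: U_def)
    have "ip (F u \<eta>) (F u \<eta>) = ip (\<Sum>\<eta>\<in>S. F u \<eta>) (F u \<eta>)"
      using E_sum_forms(1)[of S "F u", OF S(1) FE \<eta>(1)] by simp
    also have "\<dots> = 0" using 0 unfolding decomp by (simp add: ip_def)
    finally have "F u \<eta> = 0" by (rule E_zero[OF FE])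
    then show "u b = 0"
      unfolding F_def using fun_space.independentD[OF B(2) B(3) subset_refl _ \<eta>(2)] by blast
  qed
  have "\<exists>f\<in>fun_space.span U. f \<noteq> 0 \<and> (\<forall>c\<in>C. f c = 0)"
    by (rule fun_space.ex_common_zero[where \<phi>="\<lambda>c f. f c" and V=UNIV, OF C(1) fin ind card]) simp_all
  then obtain f where f: "f \<in> fun_space.span U" "f \<noteq> 0" "\<forall>c\<in>C. f c = 0" by blast
  obtain u where "f = (\<Sum>b\<in>U. (\<lambda>x. u b * b x))"
    using f(1) unfolding fun_space.span_finite[OF fin] by blast
  then have fs: "f = (\<Sum>\<eta>\<in>S. F u \<eta>)" by (simp only: decomp)
  have fH: "f \<in> H1 G l" unfolding fs using E_H1[OF FE] by (intro fun_space.subspace_sum[OF H1_subspace])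
  have "qform G l f f = (\<Sum>\<eta>\<in>S. \<eta> * ip (F u \<eta>) (F u \<eta>))"
    unfolding fs by (rule E_sum_forms(3)[of S "F u", OF S(1) FE])
  also have "\<dots> \<le> (\<Sum>\<eta>\<in>S. s * ip (F u \<eta>) (F u \<eta>))"
    by (intro sum_mono mult_right_mono S(2) ip_nonneg)
  also have "\<dots> = s * ip f f"
    unfolding fs E_sum_forms(2)[of S "F u", OF S(1) FE] by (simp add: sum_distrib_left)
  finally have q: "qform G l f f \<le> s * ip f f" .
  then have "r * ip f f \<le> s * ip f f" using C(4)[OF fH f(3)] by linarith
  then have "(r - s) * ip f f \<le> 0" by (simp add: algebra_simps)
  then have "ip f f = 0" using r(1) ip_nonneg[of f] by (simp add: mult_le_0_iff)
  with q ip_zero_imp_zero[OF fH] have "f = 0" by simp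
  then show False using f(2) by simp
qed

lemma eigenvalue_k_ge:
  assumes r: "0 < r" and k: "card (verts G) + sqrt (total_length G l * r) / 2 < real k + 1"
  shows "ereal r \<le> eigenvalue_k G l \<mu> k"
  unfolding eigenvalue_k_def
proof (rule Inf_greatest)
  fix z assume "z \<in> {ereal s |s. \<exists>S. finite S \<and> S \<subseteq> {\<eta> \<in> eigenvalues G l \<mu>. \<eta> \<le> s} \<and>
    k < (\<Sum>\<eta>\<in>S. multiplicity_of G l \<mu> \<eta>)}"
  then obtain s S where z: "z = ereal s" and S: "finite S" "S \<subseteq> {\<eta> \<in> eigenvalues G l \<mu>. \<eta> \<le> s}"
    "k < (\<Sum>\<eta>\<in>S. multiplicity_of G l \<mu> \<eta>)" by blast
  have "r \<le> s"
  proof (rule ccontr)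
    assume "\<not> r \<le> s"
    then have "real (\<Sum>\<eta>\<in>S. multiplicity_of G l \<mu> \<eta>) \<le> card (verts G) + sqrt (total_length G l * r) / 2"
      using S r by (intro eigenvalue_count_le[of S s]) auto
    moreover have "real k + 1 \<le> real (\<Sum>\<eta>\<in>S. multiplicity_of G l \<mu> \<eta>)"
      using S(3) by (metis Suc_eq_plus1 Suc_leI of_nat_Suc of_nat_le_iff add.commute)
    ultimately show False using k by linarith
  qed
  then show "ereal r \<le> z" using z by simp
qed

end

lemma (in metric_graph) eigenvalue_min_ge:
  assumes "0 < r" "card (verts G) + sqrt (total_length G l * r) / 2 < real k + 1"
  shows "ereal r \<le> eigenvalue_min G l k"
  unfolding eigenvalue_min_def
proof (rule INF_greatest)
  fix \<mu> assume "\<mu> \<in> borel_prob_measures G l"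
  then interpret graph_measure G l \<mu> by unfold_locales
  show "ereal r \<le> eigenvalue_k G l \<mu> k" by (rule eigenvalue_k_ge[OF assms])
qed

section \<open>Symmetric pencils on a finite set\<close>

lemma (in vector_space) functional_sum:
  assumes "\<And>f g. \<phi> (f + g) = \<phi> f + \<phi> g" "\<And>r f. \<phi> (scale r f) = r * \<phi> f"
  shows "\<phi> (\<Sum>b\<in>B. scale (c b) b) = (\<Sum>b\<in>B. c b * \<phi> b)"
proof (cases "finite B")
  case True
  then show ?thesis
  proof (induction B)
    case empty
    then show ?case using assms(2)[of 0 0] by simp
  next
    case (insert b B)
    then show ?case by (simp add: assms)
  qed
next
  case False
  then show ?thesis using assms(2)[of 0 0] by simp
qed

text \<open>\<open>A\<close> is meant as an energy and \<open>I\<close> as an inner product, to be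
  diagonalised together on functions supported in \<open>P\<close>. Both are bilinear on all
  functions, while definiteness of \<open>I\<close> is asked on \<open>P\<close> only; continuity is
  for the product topology and feeds the compactness argument.\<close>

locale symmetric_pencil =
  fixes A I :: "('x \<Rightarrow> real) \<Rightarrow> ('x \<Rightarrow> real) \<Rightarrow> real" and P :: "'x set"
  assumes finP: "finite P"
    and A_sym: "A f g = A g f" and I_sym: "I f g = I g f"
    and A_add: "A (f + g) h = A f h + A g h" and I_add: "I (f + g) h = I f h + I g h"
    and A_scale: "A (\<lambda>x. c * f x) h = c * A f h" and I_scale: "I (\<lambda>x. c * f x) h = c * I f h"
    and A_cont: "continuous_on UNIV (\<lambda>f. A f f)" and I_cont: "continuous_on UNIV (I f)"
    and I_cont2: "continuous_on UNIV (\<lambda>f. I f f)"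
    and I_pos: "(\<And>x. x \<notin> P \<Longrightarrow> f x = 0) \<Longrightarrow> f \<noteq> 0 \<Longrightarrow> 0 < I f f"
begin

definition "V = {f :: 'x \<Rightarrow> real. \<forall>x. x \<notin> P \<longrightarrow> f x = 0}"

lemma V_subspace: "fun_space.subspace V"
  by (rule fun_space.subspaceI) (auto simp: V_def)

lemma A_add2: "A h (f + g) = A h f + A h g"
  unfolding A_sym[of h "f + g"] A_sym[of h f] A_sym[of h g] by (rule A_add)

lemma I_add2: "I h (f + g) = I h f + I h g"
  unfolding I_sym[of h "f + g"] I_sym[of h f] I_sym[of h g] by (rule I_add)

lemma A_scale2: "A h (\<lambda>x. c * f x) = c * A h f"
  unfolding A_sym[of h "\<lambda>x. c * f x"] A_sym[of h f] by (rule A_scale)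

lemma I_scale2: "I h (\<lambda>x. c * f x) = c * I h f"
  unfolding I_sym[of h "\<lambda>x. c * f x"] I_sym[of h f] by (rule I_scale)

lemma V_pos: "f \<in> V \<Longrightarrow> f \<noteq> 0 \<Longrightarrow> 0 < I f f"
  using I_pos[of f] by (auto simp: V_def)

lemma ex_independent_V: "\<exists>D. finite D \<and> D \<subseteq> V \<and> fun_space.independent D \<and> card D = card P"
proof -
  define d where "d p = (\<lambda>x. if x = p then 1 else (0 :: real))" for p :: 'x
  have inj: "inj_on d P" by (rule inj_onI) (auto simp: d_def fun_eq_iff split: if_splits)
  have "fun_space.independent (d ` P)"
  proof (rule fun_space.independent_if_scalars_zero)
    show "finite (d ` P)" using finP by simp
    fix u g assume 0: "(\<Sum>b\<in>d ` P. (\<lambda>x. u b * b x)) = 0" and "g \<in> d ` P"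
    then obtain p where p: "p \<in> P" "g = d p" by blast
    have "0 = (\<Sum>b\<in>d ` P. (\<lambda>x. u b * b x)) p" using 0 by simp
    also have "\<dots> = (\<Sum>q\<in>P. (\<lambda>x. u (d q) * d q x)) p" by (simp add: sum.reindex[OF inj])
    also have "\<dots> = (\<Sum>q\<in>P. u (d q) * d q p)"
      using finP by (induction P rule: finite_induct) auto
    also have "\<dots> = (\<Sum>q\<in>P. if q = p then u (d p) else 0)" by (intro sum.cong) (auto simp: d_def)
    also have "\<dots> = u g" using p finP by simp
    finally show "u g = 0" by simp
  qed
  then show ?thesis using inj finP
    by (intro exI[of _ "d ` P"] conjI) (simp_all add: card_image, auto simp: V_def d_def)
qed

text \<open>The form \<open>M * I - A\<close> is non-negative on \<open>W\<close> and vanishes at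
  \<open>f\<close>. Along f + t g it equals 2 t Q(f, g) + t^2 Q(g, g), which would become negative
  for small \<open>t\<close> of suitable sign unless Q(f, g) = 0.\<close>

lemma maximizer_form_zero:
  assumes W: "fun_space.subspace W" and f: "f \<in> W" "g \<in> W"
    and le: "\<And>h. h \<in> W \<Longrightarrow> A h h \<le> M * I h h" and eq: "A f f = M * I f f"
  shows "A f g = M * I f g"
proof -
  define Q where "Q f g = M * I f g - A f g" for f g
  have Q_sym: "Q f g = Q g f" for f g using A_sym I_sym by (simp add: Q_def)
  have "0 \<le> 2 * t * Q f g + t\<^sup>2 * Q g g" for t
  proof -
    have "(f + (\<lambda>x. t * g x)) \<in> W"
      using W f fun_space.subspace_add[OF W] fun_space.subspace_scale[OF W] by blast
    then have "0 \<le> Q (f + (\<lambda>x. t * g x)) (f + (\<lambda>x. t * g x))" using le by (simp add: Q_def)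
    also have "\<dots> = Q f f + t * Q f g + t * Q g f + t * (t * Q g g)"
      unfolding Q_def A_add A_add2 A_scale A_scale2 I_add I_add2 I_scale I_scale2 by algebra
    finally show ?thesis using eq by (simp add: Q_def[of f f] Q_sym[of g f] power2_eq_square)
  qed note nonneg = this
  have "Q f g = 0"
  proof (rule ccontr)
    assume q: "Q f g \<noteq> 0"
    \<comment> \<open>A step against the sign of \<open>Q f g\<close>, short enough for the linear
      term to win; the \<open>+ 1\<close> keeps the denominator positive.\<close>
    define t where "t = - Q f g / (\<bar>Q g g\<bar> + 1)"
    have k: "\<bar>Q g g\<bar> + 1 > 0" by linarith
    have t: "t * (\<bar>Q g g\<bar> + 1) = - Q f g" using k by (simp add: t_def)
    have "t \<noteq> 0" using q t by auto
    have "t\<^sup>2 * Q g g \<le> t\<^sup>2 * \<bar>Q g g\<bar>" by (intro mult_left_mono) auto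
    moreover have "t\<^sup>2 * (\<bar>Q g g\<bar> + 1) = - t * Q f g"
      using t by (metis mult.assoc mult_minus_left mult_minus_right power2_eq_square)
    ultimately have "t\<^sup>2 * Q g g \<le> - t * Q f g - t\<^sup>2" by (simp add: distrib_left)
    then have "0 \<le> t * Q f g - t\<^sup>2" using nonneg[of t] by linarith
    moreover have "t * Q f g = - (t\<^sup>2 * (\<bar>Q g g\<bar> + 1))" using \<open>t\<^sup>2 * (\<bar>Q g g\<bar> + 1) = - t * Q f g\<close> by simp
    moreover have "0 < t\<^sup>2" using \<open>t \<noteq> 0\<close> by simp
    moreover have "0 \<le> t\<^sup>2 * (\<bar>Q g g\<bar> + 1)" using k by simp
    ultimately show False by linarith
  qed
  then show ?thesis by (simp add: Q_def)
qed

text \<open>The quotient attains its maximum on a unit sphere. Normalising by the Euclidean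
  \<open>N\<close> bounds every coordinate by 1, so the sphere is a closed subset of a product of
  copies of [-1, 1], compact by Tychonoff's theorem; \<open>f0\<close> shows that it is
  non-empty.\<close>

lemma ex_maximizer:
  assumes B: "finite B" and f0: "f0 \<in> V" "f0 \<noteq> 0" "\<And>b. b \<in> B \<Longrightarrow> I b f0 = 0"
  obtains f M where "f \<in> V" "f \<noteq> 0" "\<And>b. b \<in> B \<Longrightarrow> I b f = 0" "A f f = M * I f f"
    "\<And>h. h \<in> V \<Longrightarrow> (\<And>b. b \<in> B \<Longrightarrow> I b h = 0) \<Longrightarrow> A h h \<le> M * I h h"
proof -
  define N where "N f = (\<Sum>p\<in>P. (f p)\<^sup>2)" for f :: "'x \<Rightarrow> real"
  define K where "K = {f \<in> V. (\<forall>b\<in>B. I b f = 0) \<and> N f = 1}"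
  have N_pos: "0 < N f" if f: "f \<in> V" "f \<noteq> 0" for f
  proof -
    obtain p where "f p \<noteq> 0" using f(2) by (metis ext zero_fun_apply)
    with f(1) have p: "p \<in> P" "f p \<noteq> 0" by (auto simp: V_def)
    then have "0 < (f p)\<^sup>2" by simp
    also have "\<dots> \<le> N f" unfolding N_def using p finP by (intro member_le_sum) auto
    finally show ?thesis .
  qed
  have normalize: "\<exists>c. c \<noteq> 0 \<and> (\<lambda>x. c * h x) \<in> K"
    if h: "h \<in> V" "h \<noteq> 0" "\<And>b. b \<in> B \<Longrightarrow> I b h = 0" for h
  proof (intro exI conjI)
    show "1 / sqrt (N h) \<noteq> 0" using N_pos[OF h(1,2)] by simp
    have "N (\<lambda>x. 1 / sqrt (N h) * h x) = (1 / sqrt (N h))\<^sup>2 * N h"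
      unfolding N_def by (simp only: power_mult_distrib sum_distrib_left)
    also have "\<dots> = 1" using N_pos[OF h(1,2)] by (simp add: power_divide)
    finally have N1: "N (\<lambda>x. 1 / sqrt (N h) * h x) = 1" .
    show "(\<lambda>x. 1 / sqrt (N h) * h x) \<in> K"
      unfolding K_def
    proof (intro CollectI conjI ballI N1)
      show "(\<lambda>x. 1 / sqrt (N h) * h x) \<in> V" by (rule fun_space.subspace_scale[OF V_subspace h(1)])
      show "I b (\<lambda>x. 1 / sqrt (N h) * h x) = 0" if "b \<in> B" for b
        unfolding I_scale2 h(3)[OF that] by simp
    qed
  qed
  have "\<exists>c. c \<noteq> 0 \<and> (\<lambda>x. c * f0 x) \<in> K" by (rule normalize[OF f0])
  then have "K \<noteq> {}" by (elim exE conjE) (metis empty_iff)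
  have "closed K"
  proof -
    have "K = (\<Inter>x\<in>-P. {f. f x = 0}) \<inter> ((\<Inter>b\<in>B. {f. I b f = 0}) \<inter> {f. N f = 1})"
      unfolding K_def V_def by blast
    also have "closed \<dots>"
      unfolding N_def
      by (intro closed_Int closed_INT ballI closed_Collect_eq continuous_intros continuous_on_product_coordinates I_cont)
    finally show ?thesis .
  qed
  have "compactin (product_topology (\<lambda>_. euclideanreal) UNIV) (\<Pi>\<^sub>E i\<in>UNIV. {-1..1} :: real set)"
    by (simp add: compactin_PiE)
  then have cpt: "compact (\<Pi>\<^sub>E i\<in>(UNIV :: 'x set). {-1..1} :: real set)"
    by (simp add: euclidean_product_topology)
  have "K \<subseteq> (\<Pi>\<^sub>E i\<in>UNIV. {-1..1})"
  proof
    fix f assume f: "f \<in> K"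
    have "\<bar>f x\<bar> \<le> 1" for x
    proof (cases "x \<in> P")
      case True
      then have "(f x)\<^sup>2 \<le> N f" unfolding N_def using finP by (intro member_le_sum) auto
      then have "(f x)\<^sup>2 \<le> 1" using f by (simp add: K_def)
      then show ?thesis by (simp add: abs_square_le_1)
    next
      case False
      then show ?thesis using f by (simp add: K_def V_def)
    qed
    then show "f \<in> (\<Pi>\<^sub>E i\<in>UNIV. {-1..1})" by (auto simp: abs_le_iff minus_le_iff)
  qed
  then have "K = K \<inter> (\<Pi>\<^sub>E i\<in>UNIV. {-1..1})" by blast
  then have "compact K" using closed_Int_compact[OF \<open>closed K\<close> cpt] by simp
  have K_pos: "0 < I f f" if "f \<in> K" for f
  proof (rule V_pos)
    show "f \<noteq> 0" using that by (auto simp: K_def N_def)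
  qed (use that in \<open>simp add: K_def\<close>)
  have "continuous_on K (\<lambda>f. A f f / I f f)"
    using K_pos by (intro continuous_on_divide continuous_on_subset[OF A_cont] continuous_on_subset[OF I_cont2]) force+
  from continuous_attains_sup[OF \<open>compact K\<close> \<open>K \<noteq> {}\<close> this]
  obtain f where f: "f \<in> K" "\<And>h. h \<in> K \<Longrightarrow> A h h / I h h \<le> A f f / I f f" by blast
  define M where "M = A f f / I f f"
  show ?thesis
  proof (rule that[of f M])
    show "I b f = 0" if "b \<in> B" for b using f(1) that by (auto simp: K_def)
    show "f \<in> V" using f(1) by (simp add: K_def)
    show "f \<noteq> 0" using f(1) by (auto simp: K_def N_def)
    show "A f f = M * I f f" using K_pos[OF f(1)] by (simp add: M_def)
    fix h assume h: "h \<in> V" "\<And>b. b \<in> B \<Longrightarrow> I b h = 0"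
    show "A h h \<le> M * I h h"
    proof (cases "h = 0")
      case True
      have "A 0 0 = 0" "I 0 0 = 0"
        using A_scale[of 0 0 0] I_scale[of 0 0 0] by (simp_all only: mult_zero_left flip: zero_fun_def)
      then show ?thesis using True by simp
    next
      case False
      have "\<exists>c. c \<noteq> 0 \<and> (\<lambda>x. c * h x) \<in> K" by (rule normalize[OF h(1) False h(2)])
      then obtain c where c: "c \<noteq> 0" "(\<lambda>x. c * h x) \<in> K" by (elim exE conjE)
      have "A (\<lambda>x. c * h x) (\<lambda>x. c * h x) \<le> M * I (\<lambda>x. c * h x) (\<lambda>x. c * h x)"
        using f(2)[OF c(2)] K_pos[OF c(2)] by (simp add: M_def divide_le_eq)
      then have "c\<^sup>2 * A h h \<le> c\<^sup>2 * (M * I h h)"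
        by (simp add: A_scale A_scale2 I_scale I_scale2 power2_eq_square mult_ac)
      then show ?thesis using c(1) by simp
    qed
  qed
qed

definition eigen_system :: "('x \<Rightarrow> real) set \<Rightarrow> bool" where
  "eigen_system B \<longleftrightarrow> finite B \<and> B \<subseteq> V \<and> 0 \<notin> B \<and> (\<forall>b\<in>B. \<forall>b'\<in>B. b \<noteq> b' \<longrightarrow> I b b' = 0) \<and>
    (\<forall>b\<in>B. \<exists>\<eta>. \<forall>u\<in>V. A b u = \<eta> * I b u)"

lemma eigen_systemD:
  assumes "eigen_system B"
  shows "finite B" "B \<subseteq> V" "0 \<notin> B" "\<And>b b'. b \<in> B \<Longrightarrow> b' \<in> B \<Longrightarrow> b \<noteq> b' \<Longrightarrow> I b b' = 0"
    "\<And>b. b \<in> B \<Longrightarrow> \<exists>\<eta>. \<forall>u\<in>V. A b u = \<eta> * I b u"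
  using assms unfolding eigen_system_def by blast+

text \<open>The next eigenvector maximises the quotient on the \<open>I\<close>-orthogonal
  complement of the previous ones. There the equation is the maximiser property; against a previous
  eigenvector both forms vanish; every vector of \<open>V\<close> splits accordingly.\<close>

lemma ex_eigen_system:
  assumes "m \<le> card P"
  shows "\<exists>B. eigen_system B \<and> card B = m"
  using assms
proof (induction m)
  case 0
  then show ?case by (intro exI[of _ "{}"]) (simp add: eigen_system_def)
next
  case (Suc m)
  have "m \<le> card P" using Suc.prems by simp
  from Suc.IH[OF this] obtain B where "eigen_system B" and cB: "card B = m" by blast
  note B = eigen_systemD[OF this(1)]
  obtain D where D: "finite D" "D \<subseteq> V" "fun_space.independent D" "card D = card P"
    using ex_independent_V by blast
  have "card B < card D" using cB D(4) Suc.prems by simp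
  then have "\<exists>f\<in>fun_space.span D. f \<noteq> 0 \<and> (\<forall>b\<in>B. I b f = 0)"
    by (intro fun_space.ex_common_zero[where V=UNIV] B(1) D(1,3) I_add2 I_scale2 fun_space.subspace_UNIV subset_UNIV)
  then obtain f0 where f0: "f0 \<in> fun_space.span D" "f0 \<noteq> 0" "\<And>b. b \<in> B \<Longrightarrow> I b f0 = 0" by blast
  have "f0 \<in> V" using f0(1) fun_space.span_minimal[OF D(2) V_subspace] by blast
  obtain f M where f: "f \<in> V" "f \<noteq> 0" "\<And>b. b \<in> B \<Longrightarrow> I b f = 0" "A f f = M * I f f"
    "\<And>h. h \<in> V \<Longrightarrow> (\<And>b. b \<in> B \<Longrightarrow> I b h = 0) \<Longrightarrow> A h h \<le> M * I h h"
    using ex_maximizer[OF B(1) \<open>f0 \<in> V\<close> f0(2,3)] by blast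
  define W where "W = {h \<in> V. \<forall>b\<in>B. I b h = 0}"
  have W: "fun_space.subspace W"
  proof (rule fun_space.subspaceI)
    have "I b 0 = 0" for b using I_scale2[of b 0 0] by (simp only: mult_zero_left flip: zero_fun_def)
    then show "0 \<in> W" by (simp add: W_def fun_space.subspace_0[OF V_subspace])
    show "x + y \<in> W" if "x \<in> W" "y \<in> W" for x y
      using that fun_space.subspace_add[OF V_subspace] by (simp only: W_def mem_Collect_eq I_add2) simp
    show "(\<lambda>z. c * x z) \<in> W" if "x \<in> W" for c x
      using that fun_space.subspace_scale[OF V_subspace] by (simp only: W_def mem_Collect_eq I_scale2) simp
  qed
  have AW: "A f g = M * I f g" if "g \<in> W" for g
    by (rule maximizer_form_zero[OF W _ that _ f(4)]) (use f in \<open>auto simp: W_def\<close>)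
  have AB: "A f b = M * I f b" if b: "b \<in> B" for b
  proof -
    obtain \<eta> where "\<forall>u\<in>V. A b u = \<eta> * I b u" using B(5)[OF b] by blast
    then show ?thesis using f(1) f(3)[OF b] by (simp add: A_sym[of f b] I_sym[of f b])
  qed
  have eig: "A f u = M * I f u" if u: "u \<in> V" for u
  proof -
    \<comment> \<open>Gram--Schmidt coefficients: u + s is the \<open>I\<close>-orthogonal
      projection of \<open>u\<close> to \<open>W\<close>.\<close>
    define c where "c b = - (I b u / I b b)" for b
    define s where "s = (\<Sum>b\<in>B. (\<lambda>x. c b * b x))"
    have sum: "\<phi> s = (\<Sum>b\<in>B. c b * \<phi> b)" if "\<And>f g. \<phi> (f + g) = \<phi> f + \<phi> g" "\<And>r f. \<phi> (\<lambda>x. r * f x) = r * \<phi> f" for \<phi>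
      unfolding s_def by (rule fun_space.functional_sum[OF that])
    have "u + s \<in> W"
      unfolding W_def
    proof (intro CollectI conjI ballI)
      have "s \<in> V" unfolding s_def
        using B(2) fun_space.subspace_scale[OF V_subspace] by (intro fun_space.subspace_sum[OF V_subspace]) blast
      then show "u + s \<in> V" using u fun_space.subspace_add[OF V_subspace] by blast
      fix b assume b: "b \<in> B"
      have "I b s = (\<Sum>b'\<in>B. c b' * I b b')" by (rule sum) (simp_all only: I_add2 I_scale2)
      also have "\<dots> = (\<Sum>b'\<in>B. if b' = b then c b * I b b else 0)"
        using B(4)[OF b] by (intro sum.cong) auto
      also have "\<dots> = - I b u"
      proof -
        have "b \<in> V" "b \<noteq> 0" using b B(2,3) by blast+
        then have "I b b \<noteq> 0" using V_pos[of b] by simp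
        then show ?thesis using b B(1) by (simp add: c_def)
      qed
      finally show "I b (u + s) = 0" by (simp only: I_add2)
    qed
    then have "A f (u + s) = M * I f (u + s)" by (rule AW)
    moreover have "A f s = M * I f s"
    proof -
      have "A f s = (\<Sum>b\<in>B. c b * A f b)" by (rule sum) (simp_all only: A_add2 A_scale2)
      also have "\<dots> = (\<Sum>b\<in>B. M * (c b * I f b))" by (intro sum.cong) (auto simp: AB)
      also have "\<dots> = M * (\<Sum>b\<in>B. c b * I f b)" by (rule sum_distrib_left[symmetric])
      also have "(\<Sum>b\<in>B. c b * I f b) = I f s" by (rule sum[symmetric]) (simp_all only: I_add2 I_scale2)
      finally show ?thesis .
    qed
    ultimately show ?thesis unfolding A_add2 I_add2 by (simp add: distrib_left)
  qed
  have "f \<notin> B" using f(3)[of f] V_pos[OF f(1,2)] by auto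
  have "\<exists>\<eta>. \<forall>u\<in>V. A b u = \<eta> * I b u" if "b \<in> insert f B" for b
    using eig B(5) that by (metis insert_iff)
  moreover have "I b b' = 0" if "b \<in> insert f B" "b' \<in> insert f B" "b \<noteq> b'" for b b'
    using B(4) f(3) I_sym[of f] that by (metis insert_iff)
  ultimately have "eigen_system (insert f B)"
    unfolding eigen_system_def using B(1,2,3) f(1,2) by (simp only: insert_iff finite_insert insert_subset simp_thms) blast
  moreover have "card (insert f B) = Suc m" using \<open>f \<notin> B\<close> B(1) cB by simp
  ultimately show ?case by blast
qed

theorem ex_eigenbasis:
  obtains B where "finite B" "card B = card P" "B \<subseteq> V" "0 \<notin> B" "fun_space.independent B"
    "\<forall>b\<in>B. \<exists>\<eta>. \<forall>u\<in>V. A b u = \<eta> * I b u"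
proof -
  obtain B where "eigen_system B" and cB: "card B = card P"
    using ex_eigen_system[OF order_refl] by blast
  note B = eigen_systemD[OF this(1)]
  have "fun_space.independent B"
  proof (rule fun_space.independent_if_scalars_zero[OF B(1)])
    fix c b assume 0: "(\<Sum>b\<in>B. (\<lambda>x. c b * b x)) = 0" and b: "b \<in> B"
    have "I b (\<Sum>b\<in>B. (\<lambda>x. c b * b x)) = (\<Sum>b'\<in>B. c b' * I b b')"
      by (rule fun_space.functional_sum) (simp_all only: I_add2 I_scale2)
    also have "\<dots> = (\<Sum>b'\<in>B. if b' = b then c b * I b b else 0)"
      using B(4)[OF b] by (intro sum.cong) auto
    also have "\<dots> = c b * I b b" using b B(1) by simp
    finally have "I b 0 = c b * I b b" unfolding 0 .
    moreover have "I b 0 = 0" using I_scale2[of b 0 0] by (simp only: mult_zero_left flip: zero_fun_def)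
    ultimately have "c b * I b b = 0" by simp
    moreover have "b \<in> V" "b \<noteq> 0" using b B(2,3) by blast+
    ultimately show "c b = 0" using V_pos[of b] by simp
  qed
  then show ?thesis using that[OF B(1) cB B(2,3) _ ballI[OF B(5)]] by blast
qed

end

section \<open>The upper bound\<close>

lemma H1_pair_sum:
  assumes "\<And>i. i \<in> A \<Longrightarrow> H1_pair a (u i) (v i)"
  shows "H1_pair a (\<lambda>t. \<Sum>i\<in>A. u i t) (\<lambda>t. \<Sum>i\<in>A. v i t)"
proof (cases "finite A")
  case True
  then show ?thesis using assms
    by (induction A) (auto simp: H1_pair_const intro: H1_pair_add)
next
  case False
  then show ?thesis by (simp add: H1_pair_const)
qed

locale subdivision = metric_graph G l
  for G :: "('v, 'e) pre_digraph" and l :: "'e \<Rightarrow> real" +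
  fixes n :: "'e \<Rightarrow> nat"
  assumes n_pos: "e \<in> arcs G \<Longrightarrow> 0 < n e"
begin

section \<open>Nodes and piecewise linear functions\<close>

definition h :: "'e \<Rightarrow> real" where "h e = l e / n e"

definition node :: "'e \<Rightarrow> nat \<Rightarrow> ('v, 'e) gpoint" where
  "node e i = edge_point G l e (real i * h e)"

definition P :: "('v, 'e) gpoint set" where
  "P = (\<lambda>(e, i). node e i) ` Sigma (arcs G) (\<lambda>e. {..n e})"

definition incr :: "(('v, 'e) gpoint \<Rightarrow> real) \<Rightarrow> 'e \<Rightarrow> nat \<Rightarrow> real" where
  "incr f e i = f (node e (Suc i)) - f (node e i)"

text \<open>The discrete energy: by \<open>qform_ext\<close> it is the energy of the piecewise
  linear interpolant paired with any \<open>H1\<close> function.\<close>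

definition A :: "(('v, 'e) gpoint \<Rightarrow> real) \<Rightarrow> (('v, 'e) gpoint \<Rightarrow> real) \<Rightarrow> real" where
  "A f g = (\<Sum>e\<in>arcs G. \<Sum>i<n e. incr f e i * incr g e i / h e)"

definition pl :: "(('v, 'e) gpoint \<Rightarrow> real) \<Rightarrow> 'e \<Rightarrow> real \<Rightarrow> real" where
  "pl f e t = f (node e 0) + (\<Sum>i<n e. incr f e i * ramp (real i * h e) (real (Suc i) * h e) t)"

text \<open>The interpolant of the node values, harmonic between the nodes. Every vertex is a node
  by \<open>vertex_covered\<close>; the value 0 off the graph is the convention of
  \<open>H1\<close>.\<close>

definition ext :: "(('v, 'e) gpoint \<Rightarrow> real) \<Rightarrow> ('v, 'e) gpoint \<Rightarrow> real" where
  "ext f x = (case x of Vertex v \<Rightarrow> if v \<in> verts G then f x else 0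
     | Inner e t \<Rightarrow> if e \<in> arcs G \<and> 0 < t \<and> t < l e then pl f e t else 0)"

lemma h_pos: "e \<in> arcs G \<Longrightarrow> 0 < h e"
  using length_pos n_pos by (simp add: h_def)

lemma n_h: "e \<in> arcs G \<Longrightarrow> real (n e) * h e = l e"
  using n_pos[of e] by (simp add: h_def)

lemma node_0: "node e 0 = Vertex (tail G e)"
  by (simp add: node_def edge_point_def)

lemma node_n: "e \<in> arcs G \<Longrightarrow> node e (n e) = Vertex (head G e)"
  using length_pos[of e] by (simp add: node_def edge_point_def n_h)

lemma node_P: "e \<in> arcs G \<Longrightarrow> i \<le> n e \<Longrightarrow> node e i \<in> P"
  by (force simp: P_def)

lemma finite_P: "finite P"
  by (auto simp: P_def)

lemma P_subset: "P \<subseteq> gpoints G l"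
  by (auto simp: P_def node_def edge_point_in)

lemma pl_node:
  assumes e: "e \<in> arcs G" and j: "j \<le> n e"
  shows "pl f e (real j * h e) = f (node e j)"
proof -
  note hp = h_pos[OF e]
  have "ramp (real i * h e) (real (Suc i) * h e) (real j * h e) = (if i < j then 1 else 0)" for i
  proof (cases "i < j")
    case True
    then have "real (Suc i) * h e \<le> real j * h e" using hp by (intro mult_right_mono) auto
    then show ?thesis using True hp by (simp add: ramp_right)
  next
    case False
    then have "real j * h e \<le> real i * h e" using hp by (intro mult_right_mono) auto
    then show ?thesis using False hp by (simp add: ramp_left)
  qed
  then have "(\<Sum>i<n e. incr f e i * ramp (real i * h e) (real (Suc i) * h e) (real j * h e)) =
      (\<Sum>i<n e. if i < j then incr f e i else 0)"
    by (intro sum.cong) auto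
  also have "\<dots> = (\<Sum>i<j. incr f e i)"
    using j by (intro sum.mono_neutral_cong_right) auto
  also have "\<dots> = f (node e j) - f (node e 0)"
    unfolding incr_def by (rule sum_lessThan_telescope)
  finally show ?thesis by (simp add: pl_def)
qed

lemma pl_left: "e \<in> arcs G \<Longrightarrow> t \<le> 0 \<Longrightarrow> pl f e t = f (node e 0)"
proof -
  assume e: "e \<in> arcs G" and t: "t \<le> 0"
  note hp = h_pos[OF e]
  have "t \<le> real i * h e" for i using t hp by (meson mult_nonneg_nonneg of_nat_0_le_iff less_imp_le order_trans)
  then have "ramp (real i * h e) (real (Suc i) * h e) t = 0" for i
    using hp by (intro ramp_left) auto
  then show ?thesis by (simp add: pl_def)
qed

lemma pl_right: "e \<in> arcs G \<Longrightarrow> l e \<le> t \<Longrightarrow> pl f e t = f (node e (n e))"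
proof -
  assume e: "e \<in> arcs G" and t: "l e \<le> t"
  note hp = h_pos[OF e]
  have "ramp (real i * h e) (real (Suc i) * h e) t = 1" if "i < n e" for i
  proof (rule ramp_right)
    have "real (Suc i) * h e \<le> real (n e) * h e" using hp that by (intro mult_right_mono) auto
    then show "real (Suc i) * h e \<le> t" using t n_h[OF e] by simp
  qed (use hp in auto)
  then have "pl f e t = f (node e 0) + (\<Sum>i<n e. incr f e i)" by (simp add: pl_def)
  also have "(\<Sum>i<n e. incr f e i) = f (node e (n e)) - f (node e 0)"
    unfolding incr_def by (rule sum_lessThan_telescope)
  finally show ?thesis by simp
qed

lemma on_ext: "e \<in> arcs G \<Longrightarrow> on (ext f) e = pl f e"
proof
  fix t assume e: "e \<in> arcs G"
  consider "t \<le> 0" | "l e \<le> t" | "0 < t" "t < l e" by linarith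
  then show "on (ext f) e t = pl f e t"
  proof cases
    case 1
    then show ?thesis using e by (simp add: pl_left on_edge_def edge_point_def ext_def node_0)
  next
    case 2
    then show ?thesis using e length_pos[OF e]
      by (simp add: pl_right on_edge_def edge_point_def ext_def node_n)
  next
    case 3
    then show ?thesis using e by (simp add: on_edge_def edge_point_def ext_def)
  qed
qed

lemma ext_node: "e \<in> arcs G \<Longrightarrow> i \<le> n e \<Longrightarrow> ext f (node e i) = f (node e i)"
  using on_ext[of e f] pl_node[of e i f] by (metis node_def on_edge_def)

lemma ext_P: "x \<in> P \<Longrightarrow> ext f x = f x"
  by (auto simp: P_def ext_node)

definition slope :: "(('v, 'e) gpoint \<Rightarrow> real) \<Rightarrow> 'e \<Rightarrow> real \<Rightarrow> real" where
  "slope f e t = (\<Sum>i<n e. incr f e i * (indicator {real i * h e<..<real (Suc i) * h e} t / h e))"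

lemma H1_pair_pl:
  assumes e: "e \<in> arcs G"
  shows "H1_pair (l e) (pl f e) (slope f e)"
proof -
  note hp = h_pos[OF e]
  have r: "H1_pair (l e) (ramp (real i * h e) (real (Suc i) * h e)) (\<lambda>t. indicator {real i * h e<..<real (Suc i) * h e} t / h e)"
    if "i < n e" for i
  proof -
    have "real (Suc i) * h e \<le> real (n e) * h e" using hp that by (intro mult_right_mono) auto
    then have "real (Suc i) * h e \<le> l e" using n_h[OF e] by simp
    moreover have "real (Suc i) * h e - real i * h e = h e" by (simp add: algebra_simps)
    ultimately show ?thesis
      using H1_pair_ramp[of "real i * h e" "real (Suc i) * h e" "l e"] hp by simp
  qed
  have "H1_pair (l e) (\<lambda>t. \<Sum>i<n e. incr f e i * ramp (real i * h e) (real (Suc i) * h e) t) (slope f e)"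
    unfolding slope_def by (rule H1_pair_sum, rule H1_pair_scale) (use r in auto)
  from H1_pair_add[OF H1_pair_const[of "l e" "f (node e 0)"] this] show ?thesis
    by (simp add: pl_def[abs_def])
qed

lemma ext_H1: "ext f \<in> H1 G l"
  unfolding H1_iff
proof (intro conjI allI impI ballI)
  show "ext f x = 0" if "x \<notin> gpoints G l" for x
    using that by (auto simp: ext_def gpoints_def split: gpoint.splits)
  show "\<exists>v. H1_pair (l e) (on (ext f) e) v" if "e \<in> arcs G" for e
    using H1_pair_pl[OF that] on_ext[OF that] by auto
qed

text \<open>The derivative of the interpolant is constant on each segment, so integration against g'
  leaves increments of \<open>g\<close> at the nodes. That \<open>g\<close> is arbitrary in
  \<open>H1\<close> reduces both harmonicity and the eigenvalue equation to
  \<open>P\<close>.\<close>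

lemma qform_ext:
  assumes g: "g \<in> H1 G l"
  shows "qform G l (ext f) g = A f g"
proof -
  have "qform G l (ext f) g = (\<Sum>e\<in>arcs G. LINT t:{0<..<l e}|lborel. slope f e t * wd g e t)"
    by (rule qform_eq[OF g]) (simp add: on_ext H1_pair_pl)
  also have "\<dots> = A f g"
    unfolding A_def
  proof (intro sum.cong refl)
    fix e assume e: "e \<in> arcs G"
    note hp = h_pos[OF e]
    let ?S = "\<lambda>i. {real i * h e<..<real (Suc i) * h e}"
    have sub: "?S i \<subseteq> {0<..<l e}" "real (Suc i) * h e \<le> l e" if "i < n e" for i
    proof -
      have "real (Suc i) * h e \<le> real (n e) * h e" using hp that by (intro mult_right_mono) auto
      then show *: "real (Suc i) * h e \<le> l e" using n_h[OF e] by simp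
      have "0 \<le> real i * h e" using hp by simp
      with * show "?S i \<subseteq> {0<..<l e}" by auto
    qed
    have i: "set_integrable lborel (?S i) (wd g e)" if "i < n e" for i
      by (rule set_integrable_subset[OF L2_integrable[OF wd_L2[OF g e]] _ sub(1)[OF that]]) auto
    have "(LINT t:{0<..<l e}|lborel. slope f e t * wd g e t) =
        (LINT t|lborel. (\<Sum>i<n e. incr f e i / h e * (indicator (?S i) t *\<^sub>R wd g e t)))"
      unfolding set_lebesgue_integral_def
    proof (rule Bochner_Integration.integral_cong[OF refl])
      fix t
      show "indicator {0<..<l e} t *\<^sub>R (slope f e t * wd g e t) =
         (\<Sum>i<n e. incr f e i / h e * (indicator (?S i) t *\<^sub>R wd g e t))"
      proof (cases "t \<in> {0<..<l e}")
        case True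
        then show ?thesis by (simp add: slope_def sum_distrib_right mult.assoc)
      next
        case False
        then have "t \<notin> ?S i" if "i < n e" for i using sub(1)[OF that] by blast
        then show ?thesis using False by simp
      qed
    qed
    also have "\<dots> = (\<Sum>i<n e. incr f e i / h e * (LINT t:?S i|lborel. wd g e t))"
      unfolding set_lebesgue_integral_def using i
      by (subst Bochner_Integration.integral_sum) (auto simp: set_integrable_def)
    also have "\<dots> = (\<Sum>i<n e. incr f e i * incr g e i / h e)"
    proof (intro sum.cong refl)
      fix i assume "i \<in> {..<n e}"
      then have "(LINT t:?S i|lborel. wd g e t) = on g e (real (Suc i) * h e) - on g e (real i * h e)"
        using hp sub(2)[of i] by (intro H1_pair_FTC[OF H1_wd[OF g e]]) auto
      also have "\<dots> = incr g e i" by (simp add: incr_def on_edge_def node_def)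
      finally show "incr f e i / h e * (LINT t:?S i|lborel. wd g e t) = incr f e i * incr g e i / h e" by simp
    qed
    finally show "(LINT t:{0<..<l e}|lborel. slope f e t * wd g e t) = (\<Sum>i<n e. incr f e i * incr g e i / h e)" .
  qed
  finally show ?thesis .
qed

text \<open>The mass before normalisation: each of the \<open>n e\<close> segments of an edge gives
  1 / h e to both of its ends.\<close>

definition Z :: real where "Z = (\<Sum>e\<in>arcs G. real (n e) * (2 / h e))"

lemma Z_pos: "0 < Z"
  unfolding Z_def using has_edge h_pos n_pos by (intro sum_pos) auto

text \<open>A half-segment \<open>(e, i, b)\<close> stands for the segment between \<open>node e i\<close> and \<open>node e (Suc i)\<close>
  seen from its endpoint \<open>node e (i + b)\<close>, which receives a mass proportional to the reciprocal of
  the length of the segment.\<close>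

definition J :: "('e \<times> nat \<times> nat) set" where
  "J = Sigma (arcs G) (\<lambda>e. {..<n e} \<times> {0, 1})"

definition wt :: "'e \<times> nat \<times> nat \<Rightarrow> real" where "wt j = 1 / (Z * h (fst j))"

definition pt :: "'e \<times> nat \<times> nat \<Rightarrow> ('v, 'e) gpoint" where "pt = (\<lambda>(e, i, b). node e (i + b))"

text \<open>The inner product of the measure as a finite sum (\<open>ip_eq_I\<close>), which is
  bilinear and continuous on all functions as \<open>symmetric_pencil\<close> requires.\<close>

definition I :: "(('v, 'e) gpoint \<Rightarrow> real) \<Rightarrow> (('v, 'e) gpoint \<Rightarrow> real) \<Rightarrow> real" where
  "I f g = (\<Sum>j\<in>J. wt j * (f (pt j) * g (pt j)))"

text \<open>The image measure adds up the masses of all half-segments that meet at a node, including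
  loops and vertices of any degree.\<close>

definition \<mu> :: "('v, 'e) gpoint measure" where
  "\<mu> = distr (point_measure J wt) (sigma (gpoints G l) {U. openin T U}) pt"

lemma finite_J: "finite J"
  by (simp add: J_def)

lemma sum_J: "(\<Sum>j\<in>J. F j) = (\<Sum>e\<in>arcs G. \<Sum>i<n e. F (e, i, 0) + F (e, i, 1 :: nat) :: real)"
proof -
  have "(\<Sum>j\<in>J. F j) = (\<Sum>e\<in>arcs G. \<Sum>j\<in>{..<n e} \<times> {0, 1}. F (e, j))"
    unfolding J_def by (subst sum.Sigma) (auto simp: case_prod_unfold)
  also have "\<dots> = (\<Sum>e\<in>arcs G. \<Sum>i<n e. \<Sum>b\<in>{0, 1}. F (e, i, b))"
    by (simp only: sum.cartesian_product')
  finally show ?thesis by simp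
qed

lemma wt_pos: "j \<in> J \<Longrightarrow> 0 < wt j"
  using Z_pos h_pos by (auto simp: J_def wt_def)

lemma pt_image: "pt ` J = P"
proof
  show "pt ` J \<subseteq> P" by (auto simp: pt_def J_def node_P)
  show "P \<subseteq> pt ` J"
  proof
    fix x assume "x \<in> P"
    then obtain e i where x: "x = node e i" "e \<in> arcs G" "i \<le> n e" by (auto simp: P_def)
    show "x \<in> pt ` J"
    proof (cases "i = n e")
      case True
      then have "x = pt (e, n e - 1, 1)" "(e, n e - 1, 1) \<in> J"
        using x n_pos[of e] by (auto simp: pt_def J_def)
      then show ?thesis by blast
    next
      case False
      then have "x = pt (e, i, 0)" "(e, i, 0) \<in> J" using x by (auto simp: pt_def J_def)
      then show ?thesis by blast
    qed
  qed
qed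

lemma sum_wt: "(\<Sum>j\<in>J. wt j) = 1"
proof -
  have "(\<Sum>j\<in>J. wt j) = (\<Sum>e\<in>arcs G. real (n e) * (2 / h e)) / Z"
    unfolding sum_J by (simp add: wt_def sum_divide_distrib mult.commute)
  then show ?thesis using Z_pos by (simp add: Z_def)
qed

lemma pt_measurable: "pt \<in> measurable (point_measure J wt) (sigma (gpoints G l) {U. openin T U})"
proof -
  have "pt ` J \<subseteq> gpoints G l" using pt_image P_subset by simp
  then show ?thesis by (auto simp: space_measure_of[OF openin_T_Pow])
qed

lemma \<mu>_borel_prob: "\<mu> \<in> borel_prob_measures G l"
proof -
  have "prob_space (point_measure J (\<lambda>j. ennreal (wt j)))"
    using finite_J wt_pos sum_wt
    by (intro prob_space_point_measure) (auto simp: sum_ennreal less_imp_le)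
  then have "prob_space \<mu>"
    unfolding \<mu>_def using pt_measurable by (rule prob_space.prob_space_distr)
  then show ?thesis by (simp add: borel_prob_measures_def \<mu>_def)
qed

sublocale gm: graph_measure G l \<mu>
  by unfold_locales (rule \<mu>_borel_prob)

lemma ip_eq_I:
  assumes "f \<in> H1 G l" "g \<in> H1 G l"
  shows "gm.ip f g = I f g"
proof -
  have s: "sets (sigma (gpoints G l) {U. openin T U}) = sets \<mu>" by (simp add: \<mu>_def)
  have "(\<lambda>x. f x * g x) \<in> borel_measurable \<mu>"
    using assms gm.H1_measurable by measurable
  then have m: "(\<lambda>x. f x * g x) \<in> borel_measurable (sigma (gpoints G l) {U. openin T U})"
    using measurable_cong_sets[OF s refl] by blast
  have "gm.ip f g = (LINT j|point_measure J wt. f (pt j) * g (pt j))"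
    unfolding gm.ip_def unfolding \<mu>_def by (rule integral_distr[OF pt_measurable m])
  also have "\<dots> = I f g"
    unfolding I_def using finite_J wt_pos
    by (subst lebesgue_integral_point_measure_finite) (auto simp: less_imp_le)
  finally show ?thesis .
qed

lemma P_msupport: "P \<subseteq> msupport G l \<mu>"
proof
  fix x assume "x \<in> P"
  then obtain j where j: "j \<in> J" "x = pt j" using pt_image by blast
  show "x \<in> msupport G l \<mu>"
    unfolding msupport_def
  proof (intro CollectI conjI allI impI)
    show "x \<in> gpoints G l" using \<open>x \<in> P\<close> P_subset by blast
    fix U assume U: "openin T U \<and> x \<in> U"
    have "0 < ennreal (wt j)" using wt_pos[OF j(1)] by simp
    also have "ennreal (wt j) \<le> (\<Sum>j\<in>pt -` U \<inter> J. ennreal (wt j))"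
      using j U finite_J by (intro member_le_sum) auto
    also have "\<dots> = emeasure (point_measure J wt) (pt -` U \<inter> J)"
      using finite_J by (intro emeasure_point_measure_finite[symmetric]) auto
    also have "\<dots> = emeasure \<mu> U"
      unfolding \<mu>_def using U openin_T_Pow
      by (subst emeasure_distr[OF pt_measurable]) (auto simp: space_point_measure sets_measure_of)
    finally show "0 < emeasure \<mu> U" .
  qed
qed

lemma A_le_I: "A f f \<le> 2 * Z * I f f"
proof -
  have "A f f \<le> (\<Sum>e\<in>arcs G. \<Sum>i<n e. 2 / h e * ((f (node e i))\<^sup>2 + (f (node e (Suc i)))\<^sup>2))"
    unfolding A_def
  proof (intro sum_mono)
    fix e i assume e: "e \<in> arcs G"
    have "(x - y)\<^sup>2 \<le> 2 * (y\<^sup>2 + x\<^sup>2)" for x y :: real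
      using sum_power2_ge_zero[of "x + y" 0] by (simp add: power2_eq_square algebra_simps)
    then have "incr f e i * incr f e i \<le> 2 * ((f (node e i))\<^sup>2 + (f (node e (Suc i)))\<^sup>2)"
      by (simp add: incr_def power2_eq_square)
    then show "incr f e i * incr f e i / h e \<le> 2 / h e * ((f (node e i))\<^sup>2 + (f (node e (Suc i)))\<^sup>2)"
      using divide_right_mono[OF _ less_imp_le[OF h_pos[OF e]]] by fastforce
  qed
  also have "\<dots> = 2 * Z * I f f"
    unfolding I_def sum_J sum_distrib_left
  proof (intro sum.cong refl)
    fix e i assume "e \<in> arcs G"
    have "1 / h e = Z * (1 / (Z * h e))" using Z_pos by simp
    then show "2 / h e * ((f (node e i))\<^sup>2 + (f (node e (Suc i)))\<^sup>2) =
        2 * Z * (wt (e, i, 0) * (f (pt (e, i, 0)) * f (pt (e, i, 0))) + wt (e, i, 1) * (f (pt (e, i, 1)) * f (pt (e, i, 1))))"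
      using Z_pos by (simp add: wt_def pt_def power2_eq_square add_divide_distrib distrib_left)
  qed
  finally show ?thesis .
qed

lemma I_pos: assumes "x \<in> P" "f x \<noteq> 0" shows "0 < I f f"
proof -
  obtain j where j: "j \<in> J" "x = pt j" using assms pt_image by blast
  have "0 < f (pt j) * f (pt j)" using assms j by (metis not_real_square_gt_zero)
  then have "0 < wt j * (f (pt j) * f (pt j))" using wt_pos[OF j(1)] by simp
  also have "\<dots> \<le> I f f"
    unfolding I_def using j finite_J wt_pos
    by (intro member_le_sum[of j J "\<lambda>j. wt j * (f (pt j) * f (pt j))"]) (auto simp: less_imp_le)
  finally show ?thesis .
qed

text \<open>A test function vanishing on the support vanishes at all nodes by
  \<open>P_msupport\<close>, and its pairing with the interpolant sees node values only.\<close>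

lemma ext_H1_mu: "ext f \<in> H1_mu G l \<mu>"
proof -
  have "A f g = 0" if "\<forall>x\<in>msupport G l \<mu>. g x = 0" for g
  proof -
    have "g (node e i) = 0" if "e \<in> arcs G" "i \<le> n e" for e i
      using node_P[OF that] P_msupport \<open>\<forall>x\<in>msupport G l \<mu>. g x = 0\<close> by blast
    then show ?thesis by (auto simp: A_def incr_def intro!: sum.neutral)
  qed
  moreover have "gpoints G l - (gpoints G l - msupport G l \<mu>) = msupport G l \<mu>"
    by (auto simp: msupport_def)
  ultimately show ?thesis
    using ext_H1[of f] by (simp add: H1_mu_def harmonic_on_graph_def qform_ext)
qed

end

text \<open>The uniform bound rules out an infinite basis, for which \<open>dim\<close> would be the
  default 0 and the inequality could fail.\<close>

lemma (in vector_space) card_le_dim_bounded: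
  assumes bounded: "\<And>D. finite D \<Longrightarrow> independent D \<Longrightarrow> D \<subseteq> V \<Longrightarrow> card D \<le> N"
    and D: "finite D" "independent D" "D \<subseteq> V"
  shows "card D \<le> dim V"
proof -
  obtain B where B: "B \<subseteq> V" "independent B" "V \<subseteq> span B" "card B = dim V"
    by (rule basis_exists[of V])
  have "finite B"
  proof (rule ccontr)
    assume "infinite B"
    then obtain D where D: "D \<subseteq> B" "finite D" "card D = Suc N"
      using infinite_arbitrarily_large by metis
    then show False using bounded[of D] independent_mono[OF B(2) D(1)] B(1) by auto
  qed
  then show ?thesis using independent_span_bound[OF _ D(2), of B] D(3) B(3,4) by auto
qed

context subdivision
begin

section \<open>Eigenvalues of the node measure\<close>

lemma A_sym: "A f g = A g f" and I_sym: "I f g = I g f"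
  by (simp_all add: A_def I_def mult.commute)

lemma A_add: "A (f + g) u = A f u + A g u" and I_add: "I (f + g) u = I f u + I g u"
  by (simp_all add: A_def I_def incr_def algebra_simps add_divide_distrib diff_divide_distrib
      sum.distrib sum_subtractf)

lemma A_scale: "A (\<lambda>x. c * f x) u = c * A f u" and I_scale: "I (\<lambda>x. c * f x) u = c * I f u"
  unfolding A_def I_def incr_def sum_distrib_left
  by (intro sum.cong refl; simp add: algebra_simps diff_divide_distrib)+

lemma pencil: "symmetric_pencil A I P"
proof (unfold_locales; (rule finite_P A_sym I_sym A_add I_add A_scale I_scale)?)
  show "continuous_on UNIV (\<lambda>f. A f f)"
    unfolding A_def incr_def
    by (intro continuous_intros continuous_on_product_coordinates) (use h_pos in force)
  show "continuous_on UNIV (I f)" for f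
    unfolding I_def by (intro continuous_intros continuous_on_product_coordinates)
  show "continuous_on UNIV (\<lambda>f. I f f)"
    unfolding I_def by (intro continuous_intros continuous_on_product_coordinates)
  fix f :: "('v, 'e) gpoint \<Rightarrow> real" assume 0: "\<And>x. x \<notin> P \<Longrightarrow> f x = 0" and "f \<noteq> 0"
  then obtain x where x: "f x \<noteq> 0" by (metis ext zero_fun_apply)
  then have "x \<in> P" using 0 by blast
  then show "0 < I f f" using x by (rule I_pos)
qed

interpretation sp: symmetric_pencil A I P
  by (rule pencil)

lemma I_cong: "(\<And>x. x \<in> P \<Longrightarrow> f x = f' x) \<Longrightarrow> (\<And>x. x \<in> P \<Longrightarrow> g x = g' x) \<Longrightarrow> I f g = I f' g'"
  unfolding I_def using pt_image by (intro sum.cong refl) (metis imageI)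

lemma A_cong:
  assumes "\<And>x. x \<in> P \<Longrightarrow> g x = g' x" shows "A f g = A f g'"
  unfolding A_def incr_def by (intro sum.cong refl) (simp add: assms node_P)

text \<open>Evaluation at the nodes separates eigenfunctions: one that vanishes on \<open>P\<close>
  has norm 0 for this measure. It supplies the uniform bound that \<open>card_le_dim_bounded\<close>
  asks for.\<close>

lemma eigenspace_card_le:
  assumes D: "finite D" "fun_space.independent D" "D \<subseteq> gm.E \<eta>"
  shows "card D \<le> card P"
proof (rule ccontr)
  assume "\<not> card D \<le> card P"
  then have card: "card P < card D" by simp
  have "\<exists>f\<in>fun_space.span D. f \<noteq> 0 \<and> (\<forall>c\<in>P. f c = 0)"
    by (rule fun_space.ex_common_zero[where \<phi>="\<lambda>c f. f c" and V=UNIV, OF finite_P D(1,2) card]) simp_all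
  then obtain f where f: "f \<in> fun_space.span D" "f \<noteq> 0" "\<forall>c\<in>P. f c = 0" by blast
  have fE: "f \<in> gm.E \<eta>" using f(1) fun_space.span_minimal[OF D(3) gm.E_subspace] by blast
  have "gm.ip f f = I f f" using gm.E_H1[OF fE] by (intro ip_eq_I)
  also have "\<dots> = 0" unfolding I_def using f(3) pt_image by (intro sum.neutral) auto
  finally show False using gm.E_zero[OF fE] f(2) by simp
qed

lemma multiplicity_ge:
  assumes "finite D" "fun_space.independent D" "D \<subseteq> gm.E \<eta>"
  shows "card D \<le> multiplicity_of G l \<mu> \<eta>"
  unfolding multiplicity_of_def
  by (rule fun_space.card_le_dim_bounded[OF _ assms]) (rule eigenspace_card_le)

lemma V_eqI:
  assumes "b \<in> sp.V" "c \<in> sp.V" "\<And>x. x \<in> P \<Longrightarrow> b x = c x" shows "b = c"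
proof
  fix x show "b x = c x" using assms by (cases "x \<in> P") (auto simp: sp.V_def)
qed

lemma inj_on_ext: "inj_on ext sp.V"
proof (rule inj_onI)
  fix b c assume bc: "b \<in> sp.V" "c \<in> sp.V" "ext b = ext c"
  show "b = c" by (rule V_eqI[OF bc(1,2)]) (metis bc(3) ext_P)
qed

lemma independent_ext:
  assumes B: "finite B" "fun_space.independent B" "B \<subseteq> sp.V"
  shows "fun_space.independent (ext ` B)"
proof (rule fun_space.independent_if_scalars_zero)
  show "finite (ext ` B)" using B(1) by simp
  have inj: "inj_on ext B" using inj_on_ext B(3) by (rule inj_on_subset)
  fix u g assume 0: "(\<Sum>f\<in>ext ` B. (\<lambda>x. u f * f x)) = 0" and g: "g \<in> ext ` B"
  then obtain b where b: "b \<in> B" "g = ext b" by blast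
  have "(\<Sum>b\<in>B. (\<lambda>x. u (ext b) * b x)) = 0"
  proof (rule V_eqI)
    show "(\<Sum>b\<in>B. (\<lambda>x. u (ext b) * b x)) \<in> sp.V"
      using B(3) fun_space.subspace_scale[OF sp.V_subspace]
      by (intro fun_space.subspace_sum[OF sp.V_subspace]) blast
    show "0 \<in> sp.V" by (rule fun_space.subspace_0[OF sp.V_subspace])
    fix x assume x: "x \<in> P"
    have "(\<Sum>b\<in>B. (\<lambda>x. u (ext b) * b x)) x = (\<Sum>b\<in>B. u (ext b) * ext b x)"
      by (simp add: fun_sum_apply ext_P[OF x])
    also have "\<dots> = (\<Sum>f\<in>ext ` B. (\<lambda>x. u f * f x)) x"
      by (simp add: fun_sum_apply sum.reindex[OF inj])
    finally show "(\<Sum>b\<in>B. (\<lambda>x. u (ext b) * b x)) x = 0 x" unfolding 0 .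
  qed
  from fun_space.independentD[OF B(2,1) subset_refl this b(1)] show "u g = 0" by (simp add: b(2))
qed

text \<open>Both sides of the equation see the test function at the nodes only, so it may be
  replaced by its cut-off to \<open>P\<close>, which lies in \<open>V\<close>.\<close>

lemma ext_eigenspace:
  assumes "\<forall>u\<in>sp.V. A b u = \<eta> * I b u"
  shows "ext b \<in> gm.E \<eta>"
  unfolding gm.E_iff
proof (intro conjI ballI ext_H1_mu)
  fix \<phi> assume "\<phi> \<in> H1_mu G l \<mu>"
  then have \<phi>: "\<phi> \<in> H1 G l" by (rule gm.H1_mu_H1)
  define u where "u x = (if x \<in> P then \<phi> x else 0)" for x
  have "qform G l (ext b) \<phi> = A b \<phi>" by (rule qform_ext[OF \<phi>])
  also have "\<dots> = A b u" by (rule A_cong) (simp add: u_def)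
  also have "\<dots> = \<eta> * I b u" using assms by (simp add: sp.V_def u_def)
  also have "I b u = I (ext b) \<phi>" by (rule I_cong) (simp_all add: u_def ext_P)
  also have "\<dots> = gm.ip (ext b) \<phi>" by (rule ip_eq_I[symmetric, OF ext_H1 \<phi>])
  finally show "qform G l (ext b) \<phi> = \<eta> * gm.ip (ext b) \<phi>" .
qed

lemma eigenvalue_k_le:
  assumes k: "k < card P"
  shows "eigenvalue_k G l \<mu> k \<le> ereal (2 * Z)"
proof -
  obtain B where B: "finite B" "card B = card P" "B \<subseteq> sp.V" "0 \<notin> B" "fun_space.independent B"
    "\<forall>b\<in>B. \<exists>\<eta>. \<forall>u\<in>sp.V. A b u = \<eta> * I b u"
    by (rule sp.ex_eigenbasis)
  from bchoice[OF B(6)] obtain \<eta> where \<eta>: "\<And>b. b \<in> B \<Longrightarrow> \<forall>u\<in>sp.V. A b u = \<eta> b * I b u" by blast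
  have extE: "ext b \<in> gm.E (\<eta> b)" if "b \<in> B" for b by (rule ext_eigenspace[OF \<eta>[OF that]])
  have "\<eta> b \<in> eigenvalues G l \<mu> \<and> \<eta> b \<le> 2 * Z" if b: "b \<in> B" for b
  proof
    have bV: "b \<in> sp.V" "b \<noteq> 0" using b B(3,4) by blast+
    then have pos: "0 < I b b" by (rule sp.V_pos)
    have "A b b = \<eta> b * I b b" using \<eta>[OF b] bV(1) by blast
    then have "\<eta> b * I b b \<le> 2 * Z * I b b" using A_le_I[of b] by simp
    then show "\<eta> b \<le> 2 * Z" using pos by simp
    have "ext b \<noteq> 0"
    proof
      assume 0: "ext b = 0"
      have "b = 0"
        by (rule V_eqI[OF bV(1) fun_space.subspace_0[OF sp.V_subspace]]) (metis 0 ext_P)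
      then show False using bV(2) by simp
    qed
    then show "\<eta> b \<in> eigenvalues G l \<mu>" using extE[OF b] by (auto simp: eigenvalues_def)
  qed
  then have S: "finite (\<eta> ` B) \<and> \<eta> ` B \<subseteq> {\<theta> \<in> eigenvalues G l \<mu>. \<theta> \<le> 2 * Z}"
    using B(1) by auto
  \<comment> \<open>Grouping by eigenvalue: distinct vectors of \<open>B\<close> may share one, and
    each group lies in a single eigenspace.\<close>
  have "card B = (\<Sum>\<theta>\<in>\<eta> ` B. card {b \<in> B. \<eta> b = \<theta>})"
    using sum.image_gen[OF B(1), of "\<lambda>_. 1::nat" \<eta>] by simp
  also have "\<dots> \<le> (\<Sum>\<theta>\<in>\<eta> ` B. multiplicity_of G l \<mu> \<theta>)"
  proof (rule sum_mono)
    fix \<theta>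
    let ?B = "{b \<in> B. \<eta> b = \<theta>}"
    have sub: "?B \<subseteq> B" by blast
    have "card ?B = card (ext ` ?B)"
      using inj_on_ext B(3) by (intro card_image[symmetric] inj_on_subset[OF inj_on_ext]) blast
    also have "\<dots> \<le> multiplicity_of G l \<mu> \<theta>"
    proof (rule multiplicity_ge)
      show "fun_space.independent (ext ` ?B)"
        using B(1,3) fun_space.independent_mono[OF B(5) sub] by (intro independent_ext) auto
    qed (use B(1) extE in auto)
    finally show "card ?B \<le> multiplicity_of G l \<mu> \<theta>" .
  qed
  finally have "k < (\<Sum>\<theta>\<in>\<eta> ` B. multiplicity_of G l \<mu> \<theta>)" using k B(2) by simp
  then show ?thesis
    unfolding eigenvalue_k_def using S by (intro Inf_lower) blast
qed

text \<open>Interior nodes belong to one edge and one index each. Leaving out the vertices, which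
  edges may share, costs only a bounded number.\<close>

lemma card_P_ge: "(\<Sum>e\<in>arcs G. n e - 1) \<le> card P"
proof -
  let ?S = "Sigma (arcs G) (\<lambda>e. {1..<n e})"
  have inner: "node e i = Inner e (real i * h e)" if "e \<in> arcs G" "i \<in> {1..<n e}" for e i
  proof -
    have "real i * h e < real (n e) * h e" "0 < real i * h e" using that h_pos by auto
    then show ?thesis using n_h[OF that(1)] by (simp add: node_def edge_point_def)
  qed
  have "inj_on (\<lambda>(e, i). node e i) ?S"
  proof (rule inj_onI, clarify)
    fix e i d j assume *: "e \<in> arcs G" "i \<in> {1..<n e}" "d \<in> arcs G" "j \<in> {1..<n d}" "node e i = node d j"
    then show "e = d \<and> i = j" using inner[of e i] inner[of d j] h_pos[of e] by auto
  qed
  then have "card ((\<lambda>(e, i). node e i) ` ?S) = card ?S" by (rule card_image)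
  also have "card ?S = (\<Sum>e\<in>arcs G. n e - 1)" by simp
  finally show ?thesis
    using card_mono[OF finite_P, of "(\<lambda>(e, i). node e i) ` ?S"] node_P by force
qed

end

lemma (in metric_graph) eigenvalue_min_le:
  obtains C where "0 \<le> C" "\<forall>k. eigenvalue_min G l k \<le> ereal (4 * (real k + C)\<^sup>2 / total_length G l)"
proof -
  define L where "L = total_length G l"
  define R where "R = (\<Sum>e\<in>arcs G. 1 / l e)"
  define m where "m = real (card (arcs G))"
  \<comment> \<open>Large enough to complete the square: 2 m \<le> K covers the linear term 4 m x,
    and 4 L R \<le> K \<le> K^2 covers the constant one; the \<open>+ 1\<close> ensures K \<ge>
    1.\<close>
  define K where "K = 2 * m + 4 * L * R + 1"
  have L: "0 < L" unfolding L_def total_length_def using has_edge length_pos by (intro sum_pos) auto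
  have R: "0 \<le> R" unfolding R_def using length_pos by (intro sum_nonneg) (simp add: less_imp_le)
  have K1: "1 \<le> K" using L R by (simp add: K_def m_def)
  have "eigenvalue_min G l k \<le> ereal (4 * (real k + (1 + K))\<^sup>2 / L)" for k
  proof -
    define x where "x = real k + 1"
    \<comment> \<open>\<open>n e - 1 \<ge> l e * x / L\<close>, so that the interior nodes alone number at least \<open>k + 1\<close>.\<close>
    define n where "n e = Suc (nat \<lceil>l e * x / L\<rceil>)" for e
    interpret subdivision G l n by unfold_locales (simp add: n_def)
    have x: "0 \<le> x" by (simp add: x_def)
    have pos: "0 \<le> l e * x / L" if "e \<in> arcs G" for e
      using length_pos[OF that] x L by simp
    have "x = (\<Sum>e\<in>arcs G. l e * x / L)"
      using L unfolding L_def total_length_def by (simp flip: sum_divide_distrib sum_distrib_right)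
    also have "\<dots> \<le> (\<Sum>e\<in>arcs G. real (n e - 1))"
      by (intro sum_mono) (simp add: n_def real_nat_ceiling_ge)
    also have "\<dots> \<le> real (card P)" using card_P_ge by (simp flip: of_nat_sum)
    finally have "k < card P" by (simp add: x_def)
    then have "eigenvalue_min G l k \<le> ereal (2 * Z)"
      unfolding eigenvalue_min_def by (intro INF_lower2[OF \<mu>_borel_prob] eigenvalue_k_le)
    also have "2 * Z \<le> 4 * (real k + (1 + K))\<^sup>2 / L"
    proof -
      have "2 * Z = 4 * (\<Sum>e\<in>arcs G. (real (n e))\<^sup>2 / l e)"
        unfolding Z_def sum_distrib_left by (intro sum.cong refl) (simp add: h_def power2_eq_square)
      also have "(\<Sum>e\<in>arcs G. (real (n e))\<^sup>2 / l e) \<le> (\<Sum>e\<in>arcs G. l e * (x\<^sup>2 / L\<^sup>2) + 4 * x / L + 4 * (1 / l e))"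
      proof (rule sum_mono)
        fix e assume e: "e \<in> arcs G"
        have le: "real (n e) \<le> l e * x / L + 2"
          using pos[OF e] unfolding n_def by linarith
        have "(real (n e))\<^sup>2 \<le> (l e * x / L + 2)\<^sup>2" by (rule power_mono[OF le]) simp
        then have "(real (n e))\<^sup>2 / l e \<le> (l e * x / L + 2)\<^sup>2 / l e"
          using length_pos[OF e] by (intro divide_right_mono) auto
        also have "\<dots> = l e * (x\<^sup>2 / L\<^sup>2) + 4 * x / L + 4 * (1 / l e)"
          using length_pos[OF e] L by (simp add: field_simps power2_eq_square)
        finally show "(real (n e))\<^sup>2 / l e \<le> l e * (x\<^sup>2 / L\<^sup>2) + 4 * x / L + 4 * (1 / l e)" .
      qed
      also have "\<dots> = L * (x\<^sup>2 / L\<^sup>2) + m * (4 * x / L) + 4 * R"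
        unfolding sum.distrib R_def L_def m_def total_length_def by (simp add: sum_distrib_left sum_distrib_right sum_divide_distrib)
      also have "\<dots> = (x\<^sup>2 + 4 * m * x + 4 * L * R) / L"
        using L by (simp add: field_simps power2_eq_square)
      also have "\<dots> \<le> (x + K)\<^sup>2 / L"
      proof (intro divide_right_mono less_imp_le[OF L])
        have "2 * m \<le> K" using L R by (simp add: K_def)
        then have "2 * (2 * m * x) \<le> 2 * (K * x)" using x by (intro mult_left_mono mult_right_mono) auto
        moreover have "4 * L * R \<le> K * K"
        proof -
          have "4 * L * R \<le> K" by (simp add: K_def m_def)
          also have "\<dots> \<le> K * K" using K1 by simp
          finally show ?thesis .
        qed
        ultimately show "x\<^sup>2 + 4 * m * x + 4 * L * R \<le> (x + K)\<^sup>2"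
          by (simp add: power2_eq_square algebra_simps)
      qed
      finally show ?thesis by (simp add: x_def add.assoc)
    qed
    finally show ?thesis by simp
  qed
  then show ?thesis using that[of "1 + K"] K1 by (simp add: L_def)
qed

section \<open>From two-sided quadratic bounds to the asymptotics\<close>

lemma quadratic_asymptotics:
  fixes a :: "nat \<Rightarrow> ereal" and L C :: real and D :: nat
  assumes L: "0 < L" and C: "0 \<le> C"
    and lower: "\<And>k. D < k \<Longrightarrow> ereal (4 * (real k - D)\<^sup>2 / L) \<le> a k"
    and upper: "\<And>k. a k \<le> ereal (4 * (real k + C)\<^sup>2 / L)"
  shows "(\<lambda>r::real. real (card {k. a k \<le> ereal r}) / sqrt r) \<sim>[at_top] (\<lambda>_. sqrt L / 2)"
    and "(\<lambda>k. real_of_ereal (a k)) \<sim>[at_top] (\<lambda>k. 4 * (real k)\<^sup>2 / L)"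
proof -
  \<comment> \<open>The inverse of k \<mapsto> 4 k^2 / L: up to bounded shifts, \<open>s r\<close>
    is the index at which the sequence passes \<open>r\<close>.\<close>
  define s where "s r = sqrt L / 2 * sqrt r" for r
  have s_sq: "4 * (s r)\<^sup>2 / L = r" if "0 \<le> r" for r
    using L that by (simp add: s_def power_mult_distrib power_divide)
  have s0: "0 \<le> s r" if "0 \<le> r" for r using L that by (simp add: s_def)
  \<comment> \<open>Besides the upper count this gives finiteness, without which \<open>card\<close>
    would be 0 by default. Indices up to \<open>D\<close>, where \<open>lower\<close> is silent, are
    included since \<open>s r\<close> is non-negative.\<close>
  have sub: "{k. a k \<le> ereal r} \<subseteq> {..nat \<lfloor>s r + D\<rfloor>}" if r: "0 \<le> r" for r
  proof clarify
    fix k assume k: "a k \<le> ereal r"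
    have "real k \<le> s r + D"
    proof (cases "D < k")
      case True
      then have "ereal (4 * (real k - D)\<^sup>2 / L) \<le> ereal r" using lower k order_trans by blast
      then have "4 * (real k - D)\<^sup>2 / L \<le> 4 * (s r)\<^sup>2 / L" by (simp add: s_sq[OF r])
      then have "(real k - D)\<^sup>2 \<le> (s r)\<^sup>2" using L by (simp add: divide_le_cancel)
      then have "real k - D \<le> s r" using s0[OF r] by (rule power2_le_imp_le)
      then show ?thesis by simp
    next
      case False
      then show ?thesis using s0[OF r] by simp
    qed
    then show "k \<le> nat \<lfloor>s r + D\<rfloor>" by (rule le_nat_floor)
  qed
  have ub: "real (card {k. a k \<le> ereal r}) \<le> s r + (D + 1)" if r: "0 \<le> r" for r
  proof -
    have "card {k. a k \<le> ereal r} \<le> card {..nat \<lfloor>s r + D\<rfloor>}" by (rule card_mono[OF _ sub[OF r]]) simp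
    then have "real (card {k. a k \<le> ereal r}) \<le> real (nat \<lfloor>s r + D\<rfloor>) + 1" by simp
    also have "real (nat \<lfloor>s r + D\<rfloor>) \<le> s r + D" using s0[OF r] by (intro of_nat_floor) simp
    finally show ?thesis by simp
  qed
  have lb: "s r - C \<le> real (card {k. a k \<le> ereal r})" if r: "0 \<le> r" for r
  proof (cases "C \<le> s r")
    case True
    have "{..nat \<lfloor>s r - C\<rfloor>} \<subseteq> {k. a k \<le> ereal r}"
    proof clarify
      fix k assume "k \<le> nat \<lfloor>s r - C\<rfloor>"
      then have "real k \<le> real (nat \<lfloor>s r - C\<rfloor>)" by simp
      also have "\<dots> \<le> s r - C" using True by (intro of_nat_floor) simp
      finally have "(real k + C)\<^sup>2 \<le> (s r)\<^sup>2" using C by (intro power_mono) auto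
      then have "4 * (real k + C)\<^sup>2 / L \<le> 4 * (s r)\<^sup>2 / L" using L by (simp add: divide_right_mono)
      then have "ereal (4 * (real k + C)\<^sup>2 / L) \<le> ereal r" using s_sq[OF r] by simp
      with upper[of k] show "a k \<le> ereal r" by (rule order_trans)
    qed
    then have "card {..nat \<lfloor>s r - C\<rfloor>} \<le> card {k. a k \<le> ereal r}"
      by (rule card_mono[OF finite_subset[OF sub[OF r] finite_atMost]])
    then have "real (nat \<lfloor>s r - C\<rfloor>) + 1 \<le> real (card {k. a k \<le> ereal r})" by simp
    moreover have "s r - C \<le> real (nat \<lfloor>s r - C\<rfloor>) + 1" using True by linarith
    ultimately show ?thesis by linarith
  qed simp
  have s_lim: "((\<lambda>r. 1 + c / s r) \<longlongrightarrow> 1) at_top" for c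
  proof -
    have "filterlim s at_top at_top"
      unfolding s_def using L by (intro filterlim_tendsto_pos_mult_at_top[OF tendsto_const] sqrt_at_top) simp
    then have "((\<lambda>r. c / s r) \<longlongrightarrow> 0) at_top" by (rule real_tendsto_divide_at_top[OF tendsto_const])
    from tendsto_add[OF tendsto_const[of 1] this] show ?thesis by simp
  qed
  have s_pos: "0 < s r" if "0 < r" for r using L that by (simp add: s_def)
  show "(\<lambda>r::real. real (card {k. a k \<le> ereal r}) / sqrt r) \<sim>[at_top] (\<lambda>_. sqrt L / 2)"
  proof (rule asymp_equivI')
    have "((\<lambda>r. real (card {k. a k \<le> ereal r}) / s r) \<longlongrightarrow> 1) at_top"
    proof (rule tendsto_sandwich[OF _ _ s_lim[of "- C"] s_lim[of "D + 1"]])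
      show "\<forall>\<^sub>F r in at_top. 1 + - C / s r \<le> real (card {k. a k \<le> ereal r}) / s r"
        using eventually_gt_at_top[of 0]
      proof eventually_elim
        case (elim r)
        have "1 + - C / s r = (s r - C) / s r" using s_pos[OF elim] by (simp add: field_simps)
        also have "\<dots> \<le> real (card {k. a k \<le> ereal r}) / s r"
          using lb[of r] elim s_pos[OF elim] by (intro divide_right_mono) auto
        finally show ?case .
      qed
      show "\<forall>\<^sub>F r in at_top. real (card {k. a k \<le> ereal r}) / s r \<le> 1 + (D + 1) / s r"
        using eventually_gt_at_top[of 0]
      proof eventually_elim
        case (elim r)
        have "real (card {k. a k \<le> ereal r}) / s r \<le> (s r + (D + 1)) / s r"
          using ub[of r] elim s_pos[OF elim] by (intro divide_right_mono) auto
        also have "\<dots> = 1 + (D + 1) / s r" using s_pos[OF elim] by (simp add: field_simps)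
        finally show ?case .
      qed
    qed
    then show "((\<lambda>r. real (card {k. a k \<le> ereal r}) / sqrt r / (sqrt L / 2)) \<longlongrightarrow> 1) at_top"
      by (simp add: s_def mult_ac)
  qed
  show "(\<lambda>k. real_of_ereal (a k)) \<sim>[at_top] (\<lambda>k. 4 * (real k)\<^sup>2 / L)"
  proof (rule asymp_equivI')
    have lim: "(\<lambda>k. (1 + c / real k)\<^sup>2) \<longlonglongrightarrow> 1" for c
      using tendsto_power[OF tendsto_add[OF tendsto_const[of 1] lim_const_over_n[of c]], of 2] by simp
    have bounds: "(1 + - real D / real k)\<^sup>2 \<le> real_of_ereal (a k) / (4 * (real k)\<^sup>2 / L) \<and>
      real_of_ereal (a k) / (4 * (real k)\<^sup>2 / L) \<le> (1 + C / real k)\<^sup>2" if k: "D < k" for k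
    proof -
      \<comment> \<open>The two bounds exclude both infinite values, so \<open>real_of_ereal\<close>
        loses nothing here.\<close>
      obtain y where y: "a k = ereal y"
        using lower[OF k] upper[of k] by (cases "a k") auto
      have k0: "0 < real k" using k by simp
      have q: "(1 + c / real k)\<^sup>2 = (4 * (real k + c)\<^sup>2 / L) / (4 * (real k)\<^sup>2 / L)" for c
      proof -
        have "1 + c / real k = (real k + c) / real k" using k0 by (simp add: field_simps)
        then show ?thesis using L k0 by (simp add: power_divide)
      qed
      have "0 \<le> 4 * (real k)\<^sup>2 / L" using L by simp
      moreover have "4 * (real k + - real D)\<^sup>2 / L \<le> y" "y \<le> 4 * (real k + C)\<^sup>2 / L"
        using lower[OF k] upper[of k] y by simp_all
      ultimately show ?thesis unfolding q y by (simp only: real_of_ereal.simps divide_right_mono simp_thms)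
    qed
    show "(\<lambda>k. real_of_ereal (a k) / (4 * (real k)\<^sup>2 / L)) \<longlonglongrightarrow> 1"
    proof (rule tendsto_sandwich[OF _ _ lim[of "- real D"] lim[of C]])
      show "\<forall>\<^sub>F k in sequentially. (1 + - real D / real k)\<^sup>2 \<le> real_of_ereal (a k) / (4 * (real k)\<^sup>2 / L)"
        using eventually_gt_at_top[of D] by eventually_elim (use bounds in blast)
      show "\<forall>\<^sub>F k in sequentially. real_of_ereal (a k) / (4 * (real k)\<^sup>2 / L) \<le> (1 + C / real k)\<^sup>2"
        using eventually_gt_at_top[of D] by eventually_elim (use bounds in blast)
    qed
  qed
qed

theorem theorem7p4:
  fixes G :: "('v, 'e) pre_digraph" and l :: "'e \<Rightarrow> real"
  assumes "metric_graph G l"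
  shows "(\<lambda>r::real. real (N_min G l r) / sqrt r) \<sim>[at_top] (\<lambda>_. sqrt (total_length G l) / 2) \<and>
    (\<lambda>k::nat. real_of_ereal (eigenvalue_min G l k)) \<sim>[at_top]
      (\<lambda>k. 4 * (real k)\<^sup>2 / total_length G l)"
proof -
  interpret metric_graph G l by fact
  let ?L = "total_length G l" and ?D = "card (verts G)"
  have L: "0 < ?L" unfolding total_length_def using has_edge length_pos by (intro sum_pos) auto
  obtain C where C: "0 \<le> C" "\<forall>k. eigenvalue_min G l k \<le> ereal (4 * (real k + C)\<^sup>2 / ?L)"
    by (rule eigenvalue_min_le)
  have lower: "ereal (4 * (real k - ?D)\<^sup>2 / ?L) \<le> eigenvalue_min G l k" if k: "?D < k" for k
  proof (rule eigenvalue_min_ge)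
    show "0 < 4 * (real k - ?D)\<^sup>2 / ?L" using L k by simp
    \<comment> \<open>This choice of r makes sqrt (L r) / 2 equal to k minus the number of vertices,
      so the condition of \<open>eigenvalue_min_ge\<close> becomes k < k + 1.\<close>
    have "?L * (4 * (real k - ?D)\<^sup>2 / ?L) = (2 * (real k - ?D))\<^sup>2"
      using L by (simp only: power_mult_distrib) simp
    then have eq: "sqrt (?L * (4 * (real k - ?D)\<^sup>2 / ?L)) = 2 * (real k - ?D)"
      using k by (simp only: real_sqrt_abs) simp
    show "?D + sqrt (?L * (4 * (real k - ?D)\<^sup>2 / ?L)) / 2 < real k + 1"
      unfolding eq by (simp add: field_simps)
  qed
  show ?thesis
    unfolding N_min_def using quadratic_asymptotics[OF L C(1) lower C(2)[rule_format]] by blast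
qed

end
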